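(* Let $n\ge2$, let $\boldsymbol a=(a_1,\dots,a_{n-1}),\boldsymbol b=(b_1,\dots,b_{n-1})\in\mathbb Z_{\ge0}^{n-1}$, and let $p'\neq p$ be integers such that $a_n:=p'-1-\sum_{i=1}^{n-1}(a_i+1)$ and $b_n:=p-1-\sum_{i=1}^{n-1}(b_i+1)$ belong to $\mathbb Z_{\ge0}$. Assume the resonance $q_1^{p'}q_3^p=1$, in the precise sense that for $x,y\in\mathbb Z$ one has $q_1^xq_3^y=1$ if and only if $x=p'\kappa$, $y=p\kappa$ for some $\kappa\in\mathbb Z$; let $u\in\mathbb C^\times$. Then the action of the operators $\psi^\pm(z),e(z),f(z)$ on $\mathcal M^{p',p}_{\boldsymbol a,\boldsymbol b}(u)$ (described in the context) is well-defined and gives $\mathcal M^{p',p}_{\boldsymbol a,\boldsymbol b}(u)$ the structure of a graded $\mathcal E$-module.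
   Context: **Algebra.** $q_1,q_2,q_3\in\mathbb C^\times$ satisfy $q_1q_2q_3=1$ and none of them is a root of unity. Put $g(z,w)=(z-q_1w)(z-q_2w)(z-q_3w)$, $\delta(z)=\sum_{k\in\mathbb Z}z^k$. The algebra $\mathcal E$ is the associative algebra generated by $e_i,f_i$ ($i\in\mathbb Z$), $\psi^+_i,\psi^-_{-i}$ ($i\ge0$) and $(\psi_0^\pm)^{-1}$; with $e(z)=\sum_i e_iz^{-i}$, $f(z)=\sum_i f_iz^{-i}$, $\psi^\pm(z)=\sum_{\pm i\ge0}\psi^\pm_iz^{-i}$ the relations are: $g(z,w)e(z)e(w)=-g(w,z)e(w)e(z)$; $g(w,z)f(z)f(w)=-g(z,w)f(w)f(z)$; $g(z,w)\psi^\pm(z)e(w)=-g(w,z)e(w)\psi^\pm(z)$; $g(w,z)\psi^\pm(z)f(w)=-g(z,w)f(w)\psi^\pm(z)$; $[e(z),f(w)]=\frac{\delta(z/w)}{g(1,1)}(\psi^+(z)-\psi^-(z))$; all $\psi^\pm_i$ commute with each other; $\psi^\pm_0(\psi^\pm_0)^{-1}=(\psi^\pm_0)^{-1}\psi^\pm_0=1$; $[e_0,[e_1,e_{-1}]]=0=[f_0,[f_1,f_{-1}]]$. $\mathcal E$ is $\mathbb Z$-graded by $\deg e_i=1$, $\deg f_i=-1$, $\deg\psi_i^\pm=0$. **Fock spaces.** $\mathcal P^+$ is the set of finite partitions $\lambda=(\lambda_1\ge\lambda_2\ge\cdots)$ (integers, finitely many nonzero), $\emptyset$ the empty partition. $\mathcal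 F(u)$ has basis $|\lambda\rangle$, $\lambda\in\mathcal P^+$. Set $$\psi_{\lambda,j}(x)=\frac{(1-q_1^{\lambda_j}q_3^{j}x)(1-q_1^{\lambda_j}q_2q_3^{j-1}x)}{(1-q_1^{\lambda_j}q_3^{j-1}x)(1-q_1^{\lambda_j-1}q_3^{j-1}x)},\qquad \psi_\lambda(x)=\frac{1-q_2x}{1-x}\prod_{j\ge1}\frac{\psi_{\lambda,j}(x)}{\psi_{\emptyset,j}(x)}$$ (all but finitely many factors are 1). **Tensor product action (independent parameters $q_1,q_3,u_1,\dots,u_n$).** The basis is $|\boldsymbol\lambda\rangle=|\lambda^{(1)}\rangle\otimes\dots\otimes|\lambda^{(n)}\rangle$, $\lambda^{(i)}\in\mathcal P^+$, of degree $\sum_{i,s}\lambda^{(i)}_s$; $\boldsymbol\lambda+\mathbf 1^{(i)}_s$ is $\boldsymbol\lambda$ with $\lambda^{(i)}_s$ increased by 1. $\psi^\pm(z)|\boldsymbol\lambda\rangle=\prod_i\psi_{\lambda^{(i)}}(u_i/z)|\boldsymbol\lambda\rangle$ (expanded in $z^{\mp1}$). For $\boldsymbol\lambda,\boldsymbol\lambda+\mathbf 1_s^{(i)}$ both $n$-tuples of finite partitions and $v=q_1^{\lambda^{(i)}_s}q_3^{s-1}u_i$, $$\langle\boldsymbol\lambda+\mathbf1_s^{(i)}|e(z)|\boldsymbol\lambda\rangle=\frac{\delta(v/z)}{1-q_1}\prod_{j<i}\psi_{\lambda^{(j)}}(u_j/v)\prod_{t<s}\psi_{\lambda^{(i)},t}(u_i/v),$$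 $$\langle\boldsymbol\lambda|f(z)|\boldsymbol\lambda+\mathbf1_s^{(i)}\rangle=\frac{q_1\delta(v/z)}{1-q_1}\cdot\frac{1-q_2q_3^{s}u_i/v}{1-q_3^su_i/v}\prod_{t>s}\frac{\psi_{\lambda^{(i)},t}(u_i/v)}{\psi_{\emptyset,t}(u_i/v)}\prod_{j>i}\psi_{\lambda^{(j)}}(u_j/v);$$ all other matrix coefficients of $e(z),f(z)$ are zero. **The space $\mathcal M_{\boldsymbol a,\boldsymbol b}(u)$ for generic $q_1,q_3,u$.** Specialize $u_1=u$, $u_i=u_{i+1}q_1^{a_i+1}q_3^{b_i+1}$ for $i=1,\dots,n-1$, and let $\mathcal M_{\boldsymbol a,\boldsymbol b}(u)$ be the span of the $|\lambda^{(1)},\dots,\lambda^{(n)}\rangle$ with $\lambda^{(i)}_s\ge\lambda^{(i+1)}_{s+b_i}-a_i$ for $s\ge1$, $i=1,\dots,n-1$. Its matrix coefficients between basis vectors are obtained from those of the tensor product (rational functions of independent $q_1,q_3,u_1,\dots,u_n$, $q_2=(q_1q_3)^{-1}$, times delta functions) by cancelling common factors and then substituting the special $u_i$; they are regular and become rational functions of $q_1,q_3,u$ times delta functions. **The space $\mathcal M^{p',p}_{\boldsymbol a,\boldsymbol b}(u)$.** With $\lambda^{(n+1)}=\lambda^{(1)}$, $$\mathcal M^{p',p}_{\boldsymbol a,\boldsymbol b}(u)=\operatorname{span}\{|\lambda^{(1)},\dots,\lambda^{(n)}\rangle:\ \lambda^{(i)}\in\mathcal P^+,\ \lambda^{(i)}_s\ge\lambda^{(i+1)}_{s+b_i}-a_i,\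 s\in\mathbb Z_{\ge1},\ i=1,\dots,n\},$$ graded by $\deg|\lambda^{(1)},\dots,\lambda^{(n)}\rangle=\sum_{i=1}^n\sum_{s\ge1}\lambda^{(i)}_s$. The matrix coefficients of $\psi^\pm(z),e(z),f(z)$ on it between its basis vectors are the corresponding matrix coefficients of $\mathcal M_{\boldsymbol a,\boldsymbol b}(u)$, where in the rational functions of $q_1,q_3,u$ one first cancels common factors and then substitutes values with $q_1^{p'}q_3^p=1$. "Well-defined" means that no pole occurs in this substitution. *)

theory Defs
  imports
    Complex_Main
    "HOL-Library.Poly_Mapping"
    "HOL-Library.FuncSet"
    "HOL-Computational_Algebra.Computational_Algebra"
    "HOL-Algebra.QuotRing"
begin

section \<open>The algebra\<close>

text \<open>The constructor \<open>PsiM k\<close> stands for \<open>\<psi>\<^sup>-\<^sub>-\<^sub>k\<close>.\<close>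

datatype mode = E int | F int | PsiP nat | PsiM nat

datatype generator = Mode mode | PsiP0_inv | PsiM0_inv

text \<open>Words form the free monoid, so that finitely supported functions on words, with the
  convolution product of \<^theory>\<open>HOL-Library.Poly_Mapping\<close>, are the free associative algebra.\<close>

instantiation list :: (type) monoid_add
begin

definition zero_list :: "'a list" where "zero_list = []"

definition plus_list :: "'a list \<Rightarrow> 'a list \<Rightarrow> 'a list" where "plus_list = (@)"

instance
  by standard (simp_all add: zero_list_def plus_list_def)

end

type_synonym free_alg = "generator list \<Rightarrow>\<^sub>0 complex"

definition fgen :: "generator \<Rightarrow> free_alg" where
  "fgen x = Poly_Mapping.single [x] 1"

definition fconst :: "complex \<Rightarrow> free_alg" where
  "fconst c = Poly_Mapping.single [] c"

definition ge :: "int \<Rightarrow> free_alg" where "ge i = fgen (Mode (E i))"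

definition gf :: "int \<Rightarrow> free_alg" where "gf i = fgen (Mode (F i))"

definition gpsip :: "int \<Rightarrow> free_alg" where
  "gpsip i = (if 0 \<le> i then fgen (Mode (PsiP (nat i))) else 0)"

definition gpsim :: "int \<Rightarrow> free_alg" where
  "gpsim i = (if i \<le> 0 then fgen (Mode (PsiM (nat (- i)))) else 0)"

definition gcubic :: "'r::comm_ring_1 \<Rightarrow> 'r \<Rightarrow> 'r \<Rightarrow> 'r \<Rightarrow> 'r \<Rightarrow> 'r" where
  "gcubic q1 q2 q3 z w = (z - q1 * w) * (z - q2 * w) * (z - q3 * w)"

text \<open>Polynomials in \<open>z, w\<close> are of type \<^typ>\<open>complex poly poly\<close>, with \<open>z\<close> the outer variable.\<close>

definition zvar :: "complex poly poly" where "zvar = [:0, 1:]"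

definition wvar :: "complex poly poly" where "wvar = [:[:0, 1:]:]"

definition gzw :: "complex \<Rightarrow> complex \<Rightarrow> complex \<Rightarrow> complex poly poly" where
  "gzw q1 q2 q3 = gcubic [:[:q1:]:] [:[:q2:]:] [:[:q3:]:] zvar wvar"

definition gwz :: "complex \<Rightarrow> complex \<Rightarrow> complex \<Rightarrow> complex poly poly" where
  "gwz q1 q2 q3 = gcubic [:[:q1:]:] [:[:q2:]:] [:[:q3:]:] wvar zvar"

text \<open>A formal series in \<open>z\<^sup>\<plusminus>\<^sup>1, w\<^sup>\<plusminus>\<^sup>1\<close> is represented by the function \<open>D\<close> for which \<open>D i j\<close> is the
  coefficient of \<open>z\<^sup>-\<^sup>i w\<^sup>-\<^sup>j\<close>; hence multiplication by \<open>z\<^sup>m w\<^sup>k\<close> shifts \<open>(i, j)\<close> to \<open>(i + m, j + k)\<close>.\<close>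

definition series_mult ::
    "complex poly poly \<Rightarrow> (int \<Rightarrow> int \<Rightarrow> free_alg) \<Rightarrow> int \<Rightarrow> int \<Rightarrow> free_alg" where
  "series_mult P D i j =
     (\<Sum>m\<le>Polynomial.degree P. \<Sum>k\<le>Polynomial.degree (Polynomial.coeff P m).
        fconst (Polynomial.coeff (Polynomial.coeff P m) k) * D (i + int m) (j + int k))"

definition comm :: "free_alg \<Rightarrow> free_alg \<Rightarrow> free_alg" where
  "comm x y = x * y - y * x"

text \<open>Every element listed is the difference of the two sides of a defining relation, taken
  coefficientwise.  In \<open>rel_ef\<close> the coefficient of \<open>z\<^sup>-\<^sup>i w\<^sup>-\<^sup>j\<close> in \<open>\<delta>(z/w) \<psi>(z)\<close> is \<open>\<psi>\<^bsub>i+j\<^esub>\<close>.\<close>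

definition rel_ee :: "complex \<Rightarrow> complex \<Rightarrow> complex \<Rightarrow> free_alg set" where
  "rel_ee q1 q2 q3 =
     {series_mult (gzw q1 q2 q3) (\<lambda>i j. ge i * ge j) i j
        + series_mult (gwz q1 q2 q3) (\<lambda>i j. ge j * ge i) i j | i j. True}"

definition rel_ff :: "complex \<Rightarrow> complex \<Rightarrow> complex \<Rightarrow> free_alg set" where
  "rel_ff q1 q2 q3 =
     {series_mult (gwz q1 q2 q3) (\<lambda>i j. gf i * gf j) i j
        + series_mult (gzw q1 q2 q3) (\<lambda>i j. gf j * gf i) i j | i j. True}"

definition rel_psie :: "complex \<Rightarrow> complex \<Rightarrow> complex \<Rightarrow> free_alg set" where
  "rel_psie q1 q2 q3 =
     {series_mult (gzw q1 q2 q3) (\<lambda>i j. psi i * ge j) i j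
        + series_mult (gwz q1 q2 q3) (\<lambda>i j. ge j * psi i) i j | psi i j. psi \<in> {gpsip, gpsim}}"

definition rel_psif :: "complex \<Rightarrow> complex \<Rightarrow> complex \<Rightarrow> free_alg set" where
  "rel_psif q1 q2 q3 =
     {series_mult (gwz q1 q2 q3) (\<lambda>i j. psi i * gf j) i j
        + series_mult (gzw q1 q2 q3) (\<lambda>i j. gf j * psi i) i j | psi i j. psi \<in> {gpsip, gpsim}}"

definition rel_ef :: "complex \<Rightarrow> complex \<Rightarrow> complex \<Rightarrow> free_alg set" where
  "rel_ef q1 q2 q3 =
     {comm (ge i) (gf j)
        - fconst (1 / gcubic q1 q2 q3 1 1) * (gpsip (i + j) - gpsim (i + j)) | i j. True}"

definition rel_psipsi :: "free_alg set" where
  "rel_psipsi =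
     {comm (psi i) (psi' j) | psi psi' i j. psi \<in> {gpsip, gpsim} \<and> psi' \<in> {gpsip, gpsim}}"

definition rel_inv :: "free_alg set" where
  "rel_inv =
     {gpsip 0 * fgen PsiP0_inv - 1, fgen PsiP0_inv * gpsip 0 - 1,
      gpsim 0 * fgen PsiM0_inv - 1, fgen PsiM0_inv * gpsim 0 - 1}"

definition rel_serre :: "free_alg set" where
  "rel_serre =
     {comm (ge 0) (comm (ge 1) (ge (-1))), comm (gf 0) (comm (gf 1) (gf (-1)))}"

definition relations :: "complex \<Rightarrow> complex \<Rightarrow> complex \<Rightarrow> free_alg set" where
  "relations q1 q2 q3 =
     rel_ee q1 q2 q3 \<union> rel_ff q1 q2 q3 \<union> rel_psie q1 q2 q3 \<union> rel_psif q1 q2 q3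
     \<union> rel_ef q1 q2 q3 \<union> rel_psipsi \<union> rel_inv \<union> rel_serre"

definition free_ring :: "free_alg ring" where
  "free_ring = \<lparr>carrier = UNIV, mult = (*), one = 1, zero = 0, add = (+)\<rparr>"

definition rel_ideal :: "complex \<Rightarrow> complex \<Rightarrow> complex \<Rightarrow> free_alg set" where
  "rel_ideal q1 q2 q3 = Idl\<^bsub>free_ring\<^esub> (relations q1 q2 q3)"

definition E_alg :: "complex \<Rightarrow> complex \<Rightarrow> complex \<Rightarrow> free_alg set ring" where
  "E_alg q1 q2 q3 = free_ring Quot (rel_ideal q1 q2 q3)"

definition E_proj :: "complex \<Rightarrow> complex \<Rightarrow> complex \<Rightarrow> free_alg \<Rightarrow> free_alg set" where
  "E_proj q1 q2 q3 x = rel_ideal q1 q2 q3 +>\<^bsub>free_ring\<^esub> x"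

fun gen_degree :: "generator \<Rightarrow> int" where
  "gen_degree (Mode (E i)) = 1"
| "gen_degree (Mode (F i)) = - 1"
| "gen_degree x = 0"

definition E_homogeneous :: "complex \<Rightarrow> complex \<Rightarrow> complex \<Rightarrow> int \<Rightarrow> free_alg set set" where
  "E_homogeneous q1 q2 q3 d =
     E_proj q1 q2 q3 ` {x. \<forall>w \<in> Poly_Mapping.keys x. sum_list (map gen_degree w) = d}"


section \<open>Graded modules over an associative complex algebra\<close>

definition vscale :: "complex \<Rightarrow> ('b \<Rightarrow>\<^sub>0 complex) \<Rightarrow> ('b \<Rightarrow>\<^sub>0 complex)" where
  "vscale c v = Poly_Mapping.map ((*) c) v"

definition subspace_of_free :: "('b \<Rightarrow>\<^sub>0 complex) set \<Rightarrow> bool" where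
  "subspace_of_free V \<longleftrightarrow>
     0 \<in> V \<and> (\<forall>v\<in>V. \<forall>w\<in>V. v + w \<in> V) \<and> (\<forall>c. \<forall>v\<in>V. vscale c v \<in> V)"

text \<open>The map \<open>\<eta>\<close> is the structure map of the complex algebra \<open>A\<close>; the last clause says that the
  given scalar multiplication of \<open>V\<close> is the one induced by the action.\<close>

definition alg_module ::
    "('r, 'm) ring_scheme \<Rightarrow> (complex \<Rightarrow> 'r) \<Rightarrow> ('b \<Rightarrow>\<^sub>0 complex) set
      \<Rightarrow> ('r \<Rightarrow> ('b \<Rightarrow>\<^sub>0 complex) \<Rightarrow> ('b \<Rightarrow>\<^sub>0 complex)) \<Rightarrow> bool" where
  "alg_module A \<eta> V act \<longleftrightarrow>
     subspace_of_free V
     \<and> (\<forall>x\<in>carrier A. \<forall>v\<in>V. act x v \<in> V)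
     \<and> (\<forall>x\<in>carrier A. \<forall>v\<in>V. \<forall>w\<in>V. act x (v + w) = act x v + act x w)
     \<and> (\<forall>x\<in>carrier A. \<forall>y\<in>carrier A. \<forall>v\<in>V. act (x \<oplus>\<^bsub>A\<^esub> y) v = act x v + act y v)
     \<and> (\<forall>x\<in>carrier A. \<forall>y\<in>carrier A. \<forall>v\<in>V. act (x \<otimes>\<^bsub>A\<^esub> y) v = act x (act y v))
     \<and> (\<forall>v\<in>V. act \<one>\<^bsub>A\<^esub> v = v)
     \<and> (\<forall>c. \<forall>v\<in>V. act (\<eta> c) v = vscale c v)"

definition graded_alg_module ::
    "('r, 'm) ring_scheme \<Rightarrow> (complex \<Rightarrow> 'r) \<Rightarrow> (int \<Rightarrow> 'r set) \<Rightarrow> ('b \<Rightarrow>\<^sub>0 complex) set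
      \<Rightarrow> (int \<Rightarrow> ('b \<Rightarrow>\<^sub>0 complex) set) \<Rightarrow> ('r \<Rightarrow> ('b \<Rightarrow>\<^sub>0 complex) \<Rightarrow> ('b \<Rightarrow>\<^sub>0 complex)) \<Rightarrow> bool" where
  "graded_alg_module A \<eta> Adeg V Vdeg act \<longleftrightarrow>
     alg_module A \<eta> V act
     \<and> (\<forall>d. subspace_of_free (Vdeg d) \<and> Vdeg d \<subseteq> V)
     \<and> (\<forall>v\<in>V. \<exists>!w. finite {d. w d \<noteq> 0} \<and> (\<forall>d. w d \<in> Vdeg d) \<and> v = (\<Sum>d | w d \<noteq> 0. w d))
     \<and> (\<forall>k d. \<forall>x\<in>Adeg k. \<forall>v\<in>Vdeg d. act x v \<in> Vdeg (k + d))"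


section \<open>Rational functions and substitution\<close>

text \<open>Polynomials over \<open>\<complex>\<close> in the variables \<open>x\<^sub>0, x\<^sub>1, x\<^sub>2, \<dots>\<close>, where \<open>x\<^sub>0 = q\<^sub>1\<close>, \<open>x\<^sub>1 = q\<^sub>3\<close> and
  \<open>x\<^bsub>i+1\<^esub> = u\<^sub>i\<close> for \<open>i \<ge> 1\<close>.  After the first specialization only \<open>q\<^sub>1\<close>, \<open>q\<^sub>3\<close> and \<open>u = u\<^sub>1\<close> occur.\<close>

type_synonym mpol = "(nat \<Rightarrow>\<^sub>0 nat) \<Rightarrow>\<^sub>0 complex"

type_synonym ratfun = "mpol fract"

definition rconst :: "complex \<Rightarrow> ratfun" where
  "rconst c = Fraction_Field.Fract (Poly_Mapping.single 0 c) 1"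

definition rvar :: "nat \<Rightarrow> ratfun" where
  "rvar i = Fraction_Field.Fract (Poly_Mapping.single (Poly_Mapping.single i 1) 1) 1"

definition mpol_eval :: "(complex \<Rightarrow> 'k::field) \<Rightarrow> (nat \<Rightarrow> 'k) \<Rightarrow> mpol \<Rightarrow> 'k" where
  "mpol_eval \<iota> \<sigma> P =
     (\<Sum>m\<in>Poly_Mapping.keys P.
        \<iota> (Poly_Mapping.lookup P m) * (\<Prod>i\<in>Poly_Mapping.keys m. \<sigma> i ^ Poly_Mapping.lookup m i))"

text \<open>The class of \<^const>\<open>coprime\<close> does not contain \<^typ>\<open>mpol\<close>.\<close>

definition lowest_terms :: "ratfun \<Rightarrow> mpol \<Rightarrow> mpol \<Rightarrow> bool" where
  "lowest_terms R P Q \<longleftrightarrow>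
     Q \<noteq> 0 \<and> R = Fraction_Field.Fract P Q \<and> (\<forall>D. D dvd P \<longrightarrow> D dvd Q \<longrightarrow> D dvd 1)"

text \<open>Cancelling common factors, then substituting \<open>\<sigma>\<close>: regular if the reduced denominator does
  not vanish.  The reduced form is unique up to units, so the value is unambiguous.\<close>

definition regular_at :: "(complex \<Rightarrow> 'k::field) \<Rightarrow> (nat \<Rightarrow> 'k) \<Rightarrow> ratfun \<Rightarrow> bool" where
  "regular_at \<iota> \<sigma> R \<longleftrightarrow> (\<exists>P Q. lowest_terms R P Q \<and> mpol_eval \<iota> \<sigma> Q \<noteq> 0)"

definition subst_value :: "(complex \<Rightarrow> 'k::field) \<Rightarrow> (nat \<Rightarrow> 'k) \<Rightarrow> ratfun \<Rightarrow> 'k" where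
  "subst_value \<iota> \<sigma> R =
     (THE c. \<exists>P Q. lowest_terms R P Q \<and> mpol_eval \<iota> \<sigma> Q \<noteq> 0
        \<and> c = mpol_eval \<iota> \<sigma> P / mpol_eval \<iota> \<sigma> Q)"


section \<open>Tensor products of Fock spaces\<close>

text \<open>Parts are indexed from 1; the value at 0 is a dummy.\<close>

definition partitions :: "(nat \<Rightarrow> nat) set" where
  "partitions = {l. l 0 = 0 \<and> (\<forall>s\<ge>1. l (Suc s) \<le> l s) \<and> finite {s. l s \<noteq> 0}}"

definition psi_row :: "'k::field \<Rightarrow> 'k \<Rightarrow> (nat \<Rightarrow> nat) \<Rightarrow> nat \<Rightarrow> 'k \<Rightarrow> 'k" where
  "psi_row q1 q3 l j x =
     (let q2 = inverse (q1 * q3) in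
      ((1 - q1 ^ l j * q3 ^ j * x) * (1 - q1 ^ l j * q2 * q3 ^ (j - 1) * x))
      / ((1 - q1 ^ l j * q3 ^ (j - 1) * x) * (1 - q1 powi (int (l j) - 1) * q3 ^ (j - 1) * x)))"

text \<open>The factors with \<open>l j = 0\<close> in the infinite products are 1.\<close>

definition psi_fock :: "'k::field \<Rightarrow> 'k \<Rightarrow> (nat \<Rightarrow> nat) \<Rightarrow> 'k \<Rightarrow> 'k" where
  "psi_fock q1 q3 l x =
     (let q2 = inverse (q1 * q3) in
      (1 - q2 * x) / (1 - x)
      * (\<Prod>j | 1 \<le> j \<and> l j \<noteq> 0. psi_row q1 q3 l j x / psi_row q1 q3 (\<lambda>_. 0) j x))"

type_synonym tuple = "nat \<Rightarrow> nat \<Rightarrow> nat"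

definition add_box :: "tuple \<Rightarrow> nat \<Rightarrow> nat \<Rightarrow> tuple" where
  "add_box L i s = L(i := (L i)(s := L i s + 1))"

definition box_value :: "'k::field \<Rightarrow> 'k \<Rightarrow> (nat \<Rightarrow> 'k) \<Rightarrow> tuple \<Rightarrow> nat \<Rightarrow> nat \<Rightarrow> 'k" where
  "box_value q1 q3 u L i s = q1 ^ L i s * q3 ^ (s - 1) * u i"

text \<open>Coefficients of \<open>\<delta>(v/z)\<close> in the matrix coefficients of \<open>e(z)\<close> and \<open>f(z)\<close> between \<open>L\<close> and
  \<open>add_box L i s\<close>.\<close>

definition e_amplitude :: "'k::field \<Rightarrow> 'k \<Rightarrow> (nat \<Rightarrow> 'k) \<Rightarrow> tuple \<Rightarrow> nat \<Rightarrow> nat \<Rightarrow> 'k" where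
  "e_amplitude q1 q3 u L i s =
     (let v = box_value q1 q3 u L i s in
      1 / (1 - q1) * (\<Prod>j\<in>{1..<i}. psi_fock q1 q3 (L j) (u j / v))
      * (\<Prod>t\<in>{1..<s}. psi_row q1 q3 (L i) t (u i / v)))"

definition f_amplitude :: "'k::field \<Rightarrow> 'k \<Rightarrow> (nat \<Rightarrow> 'k) \<Rightarrow> nat \<Rightarrow> tuple \<Rightarrow> nat \<Rightarrow> nat \<Rightarrow> 'k" where
  "f_amplitude q1 q3 u n L i s =
     (let v = box_value q1 q3 u L i s; q2 = inverse (q1 * q3) in
      q1 / (1 - q1) * ((1 - q2 * q3 ^ s * u i / v) / (1 - q3 ^ s * u i / v))
      * (\<Prod>t | s < t \<and> L i t \<noteq> 0. psi_row q1 q3 (L i) t (u i / v) / psi_row q1 q3 (\<lambda>_. 0) t (u i / v))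
      * (\<Prod>j\<in>{i<..n}. psi_fock q1 q3 (L j) (u j / v)))"

text \<open>\<open>tensor_coeff q1 q3 u n X M L\<close> is \<open>\<langle>M|X|L\<rangle>\<close>.  The mode \<open>e\<^sub>k\<close> is the coefficient of \<open>z\<^sup>-\<^sup>k\<close> in
  \<open>e(z)\<close>, and that of \<open>\<delta>(v/z)\<close> is \<open>v\<^sup>k\<close>.  The expansions of \<open>\<psi>\<^sup>+(z)\<close> and \<open>\<psi>\<^sup>-(z)\<close> are obtained by
  computing in the field of formal Laurent series in \<open>z\<^sup>-\<^sup>1\<close> and in \<open>z\<close>, respectively.\<close>

fun tensor_coeff ::
    "'k::field \<Rightarrow> 'k \<Rightarrow> (nat \<Rightarrow> 'k) \<Rightarrow> nat \<Rightarrow> mode \<Rightarrow> tuple \<Rightarrow> tuple \<Rightarrow> 'k" where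
  "tensor_coeff q1 q3 u n (E k) M L =
     (\<Sum>(i, s) | 1 \<le> i \<and> i \<le> n \<and> 1 \<le> s \<and> M = add_box L i s.
        box_value q1 q3 u L i s powi k * e_amplitude q1 q3 u L i s)"
| "tensor_coeff q1 q3 u n (F k) M L =
     (\<Sum>(i, s) | 1 \<le> i \<and> i \<le> n \<and> 1 \<le> s \<and> L = add_box M i s.
        box_value q1 q3 u M i s powi k * f_amplitude q1 q3 u n M i s)"
| "tensor_coeff q1 q3 u n (PsiP k) M L =
     (if M = L then
        fls_nth (\<Prod>i\<in>{1..n}. psi_fock (fls_const q1) (fls_const q3) (L i) (fls_const (u i) * fls_X))
          (int k)
      else 0)"
| "tensor_coeff q1 q3 u n (PsiM k) M L =
     (if M = L then
        fls_nth (\<Prod>i\<in>{1..n}. psi_fock (fls_const q1) (fls_const q3) (L i) (fls_const (u i) * fls_X_inv))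
          (int k)
      else 0)"

definition generic_coeff :: "nat \<Rightarrow> mode \<Rightarrow> tuple \<Rightarrow> tuple \<Rightarrow> ratfun" where
  "generic_coeff n X M L = tensor_coeff (rvar 0) (rvar 1) (\<lambda>i. rvar (i + 1)) n X M L"


section \<open>The two specializations\<close>

text \<open>\<open>spec_u a b k\<close> is the specialized value of \<open>u\<^bsub>k+1\<^esub>\<close>: it is \<open>u\<close> for \<open>k = 0\<close>, and
  \<open>u\<^sub>i = u\<^bsub>i+1\<^esub> q\<^sub>1\<^bsup>a\<^sub>i+1\<^esup> q\<^sub>3\<^bsup>b\<^sub>i+1\<^esup>\<close>.\<close>

primrec spec_u :: "(nat \<Rightarrow> nat) \<Rightarrow> (nat \<Rightarrow> nat) \<Rightarrow> nat \<Rightarrow> ratfun" where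
  "spec_u a b 0 = rvar 2"
| "spec_u a b (Suc k) =
     spec_u a b k / (rvar 0 ^ (a (Suc k) + 1) * rvar 1 ^ (b (Suc k) + 1))"

definition spec_subst :: "(nat \<Rightarrow> nat) \<Rightarrow> (nat \<Rightarrow> nat) \<Rightarrow> nat \<Rightarrow> ratfun" where
  "spec_subst a b m = (if m = 0 then rvar 0 else if m = 1 then rvar 1 else spec_u a b (m - 2))"

definition M_coeff ::
    "(nat \<Rightarrow> nat) \<Rightarrow> (nat \<Rightarrow> nat) \<Rightarrow> nat \<Rightarrow> mode \<Rightarrow> tuple \<Rightarrow> tuple \<Rightarrow> ratfun" where
  "M_coeff a b n X M L = subst_value rconst (spec_subst a b) (generic_coeff n X M L)"

text \<open>Variables beyond \<open>q\<^sub>1, q\<^sub>3, u\<close> do not occur in \<^const>\<open>M_coeff\<close>; their value is irrelevant.\<close>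

definition num_subst :: "complex \<Rightarrow> complex \<Rightarrow> complex \<Rightarrow> nat \<Rightarrow> complex" where
  "num_subst q1 q3 u m = (if m = 0 then q1 else if m = 1 then q3 else u)"

definition resonant_coeff ::
    "complex \<Rightarrow> complex \<Rightarrow> complex \<Rightarrow> (nat \<Rightarrow> nat) \<Rightarrow> (nat \<Rightarrow> nat) \<Rightarrow> nat
      \<Rightarrow> mode \<Rightarrow> tuple \<Rightarrow> tuple \<Rightarrow> complex" where
  "resonant_coeff q1 q3 u a b n X M L = subst_value id (num_subst q1 q3 u) (M_coeff a b n X M L)"

text \<open>The index \<open>i mod n + 1\<close> is \<open>i + 1\<close> for \<open>i < n\<close> and 1 for \<open>i = n\<close>.\<close>

definition resonant_basis :: "(nat \<Rightarrow> nat) \<Rightarrow> (nat \<Rightarrow> nat) \<Rightarrow> nat \<Rightarrow> tuple set" where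
  "resonant_basis a b n =
     {L \<in> {1..n} \<rightarrow>\<^sub>E partitions.
        \<forall>i\<in>{1..n}. \<forall>s\<ge>1. int (L i s) \<ge> int (L (i mod n + 1) (s + b i)) - int (a i)}"

definition resonant_space ::
    "(nat \<Rightarrow> nat) \<Rightarrow> (nat \<Rightarrow> nat) \<Rightarrow> nat \<Rightarrow> (tuple \<Rightarrow>\<^sub>0 complex) set" where
  "resonant_space a b n = {v. Poly_Mapping.keys v \<subseteq> resonant_basis a b n}"

definition tuple_degree :: "nat \<Rightarrow> tuple \<Rightarrow> nat" where
  "tuple_degree n L = (\<Sum>i\<in>{1..n}. \<Sum>s | L i s \<noteq> 0. L i s)"

definition resonant_homogeneous ::
    "(nat \<Rightarrow> nat) \<Rightarrow> (nat \<Rightarrow> nat) \<Rightarrow> nat \<Rightarrow> int \<Rightarrow> (tuple \<Rightarrow>\<^sub>0 complex) set" where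
  "resonant_homogeneous a b n d =
     {v \<in> resonant_space a b n. \<forall>L\<in>Poly_Mapping.keys v. int (tuple_degree n L) = d}"

definition action_well_defined ::
    "complex \<Rightarrow> complex \<Rightarrow> complex \<Rightarrow> (nat \<Rightarrow> nat) \<Rightarrow> (nat \<Rightarrow> nat) \<Rightarrow> nat \<Rightarrow> bool" where
  "action_well_defined q1 q3 u a b n \<longleftrightarrow>
     (\<forall>X. \<forall>L\<in>resonant_basis a b n. \<forall>M\<in>resonant_basis a b n.
        regular_at rconst (spec_subst a b) (generic_coeff n X M L)
        \<and> regular_at id (num_subst q1 q3 u) (M_coeff a b n X M L))"

end

theory Submission
  imports Defs "HOL-Library.Multiset"
begin

text \<open>Why the theorem is true.  A tuple of partitions is drawn as a set of boxes \<open>(i, s, c)\<close> with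
  \<open>c < \<lambda>\<^sup>(\<^sup>i\<^sup>)\<^sub>s\<close>.  Besides the two evident directions \<open>(i, s, c + 1)\<close> and \<open>(i, s + 1, c)\<close> there is a
  third one, from \<open>(i, s, c)\<close> to \<open>(i + 1, s + b\<^sub>i, c + a\<^sub>i)\<close>, with \<open>n + 1\<close> read as \<open>1\<close>.  The basis
  vectors of the module are exactly the finite order ideals for these three directions
  (\<open>states_iff\<close>).  Each box has a value, and a step in the three directions multiplies it by \<open>q\<^sub>1\<close>,
  \<open>q\<^sub>3\<close>, \<open>q\<^sub>2\<close>; for the step from the last tensor factor back to the first this is the resonance
  (\<open>val_nxt\<close>).  Since there are no other relations between \<open>q\<^sub>1\<close> and \<open>q\<^sub>3\<close>, two boxes have equal values
  only if one is reached from the other by repeating a diagonal step, one step in each of the three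
  directions (\<open>val_eq_diag\<close>).  So the picture is that of plane partitions, wrapped around a cylinder,
  and the three parameters enter symmetrically.

  Regularity.  Written as products over rows with the empty rows telescoped, the amplitudes of \<open>e\<close> and
  \<open>f\<close> for a box \<open>x\<close> have denominators that vanish only if another row ends at a place whose value is
  that of \<open>x\<close> or \<open>q\<^sub>1\<close> times it.  For an order ideal this is impossible (\<open>addable_row_nonzero\<close>), so
  that all these binomials are nonzero already at the final complex point, and so is the whole
  amplitude.  If a rational function has a regular representative at that point, then it is regular in
  both of the substitutions, and the result is the naive value (\<open>two_step_specialization\<close>).  All
  matrix coefficients of the resonant action are thereby explicit products of binomials in \<open>\<complex>\<close>.

  Relations.  Adding a box \<open>y\<close> multiplies the amplitude of another box \<open>x\<close> by \<open>1\<close> or by a quotient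
  \<open>- g(y, x) / g(x, y)\<close>, according to the order of the rows (\<open>amp_add\<close>).  For two boxes that can be
  added in both orders this is the quadratic relation; if the order is forced, then \<open>g\<close> vanishes by
  itself.  The Serre relations follow by the same comparison of the six orders of three boxes and one
  polynomial identity (\<open>serre_relation\<close>).  For \<open>[e, f]\<close> the off-diagonal terms cancel
  (\<open>ef_exchange\<close>).  On the diagonal, the eigenvalue of \<open>\<psi>(z)\<close> is a rational function whose poles are
  simple and located at the values of the addable and removable boxes (\<open>pole_zero_count\<close>), and its
  residues are the products of an amplitude of \<open>e\<close> with one of \<open>f\<close>, so that partial fractions express
  the difference of the two expansions of \<open>\<psi>\<close> by these products (\<open>ef_diagonal\<close>).  Having checked the
  defining relations on basis vectors, one obtains the module over the quotient algebra from
  \<open>graded_module_of_relations\<close>.\<close>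

section \<open>Specialization of rational functions at a point\<close>

definition ring_embedding :: "(complex \<Rightarrow> 'r::comm_ring_1) \<Rightarrow> bool" where
  "ring_embedding \<iota> \<longleftrightarrow>
     \<iota> 0 = 0 \<and> \<iota> 1 = 1 \<and> (\<forall>x y. \<iota> (x + y) = \<iota> x + \<iota> y) \<and> (\<forall>x y. \<iota> (x * y) = \<iota> x * \<iota> y)"

definition monom_value :: "(nat \<Rightarrow> 'r::comm_ring_1) \<Rightarrow> (nat \<Rightarrow>\<^sub>0 nat) \<Rightarrow> 'r" where
  "monom_value \<sigma> m = (\<Prod>i\<in>Poly_Mapping.keys m. \<sigma> i ^ Poly_Mapping.lookup m i)"

text \<open>The evaluation \<^const>\<open>mpol_eval\<close> with values in a commutative ring: values in a polynomial
  ring give the total degree.\<close>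

definition ring_eval :: "(complex \<Rightarrow> 'r::comm_ring_1) \<Rightarrow> (nat \<Rightarrow> 'r) \<Rightarrow> mpol \<Rightarrow> 'r" where
  "ring_eval \<iota> \<sigma> P =
     (\<Sum>m\<in>Poly_Mapping.keys P. \<iota> (Poly_Mapping.lookup P m) * monom_value \<sigma> m)"

lemma mpol_eval_eq_ring_eval: "mpol_eval \<iota> \<sigma> P = ring_eval \<iota> \<sigma> P"
  by (simp add: mpol_eval_def ring_eval_def monom_value_def)

lemma monom_value_superset:
  assumes "finite A" "Poly_Mapping.keys m \<subseteq> A"
  shows "monom_value \<sigma> m = (\<Prod>i\<in>A. \<sigma> i ^ Poly_Mapping.lookup m i)"
  unfolding monom_value_def
  by (rule prod.mono_neutral_left) (use assms in \<open>auto simp: in_keys_iff\<close>)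

lemma monom_value_add: "monom_value \<sigma> (m + m') = monom_value \<sigma> m * monom_value \<sigma> m'"
proof -
  define A where "A = Poly_Mapping.keys m \<union> Poly_Mapping.keys m'"
  have "finite A" by (simp add: A_def)
  moreover have "Poly_Mapping.keys (m + m') \<subseteq> A"
    unfolding A_def by (rule keys_add)
  moreover have "Poly_Mapping.keys m \<subseteq> A" "Poly_Mapping.keys m' \<subseteq> A" by (auto simp: A_def)
  ultimately show ?thesis
    by (simp add: monom_value_superset[of A] lookup_add power_add prod.distrib)
qed

lemma monom_value_0 [simp]: "monom_value \<sigma> 0 = 1"
  by (simp add: monom_value_def)

lemma poly_mapping_eq_sum_single:
  "P = (\<Sum>m\<in>Poly_Mapping.keys P. Poly_Mapping.single m (Poly_Mapping.lookup P m))"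
  by (rule poly_mapping_eqI)
     (auto simp: lookup_sum lookup_single when_def sum.delta in_keys_iff
       if_distrib[of "\<lambda>x. x = _"] cong: if_cong intro!: sym[OF sum.neutral])

context
  fixes \<iota> :: "complex \<Rightarrow> 'r::comm_ring_1"
  assumes emb: "ring_embedding \<iota>"
begin

lemma ring_eval_superset:
  assumes "finite A" "Poly_Mapping.keys P \<subseteq> A"
  shows "ring_eval \<iota> \<sigma> P = (\<Sum>m\<in>A. \<iota> (Poly_Mapping.lookup P m) * monom_value \<sigma> m)"
  unfolding ring_eval_def
  by (rule sum.mono_neutral_left)
     (use assms emb in \<open>auto simp: in_keys_iff ring_embedding_def\<close>)

lemma ring_eval_0 [simp]: "ring_eval \<iota> \<sigma> 0 = 0"
  by (simp add: ring_eval_def)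

lemma ring_eval_single: "ring_eval \<iota> \<sigma> (Poly_Mapping.single m c) = \<iota> c * monom_value \<sigma> m"
  using emb by (subst ring_eval_superset[of "{m}"]) (auto simp: ring_embedding_def)

lemma ring_eval_add: "ring_eval \<iota> \<sigma> (P + Q) = ring_eval \<iota> \<sigma> P + ring_eval \<iota> \<sigma> Q"
proof -
  define A where "A = Poly_Mapping.keys P \<union> Poly_Mapping.keys Q"
  have "finite A" "Poly_Mapping.keys P \<subseteq> A" "Poly_Mapping.keys Q \<subseteq> A" by (auto simp: A_def)
  moreover have "Poly_Mapping.keys (P + Q) \<subseteq> A"
    unfolding A_def by (rule keys_add)
  ultimately show ?thesis
    using emb
    by (simp add: ring_eval_superset[of A] lookup_add ring_embedding_def distrib_right sum.distrib)
qed

lemma ring_eval_sum: "ring_eval \<iota> \<sigma> (\<Sum>x\<in>A. f x) = (\<Sum>x\<in>A. ring_eval \<iota> \<sigma> (f x))"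
  by (induction A rule: infinite_finite_induct) (simp_all add: ring_eval_add)

lemma ring_eval_mult: "ring_eval \<iota> \<sigma> (P * Q) = ring_eval \<iota> \<sigma> P * ring_eval \<iota> \<sigma> Q"
proof -
  let ?s = "\<lambda>P m. Poly_Mapping.single m (Poly_Mapping.lookup P m) :: mpol"
  have 1: "ring_eval \<iota> \<sigma> (Poly_Mapping.single m c * Poly_Mapping.single m' c')
      = ring_eval \<iota> \<sigma> (Poly_Mapping.single m c) * ring_eval \<iota> \<sigma> (Poly_Mapping.single m' c')" for m m' c c'
    using emb by (simp add: mult_single ring_eval_single monom_value_add ring_embedding_def)
  have "ring_eval \<iota> \<sigma> ((\<Sum>m\<in>Poly_Mapping.keys P. ?s P m) * (\<Sum>m\<in>Poly_Mapping.keys Q. ?s Q m))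
     = ring_eval \<iota> \<sigma> (\<Sum>m\<in>Poly_Mapping.keys P. ?s P m) * ring_eval \<iota> \<sigma> (\<Sum>m\<in>Poly_Mapping.keys Q. ?s Q m)"
    by (simp add: sum_product ring_eval_sum 1)
  then show ?thesis
    unfolding poly_mapping_eq_sum_single[symmetric] .
qed

lemma ring_eval_1 [simp]: "ring_eval \<iota> \<sigma> 1 = 1"
  using emb ring_eval_single[of \<sigma> 0 1] by (simp add: ring_embedding_def)

end

subsection \<open>Lowest terms\<close>

text \<open>The substitution \<open>x\<^sub>i \<mapsto> x\<^sub>i T\<close>.  The degree in \<open>T\<close> is the total degree, which is additive because
  the coefficients form a domain.\<close>

definition degree_tracking :: "mpol \<Rightarrow> mpol poly" where
  "degree_tracking = ring_eval (\<lambda>c. [:Poly_Mapping.single 0 c:])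
     (\<lambda>i. [:0, Poly_Mapping.single (Poly_Mapping.single i 1) 1:])"

lemma degree_tracking_embedding: "ring_embedding (\<lambda>c. [:Poly_Mapping.single 0 c:] :: mpol poly)"
  by (simp add: ring_embedding_def single_add mult_single mult.commute)

lemma poly_degree_tracking:
  "poly (degree_tracking P) x = ring_eval (Poly_Mapping.single 0)
     (\<lambda>i. x * Poly_Mapping.single (Poly_Mapping.single i 1) 1) P"
  by (simp add: degree_tracking_def ring_eval_def monom_value_def poly_sum poly_prod)

lemma single_sum:
  "(\<Sum>m\<in>A. Poly_Mapping.single k (f m)) = Poly_Mapping.single k (\<Sum>m\<in>A. f m)"
  by (induction A rule: infinite_finite_induct) (simp_all add: single_add)

lemma monom_value_vars:
  "monom_value (\<lambda>i. Poly_Mapping.single (Poly_Mapping.single i 1) 1 :: mpol) m = Poly_Mapping.single m 1"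
proof -
  have pow: "(Poly_Mapping.single k 1 :: mpol) ^ j = Poly_Mapping.single (of_nat j * k) 1" for k j
  proof (induction j)
    case (Suc j)
    then show ?case by (simp add: mult_single distrib_right)
  qed simp
  have prd: "(\<Prod>i\<in>A. Poly_Mapping.single (g i) 1 :: mpol) = Poly_Mapping.single (\<Sum>i\<in>A. g i) 1"
    for g :: "nat \<Rightarrow> (nat \<Rightarrow>\<^sub>0 nat)" and A
    by (induction A rule: infinite_finite_induct) (simp_all add: mult_single)
  have "of_nat j * Poly_Mapping.single i (1::nat) = Poly_Mapping.single i j" for i j :: nat
    by (induction j) (simp_all add: distrib_right single_add[symmetric])
  then show ?thesis
    unfolding monom_value_def by (simp add: pow prd flip: poly_mapping_eq_sum_single)
qed

lemma poly_degree_tracking_1: "poly (degree_tracking P) 1 = P"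
proof -
  have "poly (degree_tracking P) 1 =
     (\<Sum>m\<in>Poly_Mapping.keys P. Poly_Mapping.single m (Poly_Mapping.lookup P m))"
    by (simp add: poly_degree_tracking ring_eval_def monom_value_vars[unfolded One_nat_def] mult_single)
  then show ?thesis unfolding poly_mapping_eq_sum_single[symmetric] .
qed

lemma poly_degree_tracking_0: "\<exists>c. poly (degree_tracking P) 0 = Poly_Mapping.single 0 c"
proof -
  have "monom_value (\<lambda>i. 0 :: mpol) m = Poly_Mapping.single 0 (if m = 0 then 1 else 0)" for m
  proof (cases "m = 0")
    case False
    moreover have "m = 0" if "\<forall>i. Poly_Mapping.lookup m i = 0"
      using that by (intro poly_mapping_eqI) simp
    ultimately have "\<exists>i. Poly_Mapping.lookup m i \<noteq> 0" by blast
    then obtain i where "i \<in> Poly_Mapping.keys m" by (auto simp: in_keys_iff)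
    then have "monom_value (\<lambda>i. 0 :: mpol) m = 0"
      unfolding monom_value_def by (intro prod_zero) (auto simp: in_keys_iff)
    then show ?thesis using False by simp
  qed simp
  then have "poly (degree_tracking P) 0 = (\<Sum>m\<in>Poly_Mapping.keys P.
      Poly_Mapping.single 0 (Poly_Mapping.lookup P m * (if m = 0 then 1 else 0)))"
    by (simp add: poly_degree_tracking ring_eval_def mult_single)
  also have "\<dots> = Poly_Mapping.single 0
      (\<Sum>m\<in>Poly_Mapping.keys P. Poly_Mapping.lookup P m * (if m = 0 then 1 else 0))"
    by (rule single_sum)
  finally show ?thesis by blast
qed

lemma degree_tracking_mult: "degree_tracking (P * Q) = degree_tracking P * degree_tracking Q"
  unfolding degree_tracking_def by (rule ring_eval_mult[OF degree_tracking_embedding])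

lemma degree_tracking_eq_0_iff: "degree_tracking P = 0 \<longleftrightarrow> P = 0"
proof
  assume "degree_tracking P = 0"
  then show "P = 0" using poly_degree_tracking_1[of P] by (metis poly_0)
qed (simp add: degree_tracking_def ring_eval_def)

lemma degree_tracking_const_unit:
  assumes "P \<noteq> 0" "Polynomial.degree (degree_tracking P) = 0"
  shows "P dvd 1"
proof -
  obtain d where d: "degree_tracking P = [:d:]"
    using assms(2) by (meson degree_eq_zeroE)
  obtain c where c: "P = Poly_Mapping.single 0 c"
    using poly_degree_tracking_1[of P] poly_degree_tracking_0[of P] unfolding d poly_pCons by auto
  then have "c \<noteq> 0" using assms(1) by auto
  then have "1 = P * Poly_Mapping.single 0 (1 / c)" by (simp add: c mult_single)
  then show ?thesis by (rule dvdI)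
qed

text \<open>Some representative, not necessarily in lowest terms, has a denominator that does not vanish at
  \<open>\<sigma>\<close>.  Unlike \<^const>\<open>regular_at\<close> this is visibly compatible with the field operations.\<close>

definition specializes :: "(complex \<Rightarrow> 'k::field) \<Rightarrow> (nat \<Rightarrow> 'k) \<Rightarrow> ratfun \<Rightarrow> 'k \<Rightarrow> bool" where
  "specializes \<iota> \<sigma> R c \<longleftrightarrow>
     (\<exists>P Q. R = Fraction_Field.Fract P Q \<and> ring_eval \<iota> \<sigma> Q \<noteq> 0
        \<and> c = ring_eval \<iota> \<sigma> P / ring_eval \<iota> \<sigma> Q)"

text \<open>A common divisor that is not a unit has positive total degree, so cancelling common divisors comes
  to an end; and a divisor of a denominator that does not vanish at \<open>\<sigma>\<close> does not vanish there either.\<close>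

lemma lowest_terms_exist:
  assumes emb: "ring_embedding \<iota>" and Q: "ring_eval \<iota> \<sigma> Q \<noteq> 0"
  shows "\<exists>P' Q'. lowest_terms (Fraction_Field.Fract P Q) P' Q' \<and> ring_eval \<iota> \<sigma> Q' \<noteq> (0::'k::field)"
  using Q
proof (induction "Polynomial.degree (degree_tracking Q)" arbitrary: P Q rule: less_induct)
  case less
  have Q0: "Q \<noteq> 0" using less.prems emb by (auto simp: ring_eval_0)
  show ?case
  proof (cases "\<forall>D. D dvd P \<longrightarrow> D dvd Q \<longrightarrow> D dvd 1")
    case True
    then show ?thesis using less.prems Q0 by (auto simp: lowest_terms_def)
  next
    case False
    then obtain D P' Q' where D: "\<not> D dvd 1" "P = D * P'" "Q = D * Q'"
      unfolding dvd_def by blast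
    have nz: "D \<noteq> 0" "Q' \<noteq> 0" using D Q0 by auto
    have "Polynomial.degree (degree_tracking D) \<noteq> 0"
      using degree_tracking_const_unit D nz by blast
    moreover have "Polynomial.degree (degree_tracking Q)
        = Polynomial.degree (degree_tracking D) + Polynomial.degree (degree_tracking Q')"
      using nz by (simp add: D degree_tracking_mult degree_mult_eq degree_tracking_eq_0_iff)
    moreover have "ring_eval \<iota> \<sigma> Q' \<noteq> 0"
      using less.prems D by (auto simp: ring_eval_mult[OF emb])
    moreover have "Fraction_Field.Fract P Q = Fraction_Field.Fract P' Q'"
      using nz by (simp add: D mult_fract_cancel)
    ultimately show ?thesis using less.hyps[of Q' P'] by simp
  qed
qed

lemma specializesE:
  assumes "specializes \<iota> \<sigma> R c"
  obtains P Q where "R = Fraction_Field.Fract P Q" "ring_eval \<iota> \<sigma> Q \<noteq> 0"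
    "c = ring_eval \<iota> \<sigma> P / ring_eval \<iota> \<sigma> Q"
  using assms unfolding specializes_def by blast

lemma specializes_unique:
  assumes emb: "ring_embedding \<iota>" and "specializes \<iota> \<sigma> R c" "specializes \<iota> \<sigma> R d"
  shows "c = d"
proof -
  obtain P Q where
    1: "R = Fraction_Field.Fract P Q" "ring_eval \<iota> \<sigma> Q \<noteq> 0" "c = ring_eval \<iota> \<sigma> P / ring_eval \<iota> \<sigma> Q"
    using specializesE[OF assms(2)] .
  obtain P' Q' where
    2: "R = Fraction_Field.Fract P' Q'" "ring_eval \<iota> \<sigma> Q' \<noteq> 0" "d = ring_eval \<iota> \<sigma> P' / ring_eval \<iota> \<sigma> Q'"
    using specializesE[OF assms(3)] .
  have nz: "Q \<noteq> 0" "Q' \<noteq> 0" using 1(2) 2(2) ring_eval_0[OF emb, of \<sigma>] by force+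
  have "Fraction_Field.Fract P Q = Fraction_Field.Fract P' Q'"
    by (rule trans[OF 1(1)[symmetric] 2(1)])
  then have "P * Q' = P' * Q" by (rule iffD1[OF eq_fract(1)[OF nz]])
  then have "ring_eval \<iota> \<sigma> (P * Q') = ring_eval \<iota> \<sigma> (P' * Q)" by (rule arg_cong)
  then have "ring_eval \<iota> \<sigma> P * ring_eval \<iota> \<sigma> Q' = ring_eval \<iota> \<sigma> P' * ring_eval \<iota> \<sigma> Q"
    unfolding ring_eval_mult[OF emb] .
  then show ?thesis unfolding 1(3) 2(3) by (rule iffD2[OF frac_eq_eq[OF 1(2) 2(2)]])
qed

text \<open>By cross multiplication, all representatives that are regular at \<open>\<sigma>\<close> have the same value there.\<close>

lemma specializes_imp_regular_value:
  assumes emb: "ring_embedding \<iota>" and s: "specializes \<iota> \<sigma> R c"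
  shows "regular_at \<iota> \<sigma> R" and "subst_value \<iota> \<sigma> R = c"
proof -
  obtain P Q where 1: "lowest_terms R P Q" "ring_eval \<iota> \<sigma> Q \<noteq> 0"
    by (rule specializesE[OF s]) (use lowest_terms_exist[OF emb] in blast)
  then show "regular_at \<iota> \<sigma> R" by (auto simp: regular_at_def mpol_eval_eq_ring_eval)
  have *: "c' = c" if "lowest_terms R P Q" "ring_eval \<iota> \<sigma> Q \<noteq> 0"
    "c' = ring_eval \<iota> \<sigma> P / ring_eval \<iota> \<sigma> Q" for P Q c'
  proof (rule specializes_unique[OF emb _ s])
    show "specializes \<iota> \<sigma> R c'"
      unfolding specializes_def using that(1)[unfolded lowest_terms_def] that(2,3) by blast
  qed
  have "ring_eval \<iota> \<sigma> P / ring_eval \<iota> \<sigma> Q = c" using *[OF 1 refl] .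
  then show "subst_value \<iota> \<sigma> R = c"
    unfolding subst_value_def mpol_eval_eq_ring_eval
    by (intro the_equality) (use 1 * in blast)+
qed

context
  fixes \<iota> :: "complex \<Rightarrow> 'k::field"
  assumes emb: "ring_embedding \<iota>"
begin

lemma specializes_poly:
  "specializes \<iota> \<sigma> (Fraction_Field.Fract P 1) (ring_eval \<iota> \<sigma> P)"
  unfolding specializes_def by (rule exI[of _ P], rule exI[of _ 1]) (simp add: ring_eval_1[OF emb])

lemma specializes_const: "specializes \<iota> \<sigma> (rconst c) (\<iota> c)"
  using specializes_poly[of \<sigma> "Poly_Mapping.single 0 c"] unfolding rconst_def by (simp add: ring_eval_single[OF emb])

lemma specializes_var: "specializes \<iota> \<sigma> (rvar i) (\<sigma> i)"
  using specializes_poly[of \<sigma> "Poly_Mapping.single (Poly_Mapping.single i 1) 1"] emb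
  by (simp add: rvar_def ring_eval_single[OF emb] monom_value_def ring_embedding_def)

lemma specializes_1: "specializes \<iota> \<sigma> 1 1"
  using specializes_poly[of \<sigma> 1] by (simp add: One_fract_def ring_eval_1[OF emb])

lemma specializes_0: "specializes \<iota> \<sigma> 0 0"
  using specializes_poly[of \<sigma> 0] by (simp add: Zero_fract_def ring_eval_0[OF emb])

lemma specializes_add:
  assumes "specializes \<iota> \<sigma> R c" "specializes \<iota> \<sigma> S d"
  shows "specializes \<iota> \<sigma> (R + S) (c + d)"
proof -
  obtain P Q where
    1: "R = Fraction_Field.Fract P Q" "ring_eval \<iota> \<sigma> Q \<noteq> 0" "c = ring_eval \<iota> \<sigma> P / ring_eval \<iota> \<sigma> Q"
    using specializesE[OF assms(1)] .
  obtain P' Q' where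
    2: "S = Fraction_Field.Fract P' Q'" "ring_eval \<iota> \<sigma> Q' \<noteq> 0" "d = ring_eval \<iota> \<sigma> P' / ring_eval \<iota> \<sigma> Q'"
    using specializesE[OF assms(2)] .
  have "Q \<noteq> 0" "Q' \<noteq> 0" using 1 2 by (auto simp: ring_eval_0[OF emb])
  then show ?thesis unfolding specializes_def using 1 2
    by (intro exI[of _ "P * Q' + P' * Q"] exI[of _ "Q * Q'"])
       (simp add: ring_eval_mult[OF emb] ring_eval_add[OF emb] add_frac_eq)
qed

lemma specializes_mult:
  assumes "specializes \<iota> \<sigma> R c" "specializes \<iota> \<sigma> S d"
  shows "specializes \<iota> \<sigma> (R * S) (c * d)"
proof -
  obtain P Q where
    1: "R = Fraction_Field.Fract P Q" "ring_eval \<iota> \<sigma> Q \<noteq> 0" "c = ring_eval \<iota> \<sigma> P / ring_eval \<iota> \<sigma> Q"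
    using specializesE[OF assms(1)] .
  obtain P' Q' where
    2: "S = Fraction_Field.Fract P' Q'" "ring_eval \<iota> \<sigma> Q' \<noteq> 0" "d = ring_eval \<iota> \<sigma> P' / ring_eval \<iota> \<sigma> Q'"
    using specializesE[OF assms(2)] .
  show ?thesis unfolding specializes_def using 1 2
    by (intro exI[of _ "P * P'"] exI[of _ "Q * Q'"]) (simp add: ring_eval_mult[OF emb])
qed

lemma specializes_inverse:
  assumes "specializes \<iota> \<sigma> R c" "c \<noteq> 0"
  shows "specializes \<iota> \<sigma> (inverse R) (inverse c)"
proof -
  obtain P Q where
    1: "R = Fraction_Field.Fract P Q" "ring_eval \<iota> \<sigma> Q \<noteq> 0" "c = ring_eval \<iota> \<sigma> P / ring_eval \<iota> \<sigma> Q"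
    using specializesE[OF assms(1)] .
  show ?thesis unfolding specializes_def using 1 assms(2)
    by (intro exI[of _ Q] exI[of _ P]) simp
qed

lemma specializes_minus:
  assumes "specializes \<iota> \<sigma> R c"
  shows "specializes \<iota> \<sigma> (- R) (- c)"
proof -
  have "ring_eval \<iota> \<sigma> (- 1) + 1 = 0"
    using ring_eval_add[OF emb, of \<sigma> "-1" 1] by (simp add: ring_eval_1[OF emb] ring_eval_0[OF emb])
  then have "ring_eval \<iota> \<sigma> (- 1) = - 1" by (simp add: add_eq_0_iff2)
  then have "specializes \<iota> \<sigma> (- 1) (- 1)"
    using specializes_poly[of \<sigma> "-1"] by (simp add: One_fract_def)
  from specializes_mult[OF this assms] show ?thesis by simp
qed

lemma specializes_diff:
  assumes "specializes \<iota> \<sigma> R c" "specializes \<iota> \<sigma> S d"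
  shows "specializes \<iota> \<sigma> (R - S) (c - d)"
  using specializes_add[OF assms(1) specializes_minus[OF assms(2)]] by simp

lemma specializes_divide:
  assumes "specializes \<iota> \<sigma> R c" "specializes \<iota> \<sigma> S d" "d \<noteq> 0"
  shows "specializes \<iota> \<sigma> (R / S) (c / d)"
  using specializes_mult[OF assms(1) specializes_inverse[OF assms(2,3)]] by (simp add: field_simps)

lemma specializes_power:
  assumes "specializes \<iota> \<sigma> R c"
  shows "specializes \<iota> \<sigma> (R ^ k) (c ^ k)"
  by (induction k) (use assms in \<open>auto intro: specializes_1 specializes_mult\<close>)

lemma specializes_powi:
  assumes "specializes \<iota> \<sigma> R c" "c \<noteq> 0"
  shows "specializes \<iota> \<sigma> (R powi k) (c powi k)"
  using assms by (auto simp: power_int_def intro: specializes_power specializes_inverse)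

lemma specializes_sum:
  assumes "\<And>x. x \<in> A \<Longrightarrow> specializes \<iota> \<sigma> (f x) (g x)"
  shows "specializes \<iota> \<sigma> (\<Sum>x\<in>A. f x) (\<Sum>x\<in>A. g x)"
  using assms by (induction A rule: infinite_finite_induct) (auto intro: specializes_0 specializes_add)

lemma specializes_prod:
  assumes "\<And>x. x \<in> A \<Longrightarrow> specializes \<iota> \<sigma> (f x) (g x)"
  shows "specializes \<iota> \<sigma> (\<Prod>x\<in>A. f x) (\<Prod>x\<in>A. g x)"
  using assms by (induction A rule: infinite_finite_induct) (auto intro: specializes_1 specializes_mult)

lemma specializes_nonzero:
  assumes "specializes \<iota> \<sigma> R c" "c \<noteq> 0"
  shows "R \<noteq> 0"
  using specializes_unique[OF emb _ assms(1)] specializes_0 assms(2) by blast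

end

lemma ring_embedding_rconst: "ring_embedding rconst"
  by (simp add: ring_embedding_def rconst_def Zero_fract_def One_fract_def single_add mult_single)

lemma ring_embedding_id: "ring_embedding (id :: complex \<Rightarrow> complex)"
  by (simp add: ring_embedding_def)

lemmas specializes_intros =
  specializes_const[OF ring_embedding_id] specializes_var[OF ring_embedding_id]
  specializes_1[OF ring_embedding_id] specializes_0[OF ring_embedding_id]
  specializes_add[OF ring_embedding_id] specializes_mult[OF ring_embedding_id]
  specializes_inverse[OF ring_embedding_id] specializes_minus[OF ring_embedding_id]
  specializes_diff[OF ring_embedding_id] specializes_divide[OF ring_embedding_id]
  specializes_power[OF ring_embedding_id] specializes_powi[OF ring_embedding_id]
  specializes_sum[OF ring_embedding_id] specializes_prod[OF ring_embedding_id]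

text \<open>Evaluating first at \<open>\<sigma>\<close> and then at \<open>\<tau>\<close> amounts to evaluating at \<open>\<rho>\<close>.  A denominator that is nonzero
  at \<open>\<rho>\<close> is nonzero after the first substitution, since its image specializes to something nonzero.\<close>

lemma two_step_specialization:
  assumes step: "\<And>i. specializes id \<tau> (\<sigma> i) (\<rho> i)" and R: "specializes id \<rho> R c"
  shows "regular_at rconst \<sigma> R" and "regular_at id \<tau> (subst_value rconst \<sigma> R)"
    and "subst_value id \<tau> (subst_value rconst \<sigma> R) = c"
proof -
  obtain P Q where 1: "R = Fraction_Field.Fract P Q" "ring_eval id \<rho> Q \<noteq> 0" "c = ring_eval id \<rho> P / ring_eval id \<rho> Q"
    using specializesE[OF R] .
  have ev: "specializes id \<tau> (ring_eval rconst \<sigma> P) (ring_eval id \<rho> P)" for P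
    unfolding ring_eval_def monom_value_def
    by (intro specializes_intros(13) specializes_intros(6) specializes_intros(14) specializes_intros(11)
        step) (use specializes_intros(1) in auto)
  have Q: "ring_eval rconst \<sigma> Q \<noteq> 0"
    using specializes_nonzero[OF ring_embedding_id ev 1(2)] .
  have s1: "specializes rconst \<sigma> R (ring_eval rconst \<sigma> P / ring_eval rconst \<sigma> Q)"
    using 1 Q by (auto simp: specializes_def)
  have s2: "specializes id \<tau> (ring_eval rconst \<sigma> P / ring_eval rconst \<sigma> Q) c"
    unfolding 1(3) using ev 1(2) by (intro specializes_intros(10)) auto
  note v = specializes_imp_regular_value[OF ring_embedding_rconst s1]
  show "regular_at rconst \<sigma> R" by (rule v)
  show "regular_at id \<tau> (subst_value rconst \<sigma> R)" "subst_value id \<tau> (subst_value rconst \<sigma> R) = c"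
    unfolding v using specializes_imp_regular_value[OF ring_embedding_id s2] by auto
qed

section \<open>Boxes on the cylinder\<close>

type_synonym box = "nat \<times> nat \<times> nat"

text \<open>The third coordinate of a box counts from 0: a row of length \<open>l\<close> consists of the boxes with
  \<open>c < l\<close>, and \<open>c = l\<close> is the place of the next box.\<close>

locale resonance =
  fixes n :: nat and a b :: "nat \<Rightarrow> nat" and p' p :: int and q1 q2 q3 u :: complex
  assumes n: "n \<ge> 2"
    and an: "int (a n) = p' - 1 - (\<Sum>i\<in>{1..n-1}. (int (a i) + 1))"
    and bn: "int (b n) = p - 1 - (\<Sum>i\<in>{1..n-1}. (int (b i) + 1))"
    and q: "q1 * q2 * q3 = 1"
    and not_root_of_unity: "\<And>m::nat. m > 0 \<Longrightarrow> q1 ^ m \<noteq> 1 \<and> q2 ^ m \<noteq> 1 \<and> q3 ^ m \<noteq> 1"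
    and resonant: "\<And>x y::int. q1 powi x * q3 powi y = 1 \<longleftrightarrow> (\<exists>k::int. x = p' * k \<and> y = p * k)"
    and u: "u \<noteq> 0"
begin

lemma q_nonzero: "q1 \<noteq> 0" "q2 \<noteq> 0" "q3 \<noteq> 0"
  using q by auto

lemma q2_eq: "q2 = inverse (q1 * q3)"
  using q q_nonzero by (simp add: field_simps)

definition asum :: "nat \<Rightarrow> int" where "asum i = (\<Sum>k\<in>{1..<i}. int (a k) + 1)"
definition bsum :: "nat \<Rightarrow> int" where "bsum i = (\<Sum>k\<in>{1..<i}. int (b k) + 1)"

lemma asum_Suc: "i \<ge> 1 \<Longrightarrow> asum (Suc i) = asum i + int (a i) + 1"
  by (simp add: asum_def)

lemma bsum_Suc: "i \<ge> 1 \<Longrightarrow> bsum (Suc i) = bsum i + int (b i) + 1"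
  by (simp add: bsum_def)

lemma interval_pred: "{1..n - 1} = {1..<n}"
  using n by auto

lemma p'_eq: "p' = asum n + int (a n) + 1" and p_eq: "p = bsum n + int (b n) + 1"
  using an bn unfolding asum_def bsum_def interval_pred by simp_all

lemma p_ge_2: "p \<ge> 2"
proof -
  have "bsum n \<ge> (\<Sum>k\<in>{1..<n}. 1)" unfolding bsum_def by (intro sum_mono) auto
  then show ?thesis using n p_eq by simp
qed

text \<open>A coincidence would be a relation between \<open>q\<^sub>1\<close> and \<open>q\<^sub>3\<close> in which one of the exponents is
  \<open>\<plusminus> 1\<close>, whereas \<open>p'\<close> and \<open>p\<close> are at least \<open>n \<ge> 2\<close>.\<close>

lemma q_distinct: "q1 \<noteq> q2" "q1 \<noteq> q3" "q2 \<noteq> q3"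
proof -
  have no: "q1 powi x * q3 powi y \<noteq> 1" if "(y = 1 \<or> y = -1)" for x y
  proof
    assume "q1 powi x * q3 powi y = 1"
    then obtain k where "y = p * k" using resonant by blast
    then have "p dvd 1" using that by (metis dvd_triv_left dvd_minus_iff)
    then show False using p_ge_2 by simp
  qed
  show "q1 \<noteq> q2"
  proof
    assume "q1 = q2"
    then have "q1 powi 2 * q3 powi 1 = 1" using q by (simp add: power2_eq_square power_int_def)
    then show False using no by blast
  qed
  show "q1 \<noteq> q3"
  proof
    assume "q1 = q3"
    then have "q1 powi 1 * q3 powi (-1) = 1" using q_nonzero by (simp add: power_int_def)
    then show False using no by blast
  qed
  show "q2 \<noteq> q3"
  proof
    assume "q2 = q3"
    then have e: "q1 powi 1 * q3 powi 2 = 1" using q by (simp add: power2_eq_square power_int_def mult.assoc)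
    then obtain k where k: "1 = p' * k" "2 = p * k" using resonant by blast
    have "p' \<ge> 2"
    proof -
      have "asum n \<ge> (\<Sum>k\<in>{1..<n}. 1)" unfolding asum_def by (intro sum_mono) auto
      then show ?thesis using n p'_eq by simp
    qed
    moreover have "p' dvd 1" using k(1) by (metis dvd_triv_left)
    ultimately show False by simp
  qed
qed

text \<open>\<open>spectral i\<close> is the specialized value of \<open>u\<^bsub>i+1\<^esub>\<close>.\<close>

primrec spectral :: "nat \<Rightarrow> complex" where
  "spectral 0 = u"
| "spectral (Suc k) = spectral k / (q1 ^ (a (Suc k) + 1) * q3 ^ (b (Suc k) + 1))"

lemma spectral_eq: "spectral k = u * q1 powi (- asum (Suc k)) * q3 powi (- bsum (Suc k))"
proof (induction k)
  case 0
  then show ?case by (simp add: asum_def bsum_def)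
next
  case (Suc k)
  have "q1 powi (- asum (Suc (Suc k))) = q1 powi (- asum (Suc k)) / q1 ^ (a (Suc k) + 1)"
    "q3 powi (- bsum (Suc (Suc k))) = q3 powi (- bsum (Suc k)) / q3 ^ (b (Suc k) + 1)"
    using q_nonzero
    by (simp_all add: asum_Suc bsum_Suc power_int_minus_divide power_int_add power_int_diff power_int_add_1 divide_simps)
  then show ?case using Suc by simp
qed

lemma spectral_nonzero: "spectral k \<noteq> 0"
  using q_nonzero u by (simp add: spectral_eq)

text \<open>This closes the cylinder: the resonance makes the tensor factor \<open>n + 1\<close> a copy of the first.\<close>

lemma spectral_periodic: "spectral n = spectral 0"
proof -
  have e: "asum (Suc n) = p'" "bsum (Suc n) = p"
    using n p'_eq p_eq by (simp_all add: asum_Suc bsum_Suc)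
  have "\<exists>k. - p' = p' * k \<and> - p = p * k" by (rule exI[of _ "-1"]) simp
  then have "q1 powi (- p') * q3 powi (- p) = 1" using resonant by blast
  then show ?thesis unfolding spectral_eq[of n] e by (simp add: mult.assoc)
qed

definition Box :: "box set" where "Box = {(i, s, c). 1 \<le> i \<and> i \<le> n \<and> 1 \<le> s}"

fun val :: "box \<Rightarrow> complex" where "val (i, s, c) = q1 ^ c * q3 ^ (s - 1) * spectral (i - 1)"

text \<open>The directions are numbered so that a step in direction \<open>k\<close> multiplies the value by \<open>q\<^sub>k\<close>.\<close>

fun nxt1 :: "box \<Rightarrow> box" where "nxt1 (i, s, c) = (i, s, c + 1)"
fun nxt2 :: "box \<Rightarrow> box" where "nxt2 (i, s, c) = (i mod n + 1, s + b i, c + a i)"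
fun nxt3 :: "box \<Rightarrow> box" where "nxt3 (i, s, c) = (i, s + 1, c)"

definition diag :: "box \<Rightarrow> box" where "diag x = nxt1 (nxt2 (nxt3 x))"

lemma nxt_commute:
  "nxt2 (nxt1 x) = nxt1 (nxt2 x)" "nxt3 (nxt1 x) = nxt1 (nxt3 x)" "nxt3 (nxt2 x) = nxt2 (nxt3 x)"
  by (cases x; simp)+

lemma nxt_in_Box [simp]:
  "x \<in> Box \<Longrightarrow> nxt1 x \<in> Box" "x \<in> Box \<Longrightarrow> nxt2 x \<in> Box" "x \<in> Box \<Longrightarrow> nxt3 x \<in> Box"
  "x \<in> Box \<Longrightarrow> diag x \<in> Box" "x \<in> Box \<Longrightarrow> (diag ^^ m) x \<in> Box"
proof -
  show 1: "x \<in> Box \<Longrightarrow> nxt1 x \<in> Box" "x \<in> Box \<Longrightarrow> nxt2 x \<in> Box" "x \<in> Box \<Longrightarrow> nxt3 x \<in> Box" for x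
    using n by (auto simp: Box_def Suc_le_eq)
  then show 2: "x \<in> Box \<Longrightarrow> diag x \<in> Box" for x by (simp add: diag_def)
  show "x \<in> Box \<Longrightarrow> (diag ^^ m) x \<in> Box" by (induction m) (auto intro: 2)
qed

lemma mod_succ_inj:
  assumes "1 \<le> i" "i \<le> n" "1 \<le> j" "j \<le> n" "i mod n = j mod n"
  shows "i = j"
  using assms by (metis le_neq_implies_less mod_less mod_self not_one_le_zero)

lemma nxt_inj:
  "nxt1 x = nxt1 y \<Longrightarrow> x = y" "nxt3 x = nxt3 y \<Longrightarrow> x = y"
  "x \<in> Box \<Longrightarrow> y \<in> Box \<Longrightarrow> nxt2 x = nxt2 y \<Longrightarrow> x = y"
proof -
  show "nxt1 x = nxt1 y \<Longrightarrow> x = y" "nxt3 x = nxt3 y \<Longrightarrow> x = y" by (cases x; cases y; simp)+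
  show "x = y" if "x \<in> Box" "y \<in> Box" "nxt2 x = nxt2 y"
  proof -
    obtain i s c j t d where xy: "x = (i, s, c)" "y = (j, t, d)" by (cases x, cases y)
    then have "i = j" using that mod_succ_inj[of i j] by (simp add: Box_def)
    then show ?thesis using that xy by simp
  qed
qed

lemma nxt_distinct:
  assumes "x \<in> Box"
  shows "nxt1 x \<noteq> nxt2 x" "nxt1 x \<noteq> nxt3 x" "nxt3 x \<noteq> nxt2 x" "nxt1 x \<noteq> x" "nxt2 x \<noteq> x" "nxt3 x \<noteq> x"
proof -
  obtain i s c where x: "x = (i, s, c)" by (cases x)
  have "i mod n + 1 \<noteq> i"
  proof (cases "i = n")
    case True
    then show ?thesis using n by simp
  next
    case False
    then have "i mod n = i" using assms by (simp add: x Box_def)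
    then show ?thesis by simp
  qed
  then show "nxt1 x \<noteq> nxt2 x" "nxt1 x \<noteq> nxt3 x" "nxt3 x \<noteq> nxt2 x" "nxt1 x \<noteq> x" "nxt2 x \<noteq> x" "nxt3 x \<noteq> x"
    by (auto simp: x)
qed

lemma val_nonzero: "val x \<noteq> 0"
  using q_nonzero spectral_nonzero by (cases x) simp

lemma val_nxt:
  "val (nxt1 x) = q1 * val x"
  "x \<in> Box \<Longrightarrow> val (nxt2 x) = q2 * val x"
  "x \<in> Box \<Longrightarrow> val (nxt3 x) = q3 * val x"
proof -
  obtain i s c where x: "x = (i, s, c)" by (cases x)
  show "val (nxt1 x) = q1 * val x" by (simp add: x)
  show "val (nxt3 x) = q3 * val x" if "x \<in> Box"
    using that by (cases s) (auto simp: x Box_def)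
  show "val (nxt2 x) = q2 * val x" if B: "x \<in> Box"
  proof -
    obtain t where s: "s = Suc t" using B by (cases s) (auto simp: x Box_def)
    obtain k where i: "i = Suc k" using B by (cases i) (auto simp: x Box_def)
    have "spectral (i mod n) = spectral i"
      using B spectral_periodic by (cases "i = n") (auto simp: x Box_def)
    then have "val (nxt2 x) = q1 ^ (c + a i) * q3 ^ (t + b i) * spectral i"
      by (simp add: x s)
    also have "\<dots> = q1 ^ c * q3 ^ t * spectral k / (q1 * q3)"
      using q_nonzero by (simp add: i power_add field_simps)
    also have "\<dots> = q2 * val x"
      using q_nonzero by (simp add: x s i q2_eq field_simps)
    finally show ?thesis .
  qed
qed

lemma val_eq_powi: "x = (i, s, c) \<Longrightarrow> x \<in> Box \<Longrightarrow>
  val x = u * q1 powi (int c - asum i) * q3 powi (int s - 1 - bsum i)"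
proof -
  assume x: "x = (i, s, c)" "x \<in> Box"
  have "int (s - 1) = int s - 1" "Suc (i - 1) = i" using x by (auto simp: Box_def)
  then have "val x = q1 powi int c * q3 powi (int s - 1) * (u * q1 powi (- asum i) * q3 powi (- bsum i))"
    by (simp add: x spectral_eq flip: power_int_of_nat)
  also have "\<dots> = u * (q1 powi int c * q1 powi (- asum i)) * (q3 powi (int s - 1) * q3 powi (- bsum i))"
    by (simp add: algebra_simps)
  also have "\<dots> = u * q1 powi (int c - asum i) * q3 powi (int s - 1 - bsum i)"
    using power_int_add[of q1 "int c" "- asum i"] power_int_add[of q3 "int s - 1" "- bsum i"] q_nonzero
    by simp
  finally show ?thesis .
qed

lemma powi_ratio:
  "q1 powi A * q3 powi B = q1 powi C * q3 powi D \<Longrightarrow> q1 powi (C - A) * q3 powi (D - B) = 1"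
  using q_nonzero by (simp add: power_int_diff field_simps)

text \<open>With \<open>asum\<close> and \<open>bsum\<close> subtracted, the coordinates do not change along the diagonal except that a full
  turn around the cylinder adds \<open>(p', p)\<close>.\<close>

lemma diag_funpow:
  assumes "(i, s, c) \<in> Box"
  obtains s' c' where "(diag ^^ m) (i, s, c) = ((i - 1 + m) mod n + 1, s', c')"
    "int c' - asum ((i - 1 + m) mod n + 1) = int c - asum i + p' * int ((i - 1 + m) div n)"
    "int s' - bsum ((i - 1 + m) mod n + 1) = int s - bsum i + p * int ((i - 1 + m) div n)"
proof -
  have "\<exists>s' c'. (diag ^^ m) (i, s, c) = ((i - 1 + m) mod n + 1, s', c')
    \<and> int c' - asum ((i - 1 + m) mod n + 1) = int c - asum i + p' * int ((i - 1 + m) div n)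
    \<and> int s' - bsum ((i - 1 + m) mod n + 1) = int s - bsum i + p * int ((i - 1 + m) div n)"
  proof (induction m)
    case 0
    have "(i - 1) mod n = i - 1" "(i - 1) div n = 0" "Suc (i - 1) = i"
      using assms by (auto simp: Box_def)
    then show ?case by simp
  next
    case (Suc m)
    define r where "r = i - 1 + m"
    have r: "i - 1 + Suc m = Suc r" by (simp add: r_def)
    obtain s' c' where IH: "(diag ^^ m) (i, s, c) = (r mod n + 1, s', c')"
      "int c' - asum (r mod n + 1) = int c - asum i + p' * int (r div n)"
      "int s' - bsum (r mod n + 1) = int s - bsum i + p * int (r div n)"
      using Suc unfolding r_def by blast
    define j where "j = r mod n + 1"
    have j: "1 \<le> j" "j \<le> n" using n by (auto simp: j_def Suc_le_eq)
    have step: "(diag ^^ Suc m) (i, s, c) = (j mod n + 1, s' + 1 + b j, c' + a j + 1)"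
      using IH(1) by (simp add: diag_def j_def)
    show ?case
    proof (cases "j = n")
      case True
      have "Suc r mod n = 0" "Suc r div n = Suc (r div n)"
        using True n by (auto simp: j_def mod_Suc div_Suc)
      moreover have "asum (0 + 1) = 0" "bsum (0 + 1) = 0" by (simp_all add: asum_def bsum_def)
      moreover have "int c' - asum n = int c - asum i + p' * int (r div n)"
        "int s' - bsum n = int s - bsum i + p * int (r div n)"
        using IH(2,3) True unfolding j_def by simp_all
      ultimately show ?thesis unfolding r step using True p'_eq p_eq
        by (simp add: distrib_left)
    next
      case False
      have "Suc r mod n = j" "Suc r div n = r div n" "j mod n = j"
        using False j n by (auto simp: j_def mod_Suc div_Suc)
      moreover have "int c' - asum j = int c - asum i + p' * int (r div n)"
        "int s' - bsum j = int s - bsum i + p * int (r div n)"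
        using IH(2,3) unfolding j_def by simp_all
      ultimately show ?thesis unfolding r step using j by (simp add: asum_Suc bsum_Suc)
    qed
  qed
  then show ?thesis using that by blast
qed

text \<open>Up to the factor \<open>u\<close>, values are monomials in \<open>q\<^sub>1\<close> and \<open>q\<^sub>3\<close>.  By the resonance, two of them agree
  only if the exponents differ by a multiple of \<open>(p', p)\<close>, which is a number of full turns, and
  the diagonal passes through all tensor factors.\<close>

lemma val_eq_diag:
  assumes x: "x \<in> Box" and y: "y \<in> Box" and eq: "val x = val y"
  shows "(\<exists>m. y = (diag ^^ m) x) \<or> (\<exists>m. x = (diag ^^ Suc m) y)"
proof -
  have key: "y = (diag ^^ m) x"
    if xy: "x = (i, s, c)" "y = (j, t, d)" "x \<in> Box" "y \<in> Box"
      and k: "int d - asum j = int c - asum i + p' * int k" "int t - bsum j = int s - bsum i + p * int k"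
      and m: "i + m = j + n * k" for x y i s c j t d k m
  proof -
    have "i - 1 + m = (j - 1) + n * k" using m xy by (auto simp: Box_def)
    moreover have "j - 1 < n" using xy by (auto simp: Box_def)
    ultimately have dm: "(i - 1 + m) mod n = j - 1" "(i - 1 + m) div n = k" by simp_all
    have "j - 1 + 1 = j" using xy by (auto simp: Box_def)
    then obtain s' c' where "(diag ^^ m) (i, s, c) = (j, s', c')"
      "int c' - asum j = int c - asum i + p' * int k"
      "int s' - bsum j = int s - bsum i + p * int k"
      using diag_funpow[of i s c m] xy unfolding dm by metis
    then show ?thesis using k xy by auto
  qed
  obtain i s c where xc: "x = (i, s, c)" by (cases x)
  obtain j t d where yc: "y = (j, t, d)" by (cases y)
  have "q1 powi (int c - asum i) * q3 powi (int s - 1 - bsum i)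
      = q1 powi (int d - asum j) * q3 powi (int t - 1 - bsum j)"
    using eq u by (simp only: val_eq_powi[OF xc x] val_eq_powi[OF yc y]) simp
  then have "q1 powi ((int d - asum j) - (int c - asum i)) * q3 powi ((int t - 1 - bsum j) - (int s - 1 - bsum i)) = 1"
    by (rule powi_ratio)
  then obtain k where k: "(int d - asum j) - (int c - asum i) = p' * k"
    "(int t - 1 - bsum j) - (int s - 1 - bsum i) = p * k"
    using resonant by blast
  have ij: "1 \<le> i" "i \<le> n" "1 \<le> j" "j \<le> n" using x y by (auto simp: xc yc Box_def)
  consider "k \<ge> 0" "int j + int n * k \<ge> int i" | "k \<le> 0" "int i + int n * (- k) > int j"
  proof (cases "int j + int n * k \<ge> int i")
    case True
    have "k \<ge> 0"
    proof (rule ccontr)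
      assume "\<not> k \<ge> 0"
      then have "int n * k \<le> int n * (-1)" by (intro mult_left_mono) auto
      then show False using True ij by linarith
    qed
    then show ?thesis using True that by blast
  next
    case False
    have "k \<le> 0"
    proof (rule ccontr)
      assume "\<not> k \<le> 0"
      then have "int n * 1 \<le> int n * k" by (intro mult_left_mono) auto
      then show False using False ij by linarith
    qed
    then show ?thesis using False that by (simp add: not_le)
  qed
  then show ?thesis
  proof cases
    case 1
    then obtain k' where k': "k = int k'" using nonneg_int_cases by blast
    have "i \<le> j + n * k'" using 1(2) unfolding k' by (metis of_nat_add of_nat_le_iff of_nat_mult)
    then have "i + (j + n * k' - i) = j + n * k'" by simp
    then have "y = (diag ^^ (j + n * k' - i)) x"
      by (intro key[OF xc yc x y]) (use k k' in auto)
    then show ?thesis by blast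
  next
    case 2
    then obtain k' where k': "- k = int k'" using nonneg_int_cases[of "- k"] by auto
    have "j < i + n * k'" using 2(2) unfolding k' by (metis of_nat_add of_nat_less_iff of_nat_mult)
    then obtain m where m: "j + Suc m = i + n * k'" using less_iff_Suc_add by auto
    have "x = (diag ^^ Suc m) y"
    proof (rule key[OF yc xc y x])
      show "int c - asum i = int d - asum j + p' * int k'" using k(1) by (simp add: k'[symmetric])
      show "int s - bsum i = int t - bsum j + p * int k'" using k(2) by (simp add: k'[symmetric])
    qed (rule m)
    then show ?thesis by blast
  qed
qed

section \<open>Order ideals of boxes\<close>

definition ideal_set :: "box set \<Rightarrow> bool" where
  "ideal_set S \<longleftrightarrow> S \<subseteq> Box \<and>
     (\<forall>x\<in>Box. nxt1 x \<in> S \<or> nxt2 x \<in> S \<or> nxt3 x \<in> S \<longrightarrow> x \<in> S)"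

definition addable :: "box set \<Rightarrow> box \<Rightarrow> bool" where
  "addable S x \<longleftrightarrow> x \<in> Box \<and> x \<notin> S \<and>
     (\<forall>y\<in>Box. nxt1 y = x \<or> nxt2 y = x \<or> nxt3 y = x \<longrightarrow> y \<in> S)"

definition removable :: "box set \<Rightarrow> box \<Rightarrow> bool" where
  "removable S x \<longleftrightarrow> x \<in> S \<and> nxt1 x \<notin> S \<and> nxt2 x \<notin> S \<and> nxt3 x \<notin> S"

text \<open>The place after the last box of a row, whether or not it can be filled.\<close>

definition first_empty :: "box set \<Rightarrow> box \<Rightarrow> bool" where
  "first_empty S x \<longleftrightarrow> x \<in> Box \<and> x \<notin> S \<and> (\<forall>y\<in>Box. nxt1 y = x \<longrightarrow> y \<in> S)"

lemma addable_first_empty: "addable S x \<Longrightarrow> first_empty S x"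
  by (auto simp: addable_def first_empty_def)

lemma ideal_setD:
  assumes "ideal_set S" "x \<in> Box"
  shows "nxt1 x \<in> S \<Longrightarrow> x \<in> S" "nxt2 x \<in> S \<Longrightarrow> x \<in> S" "nxt3 x \<in> S \<Longrightarrow> x \<in> S"
    "diag x \<in> S \<Longrightarrow> x \<in> S" "(diag ^^ m) x \<in> S \<Longrightarrow> x \<in> S"
proof -
  have 1: "nxt1 y \<in> S \<Longrightarrow> y \<in> S" "nxt2 y \<in> S \<Longrightarrow> y \<in> S" "nxt3 y \<in> S \<Longrightarrow> y \<in> S" if "y \<in> Box" for y
    using assms(1) that unfolding ideal_set_def by blast+
  show "nxt1 x \<in> S \<Longrightarrow> x \<in> S" "nxt2 x \<in> S \<Longrightarrow> x \<in> S" "nxt3 x \<in> S \<Longrightarrow> x \<in> S"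
    using 1[OF assms(2)] by auto
  have d: "diag y \<in> S \<Longrightarrow> y \<in> S" if "y \<in> Box" for y
    using 1(1)[of "nxt2 (nxt3 y)"] 1(2)[of "nxt3 y"] 1(3)[of y] that by (simp add: diag_def)
  show "diag x \<in> S \<Longrightarrow> x \<in> S" by (rule d[OF assms(2)])
  show "(diag ^^ m) x \<in> S \<Longrightarrow> x \<in> S"
  proof (induction m)
    case (Suc m)
    then show ?case using d[of "(diag ^^ m) x"] assms(2) by simp
  qed simp
qed

lemma diag_nxt_commute:
  "diag (nxt1 x) = nxt1 (diag x)" "diag (nxt2 x) = nxt2 (diag x)" "diag (nxt3 x) = nxt3 (diag x)"
  by (simp_all add: diag_def nxt_commute)

lemma diag_funpow_nxt:
  "(diag ^^ m) (nxt1 x) = nxt1 ((diag ^^ m) x)" "(diag ^^ m) (nxt2 x) = nxt2 ((diag ^^ m) x)"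
  "(diag ^^ m) (nxt3 x) = nxt3 ((diag ^^ m) x)"
  by (induction m) (simp_all add: diag_nxt_commute)

lemma addableD:
  assumes "addable S x"
  shows "x \<in> Box" "x \<notin> S" "y \<in> Box \<Longrightarrow> nxt1 y = x \<Longrightarrow> y \<in> S"
    "y \<in> Box \<Longrightarrow> nxt2 y = x \<Longrightarrow> y \<in> S" "y \<in> Box \<Longrightarrow> nxt3 y = x \<Longrightarrow> y \<in> S"
  using assms by (auto simp: addable_def)

lemma removableD:
  assumes "ideal_set S" "removable S x"
  shows "x \<in> Box" "x \<in> S" "nxt1 x \<notin> S" "nxt2 x \<notin> S" "nxt3 x \<notin> S"
  using assms unfolding ideal_set_def removable_def by blast+

lemma first_emptyD:
  assumes "first_empty S x"
  shows "x \<in> Box" "x \<notin> S" "y \<in> Box \<Longrightarrow> nxt1 y = x \<Longrightarrow> y \<in> S"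
  using assms by (auto simp: first_empty_def)

text \<open>The following lemmas have one reason.  The values put two boxes outside \<open>S\<close> on a common diagonal,
  possibly after one step.  The upper one is, or is one step above, a box whose predecessors are in \<open>S\<close>
  by addability or, in the first direction, because a row ends there.  The lower one lies below such a
  predecessor, hence in \<open>S\<close>, a contradiction.  For removable boxes the argument is similar, with
  successors.\<close>

lemma first_empty_val_inj:
  assumes S: "ideal_set S" and x: "first_empty S x" and y: "first_empty S y" and eq: "val x = val y"
  shows "x = y"
proof -
  have no: False if x: "first_empty S x" and y: "first_empty S y" and e: "x = (diag ^^ Suc m) y" for x y m
  proof -
    define z where "z = nxt2 (nxt3 ((diag ^^ m) y))"
    have B: "y \<in> Box" "(diag ^^ m) y \<in> Box" "nxt3 ((diag ^^ m) y) \<in> Box" "z \<in> Box"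
      using first_emptyD(1)[OF y] by (simp_all add: z_def)
    have "nxt1 z = x" by (simp add: e z_def diag_def)
    then have "z \<in> S" using first_emptyD(3)[OF x] B by blast
    then have "(diag ^^ m) y \<in> S" 
      using ideal_setD(2)[OF S B(3)] ideal_setD(3)[OF S B(2)] unfolding z_def by simp
    then show False using ideal_setD(5)[OF S B(1)] first_emptyD(2)[OF y] by blast
  qed
  from val_eq_diag[OF first_emptyD(1)[OF x] first_emptyD(1)[OF y] eq]
  consider m where "y = (diag ^^ m) x" | m where "x = (diag ^^ Suc m) y" by blast
  then show ?thesis
  proof cases
    case 1
    show ?thesis
    proof (cases m)
      case 0
      then show ?thesis using 1 by simp
    next
      case (Suc k)
      then show ?thesis using no[OF y x] 1 by blast
    qed
  next
    case 2
    then show ?thesis using no[OF x y] by blast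
  qed
qed

lemma addable_val_q1:
  assumes S: "ideal_set S" and x: "addable S x" and c: "first_empty S c"
  shows "val c \<noteq> q1 * val x"
proof
  assume "val c = q1 * val x"
  then have e: "val (nxt1 x) = val c" by (simp add: val_nxt)
  note B = addableD(1)[OF x] first_emptyD(1)[OF c]
  from val_eq_diag[OF nxt_in_Box(1)[OF B(1)] B(2) e]
  consider m where "c = (diag ^^ m) (nxt1 x)" | m where "nxt1 x = (diag ^^ Suc m) c" by blast
  then show False
  proof cases
    case 1
    then have "nxt1 ((diag ^^ m) x) = c" by (simp add: diag_funpow_nxt)
    then have "(diag ^^ m) x \<in> S" using first_emptyD(3)[OF c] B by simp
    then show False using ideal_setD(5)[OF S] B addableD(2)[OF x] by blast
  next
    case 2
    then have "nxt1 x = nxt1 (nxt2 (nxt3 ((diag ^^ m) c)))" by (simp add: diag_def)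
    then have "nxt2 (nxt3 ((diag ^^ m) c)) = x" by (rule nxt_inj(1)[symmetric])
    then have "nxt3 ((diag ^^ m) c) \<in> S" using addableD(4)[OF x] B by simp
    then have "(diag ^^ m) c \<in> S" using ideal_setD(3)[OF S, of "(diag ^^ m) c"] B by simp
    then show False using ideal_setD(5)[OF S] B first_emptyD(2)[OF c] by blast
  qed
qed

lemma addable_val_q3:
  assumes S: "ideal_set S" and x: "addable S x" and c: "first_empty S c"
  shows "val x \<noteq> q3 * val c"
proof
  note B = addableD(1)[OF x] first_emptyD(1)[OF c]
  assume "val x = q3 * val c"
  then have e: "val (nxt3 c) = val x" using B by (simp add: val_nxt)
  from val_eq_diag[OF nxt_in_Box(3)[OF B(2)] B(1) e]
  consider m where "x = (diag ^^ m) (nxt3 c)" | m where "nxt3 c = (diag ^^ Suc m) x" by blast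
  then show False
  proof cases
    case 1
    then have "nxt3 ((diag ^^ m) c) = x" by (simp add: diag_funpow_nxt)
    then have "(diag ^^ m) c \<in> S" using addableD(5)[OF x] B by simp
    then show False using ideal_setD(5)[OF S] B first_emptyD(2)[OF c] by blast
  next
    case 2
    then have "nxt3 c = nxt3 (nxt1 (nxt2 ((diag ^^ m) x)))" by (simp add: diag_def nxt_commute)
    then have "nxt1 (nxt2 ((diag ^^ m) x)) = c" by (rule nxt_inj(2)[symmetric])
    then have "nxt2 ((diag ^^ m) x) \<in> S" using first_emptyD(3)[OF c] B by simp
    then have "(diag ^^ m) x \<in> S" using ideal_setD(2)[OF S, of "(diag ^^ m) x"] B by simp
    then show False using ideal_setD(5)[OF S] B addableD(2)[OF x] by blast
  qed
qed

lemma addable_val_q2: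
  assumes S: "ideal_set S" and x: "addable S x" and c: "first_empty S c"
  shows "val x \<noteq> q2 * val c"
proof
  note B = addableD(1)[OF x] first_emptyD(1)[OF c]
  assume "val x = q2 * val c"
  then have e: "val (nxt2 c) = val x" using B by (simp add: val_nxt)
  from val_eq_diag[OF nxt_in_Box(2)[OF B(2)] B(1) e]
  consider m where "x = (diag ^^ m) (nxt2 c)" | m where "nxt2 c = (diag ^^ Suc m) x" by blast
  then show False
  proof cases
    case 1
    then have "nxt2 ((diag ^^ m) c) = x" by (simp add: diag_funpow_nxt)
    then have "(diag ^^ m) c \<in> S" using addableD(4)[OF x] B by simp
    then show False using ideal_setD(5)[OF S] B first_emptyD(2)[OF c] by blast
  next
    case 2
    then have e2: "nxt2 c = nxt2 (nxt1 (nxt3 ((diag ^^ m) x)))" by (simp add: diag_def nxt_commute)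
    have "c = nxt1 (nxt3 ((diag ^^ m) x))"
      by (rule nxt_inj(3)[OF _ _ e2]) (use B in simp_all)
    then have "nxt3 ((diag ^^ m) x) \<in> S" using first_emptyD(3)[OF c] B by simp
    then have "(diag ^^ m) x \<in> S" using ideal_setD(3)[OF S, of "(diag ^^ m) x"] B by simp
    then show False using ideal_setD(5)[OF S] B addableD(2)[OF x] by blast
  qed
qed

lemma removable_val_inj:
  assumes S: "ideal_set S" and x: "removable S x" and y: "removable S y" and eq: "val x = val y"
  shows "x = y"
proof -
  have no: False if x: "removable S x" and y: "removable S y" and e: "x = (diag ^^ Suc m) y" for x y m
  proof -
    have B: "y \<in> Box" using y removableD(1)[OF S] by blast
    have e2: "x = nxt2 (nxt3 ((diag ^^ m) (nxt1 y)))"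
      unfolding e by (simp add: diag_def nxt_commute diag_funpow_nxt)
    have "x \<in> S" using x by (simp add: removable_def)
    then have "(diag ^^ m) (nxt1 y) \<in> S"
      unfolding e2 using ideal_setD(2)[OF S, of "nxt3 ((diag ^^ m) (nxt1 y))"]
        ideal_setD(3)[OF S, of "(diag ^^ m) (nxt1 y)"] B by simp
    then have "nxt1 y \<in> S" using ideal_setD(5)[OF S, of "nxt1 y"] B by simp
    then show False using y by (simp add: removable_def)
  qed
  have B: "x \<in> Box" "y \<in> Box" using x y removableD(1)[OF S] by blast+
  from val_eq_diag[OF B eq]
  consider m where "y = (diag ^^ m) x" | m where "x = (diag ^^ Suc m) y" by blast
  then show ?thesis
  proof cases
    case 1
    show ?thesis
    proof (cases m)
      case 0
      then show ?thesis using 1 by simp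
    next
      case (Suc k)
      then show ?thesis using no[OF y x] 1 by blast
    qed
  next
    case 2
    then show ?thesis using no[OF x y] by blast
  qed
qed

lemma addable_removable_val:
  assumes S: "ideal_set S" and x: "addable S x" and y: "removable S y"
  shows "val x \<noteq> val y"
proof
  assume eq: "val x = val y"
  have B: "x \<in> Box" "y \<in> Box" using x y removableD(1)[OF S] addableD(1) by blast+
  from val_eq_diag[OF B eq]
  consider m where "y = (diag ^^ m) x" | m where "x = (diag ^^ Suc m) y" by blast
  then show False
  proof cases
    case 1
    then have "x \<in> S" using y ideal_setD(5)[OF S B(1)] by (auto simp: removable_def)
    then show False using addableD(2)[OF x] by simp
  next
    case 2
    then have "x = nxt2 (nxt3 ((diag ^^ m) (nxt1 y)))"
      by (simp add: diag_def nxt_commute diag_funpow_nxt)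
    then have "nxt3 ((diag ^^ m) (nxt1 y)) \<in> S" using addableD(4)[OF x] B by simp
    then have "nxt1 y \<in> S" using ideal_setD(3)[OF S, of "(diag ^^ m) (nxt1 y)"]
        ideal_setD(5)[OF S, of "nxt1 y"] B by simp
    then show False using y by (simp add: removable_def)
  qed
qed

text \<open>Here \<open>x\<close> and the last box of the row of \<open>y\<close> have the same value, which gives a double pole of \<open>\<psi>\<close>.
  But then \<open>x\<close> is reached by one step in direction 2 and one in direction 3 from a box outside \<open>S\<close> on
  the diagonal of \<open>y\<close>, and the two other vertices of this square are ends of rows, which give two zeros.\<close>

lemma first_empty_q1_cube:
  assumes S: "ideal_set S" and x: "first_empty S x" and y: "first_empty S y"
    and eq: "val y = q1 * val x"
  obtains z3 z2 where "first_empty S z3" "first_empty S z2" "nxt3 z3 = x" "nxt2 z2 = x"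
proof -
  note B = first_emptyD(1)[OF x] first_emptyD(1)[OF y]
  have e: "val (nxt1 x) = val y" using eq by (simp add: val_nxt)
  from val_eq_diag[OF nxt_in_Box(1)[OF B(1)] B(2) e]
  consider m where "y = (diag ^^ m) (nxt1 x)" | m where "nxt1 x = (diag ^^ Suc m) y" by blast
  then show ?thesis
  proof cases
    case 1
    then have "nxt1 ((diag ^^ m) x) = y" by (simp add: diag_funpow_nxt)
    then have "(diag ^^ m) x \<in> S" using first_emptyD(3)[OF y] B by simp
    then show ?thesis using ideal_setD(5)[OF S] B first_emptyD(2)[OF x] by blast
  next
    case 2
    define w where "w = (diag ^^ m) y"
    have wB: "w \<in> Box" using B by (simp add: w_def)
    have wS: "w \<notin> S" using ideal_setD(5)[OF S B(2)] first_emptyD(2)[OF y] unfolding w_def by blast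
    from 2 have "nxt1 x = nxt1 (nxt2 (nxt3 w))" by (simp add: diag_def w_def)
    then have xw: "x = nxt2 (nxt3 w)" by (rule nxt_inj(1))
    have pred: "first_empty S (nxt3 w)"
      unfolding first_empty_def
    proof (intro conjI ballI impI)
      show "nxt3 w \<in> Box" using wB by simp
      show "nxt3 w \<notin> S" using wS ideal_setD(3)[OF S wB] by blast
      fix v assume v: "v \<in> Box" "nxt1 v = nxt3 w"
      then have "nxt1 (nxt2 v) = x" by (simp add: xw flip: nxt_commute(1))
      then have "nxt2 v \<in> S" using first_emptyD(3)[OF x] v by simp
      then show "v \<in> S" using ideal_setD(2)[OF S v(1)] by simp
    qed
    have pred2: "first_empty S (nxt2 w)"
      unfolding first_empty_def
    proof (intro conjI ballI impI)
      show "nxt2 w \<in> Box" using wB by simp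
      show "nxt2 w \<notin> S" using wS ideal_setD(2)[OF S wB] by blast
      fix v assume v: "v \<in> Box" "nxt1 v = nxt2 w"
      then have "nxt1 (nxt3 v) = x" by (simp add: xw nxt_commute(3) flip: nxt_commute(2))
      then have "nxt3 v \<in> S" using first_emptyD(3)[OF x] v by simp
      then show "v \<in> S" using ideal_setD(3)[OF S v(1)] by simp
    qed
    show ?thesis by (rule that[OF pred2 pred]) (simp_all add: xw nxt_commute)
  qed
qed

end

context resonance
begin

lemma insert_addable_ideal: "ideal_set S \<Longrightarrow> addable S x \<Longrightarrow> ideal_set (insert x S)"
  unfolding ideal_set_def addable_def by blast

lemma remove_removable_ideal: "ideal_set S \<Longrightarrow> removable S x \<Longrightarrow> ideal_set (S - {x})"
  unfolding ideal_set_def removable_def by blast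

lemma addable_of_ideal_insert:
  assumes "x \<in> Box" "x \<notin> S" "ideal_set (insert x S)"
  shows "addable S x"
  unfolding addable_def
proof (intro conjI ballI impI)
  fix y assume y: "y \<in> Box" "nxt1 y = x \<or> nxt2 y = x \<or> nxt3 y = x"
  then have "y \<in> insert x S" using assms(3) unfolding ideal_set_def by blast
  moreover have "y \<noteq> x" using nxt_distinct[OF y(1)] y(2) by metis
  ultimately show "y \<in> S" by simp
qed (use assms in auto)

lemma removable_insert:
  assumes "ideal_set S" "addable S x"
  shows "removable (insert x S) x"
  using nxt_distinct[OF addableD(1)[OF assms(2)]] ideal_setD[OF assms(1) addableD(1)[OF assms(2)]]
    addableD(2)[OF assms(2)]
  by (auto simp: removable_def)

lemma addable_remove:
  assumes "ideal_set S" "removable S x"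
  shows "addable (S - {x}) x"
  using assms remove_removable_ideal[OF assms] removableD[OF assms]
  by (intro addable_of_ideal_insert) (auto simp: insert_absorb)

lemma addable_diamond:
  "addable S x \<Longrightarrow> addable S y \<Longrightarrow> x \<noteq> y \<Longrightarrow> addable (insert x S) y"
  unfolding addable_def by blast

lemma addable_after:
  "addable (insert x S) y \<Longrightarrow> \<not> addable S y \<Longrightarrow> y = nxt1 x \<or> y = nxt2 x \<or> y = nxt3 x"
  unfolding addable_def by blast

lemma first_empty_pred:
  assumes S: "ideal_set S" and x: "first_empty S x" and y: "y \<in> Box" "y \<notin> S" "nxt2 y = x \<or> nxt3 y = x"
  shows "first_empty S y"
  unfolding first_empty_def
proof (intro conjI ballI impI)
  fix v assume v: "v \<in> Box" "nxt1 v = y"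
  then have "nxt1 (nxt2 v) = x \<or> nxt1 (nxt3 v) = x" using y(3) by (auto simp: nxt_commute)
  then have "nxt2 v \<in> S \<or> nxt3 v \<in> S" 
    using first_emptyD(3)[OF x, of "nxt2 v"] first_emptyD(3)[OF x, of "nxt3 v"] v(1) nxt_in_Box by blast
  then show "v \<in> S" using ideal_setD[OF S v(1)] by auto
qed (use y in auto)

lemma first_empty_succ:
  assumes S: "ideal_set S" and d: "d \<in> Box" "nxt1 d \<notin> S" "e \<in> S" "e = nxt2 d \<or> e = nxt3 d"
  shows "first_empty S (nxt1 e)"
  unfolding first_empty_def
proof (intro conjI ballI impI)
  show "nxt1 e \<in> Box" using d by auto
  have "nxt1 e = nxt2 (nxt1 d) \<or> nxt1 e = nxt3 (nxt1 d)" using d by (auto simp: nxt_commute)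
  then show "nxt1 e \<notin> S" using ideal_setD[OF S, of "nxt1 d"] d by auto
  fix v assume "nxt1 v = nxt1 e"
  then have "v = e" by (rule nxt_inj)
  then show "v \<in> S" using d by simp
qed

section \<open>Tuples of partitions as order ideals\<close>

definition boxes :: "tuple \<Rightarrow> box set" where
  "boxes L = {(i, s, c). 1 \<le> i \<and> i \<le> n \<and> 1 \<le> s \<and> c < L i s}"

definition row_tuples :: "tuple set" where
  "row_tuples = {1..n} \<rightarrow>\<^sub>E {l. l 0 = 0 \<and> finite {s. l s \<noteq> 0}}"

abbreviation states :: "tuple set" where "states \<equiv> resonant_basis a b n"

text \<open>For the first direction the ideal condition is automatic, for the third one it says that the rows
  decrease, and for the second one it is the interlacing condition between neighbouring partitions.\<close>

lemma states_iff: "L \<in> states \<longleftrightarrow> L \<in> row_tuples \<and> ideal_set (boxes L)"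
proof
  assume L: "L \<in> states"
  then have part: "L i \<in> partitions" if "i \<in> {1..n}" for i
    using that by (auto simp: resonant_basis_def)
  have c2: "int (L i s) \<ge> int (L (i mod n + 1) (s + b i)) - int (a i)" if "i \<in> {1..n}" "s \<ge> 1" for i s
    using that L by (auto simp: resonant_basis_def)
  have "L \<in> row_tuples"
    using L unfolding resonant_basis_def row_tuples_def partitions_def by (auto simp: PiE_def Pi_def)
  moreover have "x \<in> boxes L" if x: "x \<in> Box" "nxt1 x \<in> boxes L \<or> nxt2 x \<in> boxes L \<or> nxt3 x \<in> boxes L" for x
  proof -
    obtain i s c where e: "x = (i, s, c)" by (cases x)
    have i: "i \<in> {1..n}" "1 \<le> s" using x by (auto simp: e Box_def)
    have "L i (s + 1) \<le> L i s" using part[OF i(1)] i by (auto simp: partitions_def)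
    then have "c < L i s" using x(2) c2[OF i] by (auto simp: boxes_def e)
    then show ?thesis using i by (auto simp: e boxes_def)
  qed
  ultimately show "L \<in> row_tuples \<and> ideal_set (boxes L)"
    unfolding ideal_set_def by (auto simp: boxes_def Box_def)
next
  assume L: "L \<in> row_tuples \<and> ideal_set (boxes L)"
  then have S: "ideal_set (boxes L)" by simp
  have r: "L i 0 = 0" "finite {s. L i s \<noteq> 0}" if "i \<in> {1..n}" for i
    using L that by (auto simp: row_tuples_def)
  have s3: "L i (Suc s) \<le> L i s" if "i \<in> {1..n}" "s \<ge> 1" for i s
  proof (rule ccontr)
    assume "\<not> ?thesis"
    then have "nxt3 (i, s, L i s) \<in> boxes L" using that by (auto simp: boxes_def)
    then have "(i, s, L i s) \<in> boxes L" using ideal_setD(3)[OF S, of "(i, s, L i s)"] that by (auto simp: Box_def)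
    then show False by (simp add: boxes_def)
  qed
  have s2: "int (L i s) \<ge> int (L (i mod n + 1) (s + b i)) - int (a i)" if "i \<in> {1..n}" "s \<ge> 1" for i s
  proof (rule ccontr)
    assume "\<not> ?thesis"
    moreover have "i mod n + 1 \<le> n" using n by (simp add: Suc_le_eq)
    ultimately have "nxt2 (i, s, L i s) \<in> boxes L" using that by (auto simp: boxes_def)
    then have "(i, s, L i s) \<in> boxes L" using ideal_setD(2)[OF S, of "(i, s, L i s)"] that by (auto simp: Box_def)
    then show False by (simp add: boxes_def)
  qed
  have "L i \<in> partitions" if "i \<in> {1..n}" for i
    using r[OF that] s3[OF that] by (auto simp: partitions_def)
  then have "L \<in> {1..n} \<rightarrow>\<^sub>E partitions" using L by (auto simp: row_tuples_def)
  then show "L \<in> states" using s2 by (auto simp: resonant_basis_def)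
qed

lemma states_ideal: "L \<in> states \<Longrightarrow> ideal_set (boxes L)"
  by (simp add: states_iff)

lemma boxes_inj:
  assumes "L \<in> states" "M \<in> states" "boxes L = boxes M"
  shows "L = M"
proof (intro ext)
  fix i s
  have r: "L \<in> row_tuples" "M \<in> row_tuples" using assms by (auto simp: states_iff)
  show "L i s = M i s"
  proof (cases "i \<in> {1..n}")
    case False
    then show ?thesis using r by (auto simp: row_tuples_def PiE_def extensional_def)
  next
    case True
    show ?thesis
    proof (cases "s = 0")
      case True
      then show ?thesis using r \<open>i \<in> _\<close> by (auto simp: row_tuples_def PiE_def Pi_def)
    next
      case False
      then have "c < L i s \<longleftrightarrow> c < M i s" for c
        using arg_cong[OF assms(3), of "\<lambda>S. (i, s, c) \<in> S"] True by (simp add: boxes_def)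
      then show ?thesis by (meson less_irrefl nat_neq_iff)
    qed
  qed
qed

definition corner :: "tuple \<Rightarrow> nat \<times> nat \<Rightarrow> box" where
  "corner L r = (fst r, snd r, L (fst r) (snd r))"

definition row_of :: "box \<Rightarrow> nat \<times> nat" where
  "row_of x = (fst x, fst (snd x))"

definition add_at :: "tuple \<Rightarrow> box \<Rightarrow> tuple" where
  "add_at L x = add_box L (fst x) (fst (snd x))"

definition remove_at :: "tuple \<Rightarrow> box \<Rightarrow> tuple" where
  "remove_at L x = (let i = fst x; s = fst (snd x) in L(i := (L i)(s := L i s - 1)))"

lemma corner_first_empty:
  assumes "1 \<le> i" "i \<le> n" "1 \<le> s"
  shows "first_empty (boxes L) (corner L (i, s))"
  using assms by (auto simp: first_empty_def corner_def boxes_def Box_def)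

lemma first_empty_corner:
  assumes "first_empty (boxes L) x"
  shows "x = corner L (row_of x)"
proof -
  obtain i s c where x: "x = (i, s, c)" by (cases x)
  have B: "1 \<le> i" "i \<le> n" "1 \<le> s" using first_emptyD(1)[OF assms] by (auto simp: x Box_def)
  have "\<not> c < L i s" using first_emptyD(2)[OF assms] B by (auto simp: x boxes_def)
  moreover have "c \<le> L i s"
  proof (cases c)
    case (Suc d)
    have "(i, s, d) \<in> boxes L"
      by (rule first_emptyD(3)[OF assms]) (use B in \<open>auto simp: x Suc Box_def\<close>)
    then show ?thesis by (simp add: boxes_def Suc)
  qed simp
  ultimately show ?thesis by (simp add: x corner_def row_of_def)
qed

lemma boxes_add_corner:
  assumes "1 \<le> i" "i \<le> n" "1 \<le> s"
  shows "boxes (add_box L i s) = insert (i, s, L i s) (boxes L)"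
  using assms by (auto simp: boxes_def add_box_def less_Suc_eq split: if_splits)

lemma add_box_row_tuples:
  assumes "1 \<le> i" "i \<le> n" "1 \<le> s" "L \<in> row_tuples"
  shows "add_box L i s \<in> row_tuples"
proof -
  have "finite {t. (if t = s then L i s + 1 else L i t) \<noteq> 0}"
    by (rule finite_subset[of _ "insert s {t. L i t \<noteq> 0}"]) (use assms in \<open>auto simp: row_tuples_def\<close>)
  then have "(L i)(s := L i s + 1) \<in> {l. l 0 = 0 \<and> finite {s. l s \<noteq> 0}}"
    using assms unfolding fun_upd_def by (simp add: row_tuples_def PiE_def Pi_def)
  then show ?thesis using assms unfolding row_tuples_def add_box_def by (auto simp: PiE_def Pi_def extensional_def)
qed

lemma add_at_state:
  assumes L: "L \<in> states" and x: "addable (boxes L) x"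
  shows "add_at L x \<in> states" "boxes (add_at L x) = insert x (boxes L)"
proof -
  obtain i s c where e: "x = (i, s, c)" by (cases x)
  have B: "1 \<le> i" "i \<le> n" "1 \<le> s" using addableD(1)[OF x] by (auto simp: e Box_def)
  have "x = corner L (row_of x)" by (rule first_empty_corner[OF addable_first_empty[OF x]])
  then have c: "c = L i s" by (simp add: e corner_def row_of_def)
  show 1: "boxes (add_at L x) = insert x (boxes L)"
    using boxes_add_corner[OF B] by (simp add: e c add_at_def)
  show "add_at L x \<in> states"
    unfolding states_iff 1
    using insert_addable_ideal[OF states_ideal[OF L] x] add_box_row_tuples[OF B] L
    by (simp add: states_iff add_at_def e)
qed

lemma remove_at_state:
  assumes L: "L \<in> states" and x: "removable (boxes L) x"
  shows "remove_at L x \<in> states" "boxes (remove_at L x) = boxes L - {x}"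
    "addable (boxes (remove_at L x)) x" "add_at (remove_at L x) x = L"
proof -
  note S = states_ideal[OF L]
  obtain i s c where e: "x = (i, s, c)" by (cases x)
  have B: "1 \<le> i" "i \<le> n" "1 \<le> s" using removableD(1)[OF S x] by (auto simp: e Box_def)
  have c: "L i s = Suc c"
    using removableD[OF S x] B by (auto simp: e boxes_def)
  have 1: "remove_at L x = L(i := (L i)(s := c))" by (simp add: remove_at_def e c)
  show 2: "boxes (remove_at L x) = boxes L - {x}"
    unfolding 1 using c by (auto simp: boxes_def e split: if_splits)
  have "finite {t. (if t = s then c else L i t) \<noteq> 0}"
    by (rule finite_subset[of _ "insert s {t. L i t \<noteq> 0}"]) (use B L in \<open>auto simp: row_tuples_def states_iff\<close>)
  then have "(L i)(s := c) \<in> {l. l 0 = 0 \<and> finite {s. l s \<noteq> 0}}"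
    using B L by (auto simp: row_tuples_def states_iff fun_upd_def PiE_def Pi_def)
  then have "remove_at L x \<in> row_tuples"
    using B L unfolding 1 row_tuples_def states_iff by (auto simp: PiE_def Pi_def extensional_def)
  then show 3: "remove_at L x \<in> states"
    unfolding states_iff 2 using remove_removable_ideal[OF S x] by simp
  show 4: "addable (boxes (remove_at L x)) x" unfolding 2 by (rule addable_remove[OF S x])
  show "add_at (remove_at L x) x = L"
    by (rule boxes_inj)
       (use add_at_state[OF 3 4] L removableD(2)[OF S x] in \<open>auto simp: 2 insert_absorb\<close>)
qed

lemma remove_add_at:
  assumes L: "L \<in> states" and x: "addable (boxes L) x"
  shows "removable (boxes (add_at L x)) x" "remove_at (add_at L x) x = L"
proof -
  note A = add_at_state[OF L x]
  show 1: "removable (boxes (add_at L x)) x"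
    unfolding A(2) by (rule removable_insert[OF states_ideal[OF L] x])
  show "remove_at (add_at L x) x = L"
    by (rule boxes_inj) (use remove_at_state[OF A(1) 1] L A addableD(2)[OF x] in auto)
qed

lemma add_box_state_imp_addable:
  assumes "L \<in> states" "1 \<le> i" "i \<le> n" "1 \<le> s" "add_box L i s \<in> states"
  shows "addable (boxes L) (i, s, L i s)"
  using assms(2-4) states_ideal[OF assms(5)] unfolding boxes_add_corner[OF assms(2-4)]
  by (intro addable_of_ideal_insert) (auto simp: Box_def boxes_def)

lemma add_at_commute:
  assumes L: "L \<in> states" and x: "addable (boxes L) x" and y: "addable (boxes L) y" and ne: "x \<noteq> y"
  shows "add_at (add_at L x) y = add_at (add_at L y) x"
    "addable (boxes (add_at L x)) y" "addable (boxes (add_at L y)) x"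
proof -
  note A = add_at_state[OF L x] add_at_state[OF L y]
  show 1: "addable (boxes (add_at L x)) y" unfolding A by (rule addable_diamond[OF x y ne])
  show 2: "addable (boxes (add_at L y)) x" unfolding A by (rule addable_diamond[OF y x ne[symmetric]])
  show "add_at (add_at L x) y = add_at (add_at L y) x"
    by (rule boxes_inj) (use add_at_state[OF A(1) 1] add_at_state[OF A(3) 2] A in auto)
qed

text \<open>The rows beyond a common bound are empty.\<close>

definition height_bound :: "tuple \<Rightarrow> nat \<Rightarrow> bool" where
  "height_bound L N \<longleftrightarrow> (\<forall>i\<in>{1..n}. \<forall>s>N. L i s = 0)"

lemma height_bound_exists:
  assumes "L \<in> states"
  shows "\<exists>N. height_bound L N"
proof -
  have "finite (\<Union>i\<in>{1..n}. {s. L i s \<noteq> 0})"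
    using assms by (auto simp: states_iff row_tuples_def)
  then obtain N where N: "\<forall>s\<in>(\<Union>i\<in>{1..n}. {s. L i s \<noteq> 0}). s \<le> N"
    using finite_nat_set_iff_bounded_le by blast
  have "L i s = 0" if "i \<in> {1..n}" "s > N" for i s
  proof (rule ccontr)
    assume "L i s \<noteq> 0"
    then have "s \<le> N" using N that(1) by blast
    then show False using that(2) by simp
  qed
  then show ?thesis unfolding height_bound_def by blast
qed

lemma finite_boxes:
  assumes "L \<in> states"
  shows "finite (boxes L)"
proof -
  have "boxes L = (SIGMA i:{1..n}. SIGMA s:{s. L i s \<noteq> 0}. {..<L i s})"
  proof -
    have "L i 0 = 0" if "i \<in> {1..n}" for i using assms that by (auto simp: states_iff row_tuples_def)
    then show ?thesis by (auto simp: boxes_def Suc_le_eq intro: gr0I)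
  qed
  also have "finite \<dots>"
    using assms by (intro finite_SigmaI) (auto simp: states_iff row_tuples_def)
  finally show ?thesis .
qed

lemma tuple_degree_card:
  assumes "L \<in> states"
  shows "tuple_degree n L = card (boxes L)"
proof -
  have "L i 0 = 0" if "i \<in> {1..n}" for i using assms that by (auto simp: states_iff row_tuples_def)
  then have "boxes L = (SIGMA i:{1..n}. SIGMA s:{s. L i s \<noteq> 0}. {..<L i s})"
    by (auto simp: boxes_def Suc_le_eq intro: gr0I)
  moreover have "finite {s. L i s \<noteq> 0}" if "i \<in> {1..n}" for i
    using assms that by (auto simp: states_iff row_tuples_def)
  ultimately show ?thesis by (simp add: tuple_degree_def card_SigmaI)
qed

definition rows :: "nat \<Rightarrow> (nat \<times> nat) set" where "rows N = {1..n} \<times> {1..N}"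

lemma finite_rows [simp]: "finite (rows N)"
  by (simp add: rows_def)

lemma row_of_corner [simp]: "row_of (corner L r) = r"
  by (simp add: row_of_def corner_def)

lemma corner_rows_first_empty: "r \<in> rows N \<Longrightarrow> first_empty (boxes L) (corner L r)"
  using corner_first_empty by (cases r) (auto simp: rows_def)

lemma row_of_nxt: "row_of (nxt3 x) = (fst (row_of x), Suc (snd (row_of x)))" "row_of (nxt1 x) = row_of x"
  "snd (row_of x) \<le> snd (row_of (nxt2 x))"
  by (cases x; simp add: row_of_def)+

lemma row_of_rows_iff: "x \<in> Box \<Longrightarrow> row_of x \<in> rows N \<longleftrightarrow> snd (row_of x) \<le> N"
  by (cases x) (auto simp: row_of_def rows_def Box_def)

lemma height_bound_boxes: "height_bound L N \<Longrightarrow> x \<in> boxes L \<Longrightarrow> snd (row_of x) \<le> N"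
proof (rule ccontr)
  assume *: "height_bound L N" "x \<in> boxes L" "\<not> snd (row_of x) \<le> N"
  obtain i s c where "x = (i, s, c)" by (cases x)
  with * show False by (auto simp: height_bound_def boxes_def row_of_def)
qed

text \<open>As a product over rows, \<open>\<psi>(z)\<close> has poles at the corner and at the last box of each row, and zeros
  at the \<open>q\<^sub>3\<close>- and \<open>q\<^sub>2\<close>-multiples of the corners.  A corner that is not addable has an empty predecessor
  in direction 2 or 3, which is a corner and gives a zero.  A last box that is not removable
  has a successor in direction 2 or 3 inside the ideal, and the end of the row of this successor gives a
  zero.  An empty row has a pole one step before its first place, and the next row, also empty, gives
  the zero.  If both kinds of poles occur together, there are two zeros.\<close>

lemma pole_zero_count:
  assumes L: "L \<in> states" and N: "height_bound L N"
  shows "card {r \<in> rows (Suc N). val (corner L r) = P} + card {r \<in> rows N. val (corner L r) = q1 * P}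
    \<le> card {r \<in> rows N. q3 * val (corner L r) = P} + card {r \<in> rows (Suc N). q2 * val (corner L r) = P}
      + (if \<exists>x. (addable (boxes L) x \<or> removable (boxes L) x) \<and> val x = P then 1 else 0)"
proof -
  let ?S = "boxes L"
  let ?A = "{r \<in> rows (Suc N). val (corner L r) = P}" and ?B = "{r \<in> rows N. val (corner L r) = q1 * P}"
  let ?Z3 = "{r \<in> rows N. q3 * val (corner L r) = P}" and ?Z2 = "{r \<in> rows (Suc N). q2 * val (corner L r) = P}"
  let ?C = "\<exists>x. (addable ?S x \<or> removable ?S x) \<and> val x = P"
  note S = states_ideal[OF L]
  have inj: "r = r'" if "r \<in> rows M" "r' \<in> rows M" "val (corner L r) = val (corner L r')" for r r' M
  proof -
    have "corner L r = corner L r'"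
      by (rule first_empty_val_inj[OF S]) (use that corner_rows_first_empty in auto)
    then show ?thesis by (metis row_of_corner)
  qed
  have A1: "card ?A \<le> 1"
  proof -
    have "\<forall>x\<in>?A. \<forall>y\<in>?A. x = y"
    proof (intro ballI)
      fix x y assume "x \<in> ?A" "y \<in> ?A"
      then show "x = y" using inj[of x "Suc N" y] by simp
    qed
    then show ?thesis by (simp add: card_le_Suc0_iff_eq)
  qed
  have B1: "card ?B \<le> 1"
  proof -
    have "\<forall>x\<in>?B. \<forall>y\<in>?B. x = y"
    proof (intro ballI)
      fix x y assume "x \<in> ?B" "y \<in> ?B"
      then show "x = y" using inj[of x "N" y] by simp
    qed
    then show ?thesis by (simp add: card_le_Suc0_iff_eq)
  qed
  have card_pos: "card {r \<in> rows M. Q r} \<ge> 1" if "r \<in> {r \<in> rows M. Q r}" for r M Q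
  proof -
    have "finite {r \<in> rows M. Q r}" by simp
    then have "0 < card {r \<in> rows M. Q r}" using that unfolding card_gt_0_iff by blast
    then show ?thesis by simp
  qed
  have Z3: "card ?Z3 \<ge> 1" if z: "first_empty ?S z" "snd (row_of z) \<le> N" "val (nxt3 z) = P" for z
  proof -
    note B = first_emptyD(1)[OF z(1)]
    have "row_of z \<in> ?Z3"
      using z B first_empty_corner[OF z(1), symmetric] by (simp add: row_of_rows_iff val_nxt)
    then show ?thesis by (rule card_pos)
  qed
  have Z2: "card ?Z2 \<ge> 1" if z: "first_empty ?S z" "snd (row_of z) \<le> Suc N" "val (nxt2 z) = P" for z
  proof -
    note B = first_emptyD(1)[OF z(1)]
    have "row_of z \<in> ?Z2"
      using z B first_empty_corner[OF z(1), symmetric] by (simp add: row_of_rows_iff val_nxt)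
    then show ?thesis by (rule card_pos)
  qed
  have AB: "card ?Z3 \<ge> 1 \<and> card ?Z2 \<ge> 1" if "r \<in> ?A" "r' \<in> ?B" for r r'
  proof -
    have *: "first_empty ?S (corner L r)" "first_empty ?S (corner L r')"
      "val (corner L r') = q1 * val (corner L r)"
      using that corner_rows_first_empty[of r "Suc N"] corner_rows_first_empty[of r' N] by simp_all
    have rN: "snd r \<le> Suc N" using that by (auto simp: rows_def)
    obtain z3 z2 where z: "first_empty ?S z3" "first_empty ?S z2" "nxt3 z3 = corner L r" "nxt2 z2 = corner L r"
      using first_empty_q1_cube[OF S *] .
    have "Suc (snd (row_of z3)) = snd r" using row_of_nxt(1)[of z3] unfolding z(3) by simp
    moreover have "snd (row_of z2) \<le> snd r" using row_of_nxt(3)[of z2] unfolding z(4) by simp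
    ultimately show ?thesis using Z3[OF z(1)] Z2[OF z(2)] rN that(1) by (simp add: z(3,4))
  qed
  have Aonly: "card ?Z3 \<ge> 1 \<or> card ?Z2 \<ge> 1 \<or> ?C" if "r \<in> ?A" for r
  proof (cases "addable ?S (corner L r)")
    case True
    then show ?thesis using that by blast
  next
    case False
    have x: "first_empty ?S (corner L r)" using that corner_rows_first_empty[of r "Suc N"] by simp
    have rN: "snd r \<le> Suc N" using that by (auto simp: rows_def)
    obtain y where y: "y \<in> Box" "y \<notin> ?S" "nxt2 y = corner L r \<or> nxt3 y = corner L r"
      using False x unfolding addable_def first_empty_def by blast
    note fe = first_empty_pred[OF S x y]
    show ?thesis using y(3)
    proof
      assume e: "nxt2 y = corner L r"
      then have "snd (row_of y) \<le> snd r" using row_of_nxt(3)[of y] by simp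
      then show ?thesis using Z2[OF fe] e that rN by auto
    next
      assume e: "nxt3 y = corner L r"
      then have "Suc (snd (row_of y)) = snd r" using row_of_nxt(1)[of y] by simp
      then show ?thesis using Z3[OF fe] e that rN by auto
    qed
  qed
  have Bonly: "card ?Z3 \<ge> 1 \<or> card ?Z2 \<ge> 1 \<or> ?C" if r: "r \<in> ?B" for r
  proof -
    obtain j t where rjt: "r = (j, t)" by (cases r)
    have jt: "1 \<le> j" "j \<le> n" "1 \<le> t" "t \<le> N" using r by (auto simp: rjt rows_def)
    have vx: "val (corner L r) = q1 * P" using r by simp
    have qqq: "q2 * (q3 * (q1 * P)) = P" "q3 * (q2 * (q1 * P)) = P"
    proof -
      have "q2 * (q3 * (q1 * P)) = (q1 * q2 * q3) * P" "q3 * (q2 * (q1 * P)) = (q1 * q2 * q3) * P"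
        by (simp_all only: mult_ac)
      then show "q2 * (q3 * (q1 * P)) = P" "q3 * (q2 * (q1 * P)) = P" unfolding q by simp_all
    qed
    show ?thesis
    proof (cases "L j t")
      case 0
      have "L j (Suc t) = 0"
      proof (rule ccontr)
        assume "L j (Suc t) \<noteq> 0"
        then have "nxt3 (j, t, 0) \<in> ?S" using jt by (auto simp: boxes_def)
        then have "(j, t, 0) \<in> ?S" using ideal_setD(3)[OF S, of "(j, t, 0)"] jt by (auto simp: Box_def)
        then show False using 0 by (simp add: boxes_def)
      qed
      then have e: "corner L (j, Suc t) = nxt3 (corner L r)" by (simp add: corner_def rjt 0)
      have B: "corner L r \<in> Box" "corner L (j, Suc t) \<in> Box"
        using jt by (auto simp: corner_def rjt Box_def)
      have "val (nxt2 (corner L (j, Suc t))) = P"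
        using B vx qqq by (simp add: val_nxt e)
      then have "card ?Z2 \<ge> 1"
        using Z2[of "corner L (j, Suc t)"] corner_first_empty[of j "Suc t"] jt by simp
      then show ?thesis by simp
    next
      case (Suc l)
      define d where "d = (j, t, l)"
      have d: "d \<in> Box" "d \<in> ?S" "nxt1 d = corner L r" "nxt1 d \<notin> ?S"
        using jt Suc by (auto simp: d_def Box_def boxes_def corner_def rjt)
      have vd: "val d = P" using vx q_nonzero by (simp add: d(3)[symmetric] val_nxt)
      consider "removable ?S d" | "nxt3 d \<in> ?S" | "nxt2 d \<in> ?S"
        using d unfolding removable_def by blast
      then show ?thesis
      proof cases
        case 1
        then show ?thesis using vd by blast
      next
        case 2
        have "first_empty ?S (nxt1 (nxt3 d))" by (rule first_empty_succ[OF S d(1,4) 2]) simp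
        moreover have "snd (row_of (nxt1 (nxt3 d))) \<le> Suc N"
          using height_bound_boxes[OF N 2] by (simp add: row_of_nxt)
        moreover have "val (nxt2 (nxt1 (nxt3 d))) = P"
          using d(1) vd qqq by (simp add: val_nxt mult.left_commute)
        ultimately show ?thesis using Z2 by blast
      next
        case 3
        have "first_empty ?S (nxt1 (nxt2 d))" by (rule first_empty_succ[OF S d(1,4) 3]) simp
        moreover have "snd (row_of (nxt1 (nxt2 d))) \<le> N"
          using height_bound_boxes[OF N 3] by (simp add: row_of_nxt)
        moreover have "val (nxt3 (nxt1 (nxt2 d))) = P"
          using d(1) vd qqq by (simp add: val_nxt mult.left_commute)
        ultimately show ?thesis using Z3 by blast
      qed
    qed
  qed
  define w :: nat where "w = (if ?C then 1 else 0)"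
  have w: "w = 1" if ?C using that unfolding w_def by (rule if_P)
  have "card ?A + card ?B \<le> card ?Z3 + card ?Z2 + w"
  proof (cases "?A = {}")
    case True
    then have A0: "card ?A = 0" by (simp only: card.empty)
    show ?thesis
    proof (cases "?B = {}")
      case True
      then have "card ?B = 0" by (simp only: card.empty)
      then show ?thesis using A0 by linarith
    next
      case False
      then obtain r where "r \<in> ?B" by blast
      then have "card ?Z3 \<ge> 1 \<or> card ?Z2 \<ge> 1 \<or> w = 1" using Bonly w by blast
      then show ?thesis using A0 B1 by linarith
    qed
  next
    case A: False
    then obtain r where r: "r \<in> ?A" by blast
    show ?thesis
    proof (cases "?B = {}")
      case True
      then have "card ?B = 0" by (simp only: card.empty)
      moreover have "card ?Z3 \<ge> 1 \<or> card ?Z2 \<ge> 1 \<or> w = 1" using Aonly[OF r] w by blast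
      ultimately show ?thesis using A1 by linarith
    next
      case False
      then obtain r' where "r' \<in> ?B" by blast
      from AB[OF r this] show ?thesis using A1 B1 by linarith
    qed
  qed
  then show ?thesis unfolding w_def .
qed

end

section \<open>Amplitudes as products over rows\<close>

definition row_ratio :: "'k::field \<Rightarrow> 'k \<Rightarrow> 'k \<Rightarrow> 'k" where
  "row_ratio q1 q3 y = ((1 - q3 * y) * (1 - inverse (q1 * q3) * y)) / ((1 - y) * (1 - inverse q1 * y))"

definition end_ratio :: "'k::field \<Rightarrow> 'k \<Rightarrow> 'k \<Rightarrow> 'k" where
  "end_ratio q1 q3 y = (1 - inverse (q1 * q3) * y) / (1 - y)"

lemma psi_row_eq_row_ratio:
  assumes "q1 \<noteq> 0" "j \<ge> 1"
  shows "psi_row q1 q3 l j x = row_ratio q1 q3 (q1 ^ l j * q3 ^ (j - 1) * x)"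
proof -
  obtain i where j: "j = Suc i" using assms by (cases j) auto
  have "q1 powi (int (l j) - 1) = inverse q1 * q1 ^ l j"
    using assms by (simp add: power_int_diff field_simps)
  then show ?thesis
    by (simp add: psi_row_def row_ratio_def Let_def j mult_ac)
qed

text \<open>Consecutive empty rows telescope.  This replaces the normalization by empty rows with a single end
  factor, and removes the binomials of the definition that may vanish at the resonance.\<close>

lemma truncated_product:
  fixes q1 q3 x :: "'k::field"
  assumes q: "q1 \<noteq> 0" "q3 \<noteq> 0" and sN: "s \<le> N" and l: "\<And>t. t > N \<Longrightarrow> l t = 0"
    and nz: "\<And>t. s \<le> t \<Longrightarrow> t \<le> N \<Longrightarrow> 1 - q3 ^ t * x \<noteq> 0 \<and> 1 - inverse (q1 * q3) * (q3 ^ t * x) \<noteq> 0"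
  shows "end_ratio q1 q3 (q3 ^ s * x) * (\<Prod>t | s < t \<and> l t \<noteq> 0. psi_row q1 q3 l t x / psi_row q1 q3 (\<lambda>_. 0) t x)
    = end_ratio q1 q3 (q3 ^ N * x) * (\<Prod>t\<in>{s<..N}. row_ratio q1 q3 (q1 ^ l t * q3 ^ (t - 1) * x))"
proof -
  have row0: "psi_row q1 q3 (\<lambda>_. 0) (Suc t) x = end_ratio q1 q3 (q3 ^ t * x) / end_ratio q1 q3 (q3 ^ Suc t * x)" for t
  proof -
    have "inverse q1 * (q3 ^ t * x) = inverse (q1 * q3) * (q3 ^ Suc t * x)"
      using q by (simp add: field_simps)
    then have e: "psi_row q1 q3 (\<lambda>_. 0) (Suc t) x = ((1 - q3 ^ Suc t * x) * (1 - inverse (q1 * q3) * (q3 ^ t * x)))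
        / ((1 - q3 ^ t * x) * (1 - inverse (q1 * q3) * (q3 ^ Suc t * x)))"
      using q by (simp add: psi_row_eq_row_ratio row_ratio_def mult.assoc)
    show ?thesis unfolding e end_ratio_def by simp
  qed
  have nz0: "psi_row q1 q3 (\<lambda>_. 0) t x \<noteq> 0" if "t \<in> {s<..N}" for t
  proof -
    define r where "r = t - 1"
    have r: "t = Suc r" using that by (simp add: r_def)
    show ?thesis using nz[of r] nz[of t] that unfolding r row0 end_ratio_def by simp
  qed
  have "(\<Prod>t | s < t \<and> l t \<noteq> 0. psi_row q1 q3 l t x / psi_row q1 q3 (\<lambda>_. 0) t x)
      = (\<Prod>t\<in>{s<..N}. psi_row q1 q3 l t x / psi_row q1 q3 (\<lambda>_. 0) t x)"
  proof (rule prod.mono_neutral_left)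
    show "{t. s < t \<and> l t \<noteq> 0} \<subseteq> {s<..N}" using l by (auto simp: not_less[symmetric])
    show "\<forall>t\<in>{s<..N} - {t. s < t \<and> l t \<noteq> 0}. psi_row q1 q3 l t x / psi_row q1 q3 (\<lambda>_. 0) t x = 1"
    proof
      fix t assume t: "t \<in> {s<..N} - {t. s < t \<and> l t \<noteq> 0}"
      then have "l t = 0" by simp
      then have "psi_row q1 q3 l t x = psi_row q1 q3 (\<lambda>_. 0) t x" by (simp add: psi_row_def)
      then show "psi_row q1 q3 l t x / psi_row q1 q3 (\<lambda>_. 0) t x = 1" using nz0[of t] t by simp
    qed
  qed simp
  also have "\<dots> = (\<Prod>t\<in>{s<..N}. psi_row q1 q3 l t x) / (\<Prod>t\<in>{s<..N}. psi_row q1 q3 (\<lambda>_. 0) t x)"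
    by (rule prod_dividef)
  also have "(\<Prod>t\<in>{s<..N}. psi_row q1 q3 (\<lambda>_. 0) t x) = end_ratio q1 q3 (q3 ^ s * x) / end_ratio q1 q3 (q3 ^ N * x)"
    using sN nz
  proof (induction N rule: dec_induct)
    case base
    then show ?case using nz[of s] sN by (simp add: end_ratio_def)
  next
    case (step M)
    have "{s<..Suc M} = insert (Suc M) {s<..M}" using step.hyps by auto
    moreover have "end_ratio q1 q3 (q3 ^ M * x) \<noteq> 0"
      using step.prems[of M] step.hyps by (simp add: end_ratio_def)
    ultimately show ?case using step.IH step.prems by (simp add: row0[simplified])
  qed
  also have "(\<Prod>t\<in>{s<..N}. psi_row q1 q3 l t x) = (\<Prod>t\<in>{s<..N}. row_ratio q1 q3 (q1 ^ l t * q3 ^ (t - 1) * x))"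
    by (rule prod.cong) (use q in \<open>auto simp: psi_row_eq_row_ratio\<close>)
  finally show ?thesis using nz[of s] nz[of N] sN by (simp add: end_ratio_def)
qed

lemma psi_fock_truncated:
  fixes q1 q3 x :: "'k::field"
  assumes "q1 \<noteq> 0" "q3 \<noteq> 0" "\<And>t. t > N \<Longrightarrow> l t = 0"
    "\<And>t. t \<le> N \<Longrightarrow> 1 - q3 ^ t * x \<noteq> 0 \<and> 1 - inverse (q1 * q3) * (q3 ^ t * x) \<noteq> 0"
  shows "psi_fock q1 q3 l x
    = end_ratio q1 q3 (q3 ^ N * x) * (\<Prod>t\<in>{1..N}. row_ratio q1 q3 (q1 ^ l t * q3 ^ (t - 1) * x))"
proof -
  have "{0<..N} = {1..N}" by auto
  then show ?thesis
    using truncated_product[of q1 q3 0 N l x] assms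
    by (simp add: psi_fock_def Let_def end_ratio_def Suc_le_eq)
qed

text \<open>The rows \<open>(i, s)\<close> are ordered lexicographically.  The amplitude of \<open>e\<close> for a box involves the rows
  before its own, and that of \<open>f\<close> the rows after it.\<close>

definition rows_before :: "nat \<Rightarrow> nat \<times> nat \<Rightarrow> (nat \<times> nat) set" where
  "rows_before N r = {1..<fst r} \<times> {1..N} \<union> {fst r} \<times> {1..<snd r}"

definition rows_after :: "nat \<Rightarrow> nat \<Rightarrow> nat \<times> nat \<Rightarrow> (nat \<times> nat) set" where
  "rows_after n N r = {fst r} \<times> {snd r<..N} \<union> {fst r<..n} \<times> {1..N}"

definition row_factor :: "'k::field \<Rightarrow> 'k \<Rightarrow> (nat \<Rightarrow> 'k) \<Rightarrow> tuple \<Rightarrow> 'k \<Rightarrow> nat \<times> nat \<Rightarrow> 'k" where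
  "row_factor q1 q3 u L v r = row_ratio q1 q3 (q1 ^ L (fst r) (snd r) * q3 ^ (snd r - 1) * (u (fst r) / v))"

definition end_factor :: "'k::field \<Rightarrow> 'k \<Rightarrow> (nat \<Rightarrow> 'k) \<Rightarrow> nat \<Rightarrow> 'k \<Rightarrow> nat \<Rightarrow> 'k" where
  "end_factor q1 q3 u N v j = end_ratio q1 q3 (q3 ^ N * (u j / v))"

definition e_rows :: "'k::field \<Rightarrow> 'k \<Rightarrow> (nat \<Rightarrow> 'k) \<Rightarrow> nat \<Rightarrow> tuple \<Rightarrow> 'k \<Rightarrow> nat \<times> nat \<Rightarrow> 'k" where
  "e_rows q1 q3 u N L v r = 1 / (1 - q1) * (\<Prod>j\<in>{1..<fst r}. end_factor q1 q3 u N v j)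
     * (\<Prod>r'\<in>rows_before N r. row_factor q1 q3 u L v r')"

definition f_rows :: "'k::field \<Rightarrow> 'k \<Rightarrow> (nat \<Rightarrow> 'k) \<Rightarrow> nat \<Rightarrow> nat \<Rightarrow> tuple \<Rightarrow> 'k \<Rightarrow> nat \<times> nat \<Rightarrow> 'k" where
  "f_rows q1 q3 u n N L v r = q1 / (1 - q1) * (\<Prod>j\<in>{fst r..n}. end_factor q1 q3 u N v j)
     * (\<Prod>r'\<in>rows_after n N r. row_factor q1 q3 u L v r')"

lemma prod_Times: "prod f (A \<times> B) = (\<Prod>x\<in>A. \<Prod>y\<in>B. f (x, y))"
  by (simp add: prod.cartesian_product split_def)

lemma e_amplitude_rows:
  fixes q1 q3 :: "'k::field"
  assumes q: "q1 \<noteq> 0" "q3 \<noteq> 0" and ib: "1 \<le> i" "i \<le> n"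
    and L: "\<And>j t. j \<in> {1..n} \<Longrightarrow> t > N \<Longrightarrow> L j t = 0"
    and v: "v = box_value q1 q3 u L i s"
    and nz: "\<And>j t. j \<in> {1..<i} \<Longrightarrow> t \<le> N \<Longrightarrow>
      1 - q3 ^ t * (u j / v) \<noteq> 0 \<and> 1 - inverse (q1 * q3) * (q3 ^ t * (u j / v)) \<noteq> 0"
  shows "e_amplitude q1 q3 u L i s = e_rows q1 q3 u N L v (i, s)"
proof -
  have 1: "(\<Prod>j\<in>{1..<i}. psi_fock q1 q3 (L j) (u j / v))
     = (\<Prod>j\<in>{1..<i}. end_factor q1 q3 u N v j * (\<Prod>t\<in>{1..N}. row_factor q1 q3 u L v (j, t)))"
  proof (rule prod.cong[OF refl])
    fix j assume j: "j \<in> {1..<i}"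
    show "psi_fock q1 q3 (L j) (u j / v)
        = end_factor q1 q3 u N v j * (\<Prod>t\<in>{1..N}. row_factor q1 q3 u L v (j, t))"
      unfolding end_factor_def row_factor_def fst_conv snd_conv
      by (rule psi_fock_truncated) (use q nz L j ib in auto)
  qed
  have 2: "(\<Prod>t\<in>{1..<s}. psi_row q1 q3 (L i) t (u i / v)) = (\<Prod>t\<in>{1..<s}. row_factor q1 q3 u L v (i, t))"
    by (rule prod.cong) (use q in \<open>auto simp: row_factor_def psi_row_eq_row_ratio\<close>)
  have 3: "(\<Prod>r\<in>rows_before N (i, s). row_factor q1 q3 u L v r)
     = (\<Prod>j\<in>{1..<i}. \<Prod>t\<in>{1..N}. row_factor q1 q3 u L v (j, t)) * (\<Prod>t\<in>{1..<s}. row_factor q1 q3 u L v (i, t))"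
    unfolding rows_before_def fst_conv snd_conv
    by (subst prod.union_disjoint) (auto simp: prod_Times)
  show ?thesis
    unfolding e_amplitude_def Let_def v[symmetric] 1 2 e_rows_def 3 fst_conv
    by (simp add: prod.distrib mult_ac)
qed

lemma f_amplitude_rows:
  fixes q1 q3 :: "'k::field"
  assumes q: "q1 \<noteq> 0" "q3 \<noteq> 0" and ib: "1 \<le> i" "i \<le> n" "s \<le> N"
    and L: "\<And>j t. j \<in> {1..n} \<Longrightarrow> t > N \<Longrightarrow> L j t = 0"
    and v: "v = box_value q1 q3 u L i s"
    and nz: "\<And>j t. j \<in> {i<..n} \<Longrightarrow> t \<le> N \<Longrightarrow>
      1 - q3 ^ t * (u j / v) \<noteq> 0 \<and> 1 - inverse (q1 * q3) * (q3 ^ t * (u j / v)) \<noteq> 0"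
    and nzi: "\<And>t. s \<le> t \<Longrightarrow> t \<le> N \<Longrightarrow>
      1 - q3 ^ t * (u i / v) \<noteq> 0 \<and> 1 - inverse (q1 * q3) * (q3 ^ t * (u i / v)) \<noteq> 0"
  shows "f_amplitude q1 q3 u n L i s = f_rows q1 q3 u n N L v (i, s)"
proof -
  have 1: "(\<Prod>j\<in>{i<..n}. psi_fock q1 q3 (L j) (u j / v))
     = (\<Prod>j\<in>{i<..n}. end_factor q1 q3 u N v j * (\<Prod>t\<in>{1..N}. row_factor q1 q3 u L v (j, t)))"
  proof (rule prod.cong[OF refl])
    fix j assume j: "j \<in> {i<..n}"
    show "psi_fock q1 q3 (L j) (u j / v)
        = end_factor q1 q3 u N v j * (\<Prod>t\<in>{1..N}. row_factor q1 q3 u L v (j, t))"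
      unfolding end_factor_def row_factor_def fst_conv snd_conv
      by (rule psi_fock_truncated) (use q nz L j ib in auto)
  qed
  have 2: "(1 - inverse (q1 * q3) * q3 ^ s * u i / v) / (1 - q3 ^ s * u i / v)
      * (\<Prod>t | s < t \<and> L i t \<noteq> 0. psi_row q1 q3 (L i) t (u i / v) / psi_row q1 q3 (\<lambda>_. 0) t (u i / v))
      = end_factor q1 q3 u N v i * (\<Prod>t\<in>{s<..N}. row_factor q1 q3 u L v (i, t))"
    using truncated_product[of q1 q3 s N "L i" "u i / v"] q ib L nzi
    by (simp add: end_factor_def end_ratio_def row_factor_def mult.assoc)
  have 3: "(\<Prod>r\<in>rows_after n N (i, s). row_factor q1 q3 u L v r)
     = (\<Prod>t\<in>{s<..N}. row_factor q1 q3 u L v (i, t)) * (\<Prod>j\<in>{i<..n}. \<Prod>t\<in>{1..N}. row_factor q1 q3 u L v (j, t))"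
    unfolding rows_after_def fst_conv snd_conv
    by (subst prod.union_disjoint) (auto simp: prod_Times)
  have 4: "(\<Prod>j\<in>{i..n}. end_factor q1 q3 u N v j) = end_factor q1 q3 u N v i * (\<Prod>j\<in>{i<..n}. end_factor q1 q3 u N v j)"
    by (rule prod.head) (use ib in simp)
  have "f_amplitude q1 q3 u n L i s = q1 / (1 - q1) *
     ((1 - inverse (q1 * q3) * q3 ^ s * u i / v) / (1 - q3 ^ s * u i / v)
      * (\<Prod>t | s < t \<and> L i t \<noteq> 0. psi_row q1 q3 (L i) t (u i / v) / psi_row q1 q3 (\<lambda>_. 0) t (u i / v)))
      * (\<Prod>j\<in>{i<..n}. psi_fock q1 q3 (L j) (u j / v))"
    unfolding f_amplitude_def Let_def v[symmetric] by (simp only: mult.assoc)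
  also have "\<dots> = f_rows q1 q3 u n N L v (i, s)"
    unfolding 1 2 f_rows_def 3 4 fst_conv by (simp add: prod.distrib mult_ac)
  finally show ?thesis .
qed

text \<open>This is where the structure function comes from: \<open>y z\<close> is the value of the box by which the row is
  lengthened, and \<open>z\<close> the value at which the factor is taken.\<close>

lemma row_ratio_step:
  fixes q1 q2 q3 y z :: "'k::field"
  assumes q: "q1 * q2 * q3 = 1" and nz: "1 - q1 * y \<noteq> 0" "1 - inverse q1 * y \<noteq> 0"
  shows "row_ratio q1 q3 (q1 * y) * gcubic q1 q2 q3 z (y * z) = - (row_ratio q1 q3 y * gcubic q1 q2 q3 (y * z) z)"
proof -
  have q0: "q1 \<noteq> 0" "q2 \<noteq> 0" "q3 \<noteq> 0" using q by auto
  have q2: "inverse (q1 * q3) = q2" using q q0 by (simp add: field_simps)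
  have i2: "q1 * q3 = inverse q2" and i3: "q2 * q1 = inverse q3" using q q0 by (simp_all add: field_simps)
  have g1: "gcubic q1 q2 q3 z (y * z) = z ^ 3 * ((1 - q1 * y) * (1 - q2 * y) * (1 - q3 * y))"
    by (simp add: gcubic_def algebra_simps power3_eq_cube)
  have f: "y * z - x * z = - (x * z) * (1 - inverse x * y)" if "x \<noteq> 0" for x :: 'k
    using that by (simp add: field_simps)
  have "gcubic q1 q2 q3 (y * z) z = (- (q1 * z) * (1 - inverse q1 * y)) * (- (q2 * z) * (1 - inverse q2 * y))
      * (- (q3 * z) * (1 - inverse q3 * y))"
    unfolding gcubic_def f[OF q0(1)] f[OF q0(2)] f[OF q0(3)] ..
  also have "\<dots> = - (q1 * q2 * q3) * (z ^ 3 * ((1 - inverse q1 * y) * (1 - inverse q2 * y) * (1 - inverse q3 * y)))"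
    by (simp add: power3_eq_cube)
  finally have g2: "gcubic q1 q2 q3 (y * z) z
      = - (z ^ 3 * ((1 - inverse q1 * y) * (1 - inverse q2 * y) * (1 - inverse q3 * y)))"
    unfolding q by simp
  define A B C D where "A = 1 - q1 * y" and "B = 1 - inverse q1 * y" and "C = 1 - inverse q2 * y" and "D = 1 - inverse q3 * y"
  have r1: "row_ratio q1 q3 (q1 * y) = C * D / (A * (1 - y))"
    unfolding row_ratio_def q2 A_def C_def D_def using q0 i2 i3
    by (simp add: mult.assoc[symmetric] mult.commute[of q3 q1])
  have r2: "row_ratio q1 q3 y = (1 - q3 * y) * (1 - q2 * y) / ((1 - y) * B)"
    unfolding row_ratio_def q2 B_def ..
  show ?thesis
    unfolding r1 r2 g1 g2 A_def[symmetric] B_def[symmetric] C_def[symmetric] D_def[symmetric]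
    using nz[folded A_def B_def] by simp
qed

section \<open>Generic binomials\<close>

abbreviation gen_u :: "nat \<Rightarrow> ratfun" where "gen_u \<equiv> \<lambda>i. rvar (i + 1)"

text \<open>For independent parameters one may set all variables but one equal to 1, and the remaining one equal
  to 2: then no binomial that really contains this variable vanishes.\<close>

lemma generic_binomial_nonzero:
  fixes s t l i j :: nat
  assumes ij: "1 \<le> i" "1 \<le> j" and v: "v = rvar 0 ^ l * rvar 1 ^ (s - 1) * gen_u i"
    and c: "i \<noteq> j \<or> (1 \<le> s \<and> s \<le> t)"
  shows "1 - rvar 1 ^ t * (gen_u j / v) \<noteq> 0 \<and> 1 - inverse (rvar 0 * rvar 1) * (rvar 1 ^ t * (gen_u j / v)) \<noteq> 0"
proof -
  have *: "specializes id \<tau> (1 - rvar 1 ^ t * (gen_u j / v))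
        (1 - \<tau> 1 ^ t * (\<tau> (j + 1) / (\<tau> 0 ^ l * \<tau> 1 ^ (s - 1) * \<tau> (i + 1))))"
    "specializes id \<tau> (1 - inverse (rvar 0 * rvar 1) * (rvar 1 ^ t * (gen_u j / v)))
        (1 - inverse (\<tau> 0 * \<tau> 1) * (\<tau> 1 ^ t * (\<tau> (j + 1) / (\<tau> 0 ^ l * \<tau> 1 ^ (s - 1) * \<tau> (i + 1)))))"
    if "\<And>k. \<tau> k \<noteq> 0" for \<tau>
    unfolding v by (intro specializes_intros; simp add: that)+
  show ?thesis
  proof (cases "i = j")
    case False
    define \<tau> :: "nat \<Rightarrow> complex" where "\<tau> k = (if k = j + 1 then 2 else 1)" for k
    have \<tau>: "\<tau> k \<noteq> 0" for k by (simp add: \<tau>_def)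
    have "1 - \<tau> 1 ^ t * (\<tau> (j + 1) / (\<tau> 0 ^ l * \<tau> 1 ^ (s - 1) * \<tau> (i + 1))) \<noteq> 0"
      "1 - inverse (\<tau> 0 * \<tau> 1) * (\<tau> 1 ^ t * (\<tau> (j + 1) / (\<tau> 0 ^ l * \<tau> 1 ^ (s - 1) * \<tau> (i + 1)))) \<noteq> 0"
      using False ij by (simp_all add: \<tau>_def)
    then show ?thesis
      using specializes_nonzero[OF ring_embedding_id *(1)[of \<tau>, OF \<tau>]]
        specializes_nonzero[OF ring_embedding_id *(2)[of \<tau>, OF \<tau>]] by blast
  next
    case True
    then have st: "1 \<le> s" "s \<le> t" using c by auto
    define \<tau> :: "nat \<Rightarrow> complex" where "\<tau> k = (if k = 1 then 2 else 1)" for k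
    have \<tau>: "\<And>k. \<tau> k \<noteq> 0" by (simp add: \<tau>_def)
    define \<rho> :: "nat \<Rightarrow> complex" where "\<rho> k = (if k = 0 then 2 else 1)" for k
    have \<rho>: "\<And>k. \<rho> k \<noteq> 0" by (simp add: \<rho>_def)
    have "t = (t - s + 1) + (s - 1)" using st by simp
    then have "(2::complex) ^ t = 2 ^ (t - s + 1) * 2 ^ (s - 1)" by (metis power_add)
    moreover have "(2::complex) ^ (t - s + 1) \<noteq> 1"
      using power_eq_1_iff[of "2::complex" "t - s + 1"] by auto
    ultimately have "1 - \<tau> 1 ^ t * (\<tau> (j + 1) / (\<tau> 0 ^ l * \<tau> 1 ^ (s - 1) * \<tau> (i + 1))) \<noteq> 0"
      using True ij by (simp add: \<tau>_def)
    then have 1: "1 - rvar 1 ^ t * (gen_u j / v) \<noteq> 0"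
      using specializes_nonzero[OF ring_embedding_id *(1)[of \<tau>, OF \<tau>]] by blast
    have "(2::complex) ^ Suc l \<noteq> 1" using power_eq_1_iff[of "2::complex" "Suc l"] by auto
    then have "1 - inverse (\<rho> 0 * \<rho> 1) * (\<rho> 1 ^ t * (\<rho> (j + 1) / (\<rho> 0 ^ l * \<rho> 1 ^ (s - 1) * \<rho> (i + 1)))) \<noteq> 0"
      using True ij by (simp add: \<rho>_def field_simps)
    then show ?thesis using 1 specializes_nonzero[OF ring_embedding_id *(2)[of \<rho>, OF \<rho>]] by blast
  qed
qed

lemma rvar_nonzero: "rvar i \<noteq> 0"
  using specializes_nonzero[OF ring_embedding_id specializes_var[OF ring_embedding_id, of "\<lambda>_. 1"]] by auto

context resonance
begin

section \<open>Matrix coefficients at the resonance\<close>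

text \<open>The composite of the two substitutions: the point at which everything is evaluated.\<close>

definition point :: "nat \<Rightarrow> complex" where
  "point m = (if m = 0 then q1 else if m = 1 then q3 else spectral (m - 2))"

abbreviation cu :: "nat \<Rightarrow> complex" where "cu i \<equiv> spectral (i - 1)"

lemma spec_subst_specializes: "specializes id (num_subst q1 q3 u) (spec_subst a b m) (point m)"
proof -
  have var: "specializes id (num_subst q1 q3 u) (rvar k) (num_subst q1 q3 u k)" for k
    by (rule specializes_intros(2))
  have v0: "specializes id (num_subst q1 q3 u) (rvar 0) q1"
    and v1: "specializes id (num_subst q1 q3 u) (rvar 1) q3"
    and v2: "specializes id (num_subst q1 q3 u) (rvar 2) u"
    using var[of 0] var[of 1] var[of 2] by (simp_all add: num_subst_def)
  have "specializes id (num_subst q1 q3 u) (spec_u a b k) (spectral k)" for k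
  proof (induction k)
    case 0
    show ?case unfolding spec_u.simps spectral.simps by (rule v2)
  next
    case (Suc k)
    show ?case unfolding spec_u.simps spectral.simps
      by (intro specializes_intros(10) specializes_intros(6) specializes_intros(11) Suc v0 v1)
         (use q_nonzero in auto)
  qed
  then show ?thesis using v0 v1 by (simp add: spec_subst_def point_def)
qed

lemma coeff_values:
  assumes "specializes id point (generic_coeff n X M L) c"
  shows "regular_at rconst (spec_subst a b) (generic_coeff n X M L)"
    and "regular_at id (num_subst q1 q3 u) (M_coeff a b n X M L)"
    and "resonant_coeff q1 q3 u a b n X M L = c"
  unfolding resonant_coeff_def M_coeff_def
  using two_step_specialization[OF spec_subst_specializes assms] by auto

lemma point_var:
  "specializes id point (rvar 0) q1" "specializes id point (rvar 1) q3"
  "1 \<le> i \<Longrightarrow> specializes id point (gen_u i) (cu i)"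
  using specializes_intros(2)[of point 0] specializes_intros(2)[of point 1] specializes_intros(2)[of point "i + 1"]
  by (simp_all add: point_def)

lemma val_corner: "val (corner L r) = q1 ^ L (fst r) (snd r) * q3 ^ (snd r - 1) * cu (fst r)"
  by (simp add: corner_def)

lemma row_factor_val:
  "row_factor q1 q3 cu L v r = row_ratio q1 q3 (val (corner L r) / v)"
  by (simp add: row_factor_def val_corner mult.assoc)

lemma end_factor_val:
  assumes "L j (Suc N) = 0"
  shows "end_factor q1 q3 cu N v j = end_ratio q1 q3 (val (corner L (j, Suc N)) / v)"
  using assms by (simp add: end_factor_def val_corner)

lemma ratio_specializes:
  assumes y: "specializes id point gy y" and "y \<noteq> 1"
  shows "y \<noteq> q1 \<Longrightarrow> specializes id point (row_ratio (rvar 0) (rvar 1) gy) (row_ratio q1 q3 y)"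
    and "specializes id point (end_ratio (rvar 0) (rvar 1) gy) (end_ratio q1 q3 y)"
proof -
  have q13: "q1 * q3 \<noteq> 0" using q_nonzero by simp
  have nz: "1 - y \<noteq> 0" using assms(2) by simp
  have i: "specializes id point (inverse (rvar 0 * rvar 1)) (inverse (q1 * q3))"
    by (rule specializes_intros(7)[OF specializes_intros(6)[OF point_var(1,2)] q13])
  note one = specializes_intros(3)[of point]
  have 1: "specializes id point (1 - c * gy) (1 - d * y)" if "specializes id point c d" for c d
    by (rule specializes_intros(9)[OF one specializes_intros(6)[OF that y]])
  note 2 = specializes_intros(9)[OF one y]
  show "specializes id point (end_ratio (rvar 0) (rvar 1) gy) (end_ratio q1 q3 y)"
    unfolding end_ratio_def by (rule specializes_intros(10)[OF 1[OF i] 2 nz])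
  assume "y \<noteq> q1"
  then have "1 - inverse q1 * y \<noteq> 0" using q_nonzero by (simp add: field_simps)
  then have nz2: "(1 - y) * (1 - inverse q1 * y) \<noteq> 0" using nz by simp
  show "specializes id point (row_ratio (rvar 0) (rvar 1) gy) (row_ratio q1 q3 y)"
    unfolding row_ratio_def
    by (rule specializes_intros(10)[OF specializes_intros(6)[OF 1[OF point_var(2)] 1[OF i]]
          specializes_intros(6)[OF 2 1[OF specializes_intros(7)[OF point_var(1) q_nonzero(1)]]] nz2])
qed

lemma row_factor_specializes:
  assumes r: "1 \<le> fst r" and v: "specializes id point gv v" "v \<noteq> 0"
    and ne: "val (corner L r) \<noteq> v" "val (corner L r) \<noteq> q1 * v"
  shows "specializes id point (row_factor (rvar 0) (rvar 1) gen_u L gv r) (row_factor q1 q3 cu L v r)"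
proof -
  have "specializes id point (rvar 0 ^ L (fst r) (snd r) * rvar 1 ^ (snd r - 1) * (gen_u (fst r) / gv))
      (q1 ^ L (fst r) (snd r) * q3 ^ (snd r - 1) * (cu (fst r) / v))"
    by (intro specializes_intros(6) specializes_intros(11) specializes_intros(10) point_var r v)
  moreover have "q1 ^ L (fst r) (snd r) * q3 ^ (snd r - 1) * (cu (fst r) / v) = val (corner L r) / v"
    by (simp add: val_corner)
  moreover have "val (corner L r) / v \<noteq> 1" "val (corner L r) / v \<noteq> q1"
    using ne v by (simp_all add: field_simps)
  ultimately show ?thesis
    unfolding row_factor_def by (intro ratio_specializes(1)) (simp_all only: not_False_eq_True)
qed

lemma end_factor_specializes:
  assumes j: "1 \<le> j" and v: "specializes id point gv v" "v \<noteq> 0"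
    and L: "L j (Suc N) = 0" and ne: "val (corner L (j, Suc N)) \<noteq> v"
  shows "specializes id point (end_factor (rvar 0) (rvar 1) gen_u N gv j) (end_factor q1 q3 cu N v j)"
proof -
  have "specializes id point (rvar 1 ^ N * (gen_u j / gv)) (q3 ^ N * (cu j / v))"
    by (intro specializes_intros(6) specializes_intros(11) specializes_intros(10) point_var j v)
  moreover have "q3 ^ N * (cu j / v) = val (corner L (j, Suc N)) / v"
    using L by (simp add: val_corner)
  moreover have "val (corner L (j, Suc N)) / v \<noteq> 1" using ne v by (simp add: field_simps)
  ultimately show ?thesis
    unfolding end_factor_def by (intro ratio_specializes(2)) (simp_all only: not_False_eq_True)
qed

text \<open>The first two inequalities exclude poles of the amplitudes.\<close>

lemma addable_row_nonzero:
  assumes L: "L \<in> states" and x: "addable (boxes L) x" and r: "r \<in> rows M" "r \<noteq> row_of x"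
  shows "val (corner L r) \<noteq> val x" "val (corner L r) \<noteq> q1 * val x"
    "q3 * val (corner L r) \<noteq> val x" "q2 * val (corner L r) \<noteq> val x"
proof -
  note S = states_ideal[OF L] and c = corner_rows_first_empty[OF r(1), of L]
  have "corner L r \<noteq> x" using r(2) by auto
  then show "val (corner L r) \<noteq> val x"
    using first_empty_val_inj[OF S c addable_first_empty[OF x]] by blast
  show "val (corner L r) \<noteq> q1 * val x" "q3 * val (corner L r) \<noteq> val x" "q2 * val (corner L r) \<noteq> val x"
    using addable_val_q1[OF S x c] addable_val_q3[OF S x c] addable_val_q2[OF S x c] by metis+
qed

lemma height_bound_add_at:
  assumes L: "L \<in> states" and x: "addable (boxes L) x" and N: "height_bound (add_at L x) N"
  shows "height_bound L N" "snd (row_of x) \<le> N"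
proof -
  have "L j t \<le> add_at L x j t" for j t by (simp add: add_at_def add_box_def)
  then show "height_bound L N" using N unfolding height_bound_def by (metis le_zero_eq)
  show "snd (row_of x) \<le> N"
    by (rule height_bound_boxes[OF N]) (use add_at_state[OF L x] in auto)
qed

lemma addable_expand:
  assumes x: "addable (boxes L) x"
  obtains i s where "x = (i, s, L i s)" "1 \<le> i" "i \<le> n" "1 \<le> s" "row_of x = (i, s)" "add_at L x = add_box L i s"
    "val x = box_value q1 q3 cu L i s"
proof -
  have "x = corner L (row_of x)" by (rule first_empty_corner[OF addable_first_empty[OF x]])
  then obtain i s where x': "x = (i, s, L i s)" by (auto simp: corner_def)
  moreover have "1 \<le> i" "i \<le> n" "1 \<le> s" using addableD(1)[OF x] by (auto simp: x' Box_def)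
  ultimately show ?thesis using that[of i s] by (simp add: row_of_def add_at_def box_value_def)
qed

lemma generic_value_specializes:
  assumes "1 \<le> i"
  shows "specializes id point (box_value (rvar 0) (rvar 1) gen_u L i s) (box_value q1 q3 cu L i s)"
  unfolding box_value_def
  by (intro specializes_intros(6) specializes_intros(11) point_var assms)

lemma amplitudes_specialize:
  assumes L: "L \<in> states" and x: "addable (boxes L) x" and N: "height_bound (add_at L x) N"
    and i: "x = (i, s, L i s)"
  shows "specializes id point (e_amplitude (rvar 0) (rvar 1) gen_u L i s) (e_rows q1 q3 cu N L (val x) (i, s))"
    and "specializes id point (f_amplitude (rvar 0) (rvar 1) gen_u n L i s) (f_rows q1 q3 cu n N L (val x) (i, s))"
proof -
  have B: "1 \<le> i" "i \<le> n" "1 \<le> s" using addableD(1)[OF x] by (auto simp: i Box_def)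
  have row: "row_of x = (i, s)" by (simp add: i row_of_def)
  note H = height_bound_add_at[OF L x N]
  have sN: "s \<le> N" using H(2) by (simp add: row)
  have L0: "L j t = 0" if "j \<in> {1..n}" "t > N" for j t
    using H(1) that unfolding height_bound_def by blast
  let ?gv = "box_value (rvar 0) (rvar 1) gen_u L i s"
  have vx: "val x = box_value q1 q3 cu L i s" by (simp add: i box_value_def)
  have v: "specializes id point ?gv (val x)" "val x \<noteq> 0"
    unfolding vx by (rule generic_value_specializes[OF B(1)]) (use vx val_nonzero in metis)
  have gv: "?gv = rvar 0 ^ L i s * rvar 1 ^ (s - 1) * gen_u i" by (simp add: box_value_def)
  have rf: "specializes id point (row_factor (rvar 0) (rvar 1) gen_u L ?gv r) (row_factor q1 q3 cu L (val x) r)"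
    if "r \<in> rows N" "r \<noteq> (i, s)" for r
    using addable_row_nonzero[OF L x that(1)] that
    by (intro row_factor_specializes v) (auto simp: row rows_def)
  have ef: "specializes id point (end_factor (rvar 0) (rvar 1) gen_u N ?gv j) (end_factor q1 q3 cu N (val x) j)"
    if "j \<in> {1..n}" for j
  proof -
    have "(j, Suc N) \<in> rows (Suc N)" using that by (simp add: rows_def)
    then have "val (corner L (j, Suc N)) \<noteq> val x"
      using addable_row_nonzero(1)[OF L x] sN by (simp add: row)
    then show ?thesis using that L0 by (intro end_factor_specializes v) auto
  qed
  have bef: "r \<in> rows N \<and> r \<noteq> (i, s)" if "r \<in> rows_before N (i, s)" for r
    using that B sN by (auto simp: rows_before_def rows_def)
  have aft: "r \<in> rows N \<and> r \<noteq> (i, s)" if "r \<in> rows_after n N (i, s)" for r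
    using that B sN by (auto simp: rows_after_def rows_def)
  have q1n1: "1 - q1 \<noteq> 0" using not_root_of_unity[of 1] by simp
  have "e_amplitude (rvar 0) (rvar 1) gen_u L i s = e_rows (rvar 0) (rvar 1) gen_u N L ?gv (i, s)"
    by (rule e_amplitude_rows[OF rvar_nonzero rvar_nonzero B(1,2) L0 refl])
       (use B generic_binomial_nonzero[OF _ _ gv] in auto)
  moreover have "specializes id point (e_rows (rvar 0) (rvar 1) gen_u N L ?gv (i, s)) (e_rows q1 q3 cu N L (val x) (i, s))"
    unfolding e_rows_def fst_conv
    by (intro specializes_intros(6) specializes_intros(10) specializes_intros(9) specializes_intros(14)
        specializes_intros(3) point_var rf ef q1n1) (use bef B in auto)
  ultimately show "specializes id point (e_amplitude (rvar 0) (rvar 1) gen_u L i s) (e_rows q1 q3 cu N L (val x) (i, s))"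
    by simp
  have "f_amplitude (rvar 0) (rvar 1) gen_u n L i s = f_rows (rvar 0) (rvar 1) gen_u n N L ?gv (i, s)"
    by (rule f_amplitude_rows[OF rvar_nonzero rvar_nonzero B(1,2) sN L0 refl])
       (use B generic_binomial_nonzero[OF _ _ gv] in auto)
  moreover have "specializes id point (f_rows (rvar 0) (rvar 1) gen_u n N L ?gv (i, s)) (f_rows q1 q3 cu n N L (val x) (i, s))"
    unfolding f_rows_def fst_conv
    by (intro specializes_intros(6) specializes_intros(10) specializes_intros(9) specializes_intros(14)
        specializes_intros(3) point_var rf ef q1n1) (use aft B in auto)
  ultimately show "specializes id point (f_amplitude (rvar 0) (rvar 1) gen_u n L i s) (f_rows q1 q3 cu n N L (val x) (i, s))"
    by simp
qed

lemma add_box_unique: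
  assumes L: "L \<in> states" and x: "addable (boxes L) (i, s, L i s)"
  shows "{(i', s'). 1 \<le> i' \<and> i' \<le> n \<and> 1 \<le> s' \<and> add_box L i s = add_box L i' s'} = {(i, s)}"
proof -
  have B: "1 \<le> i" "i \<le> n" "1 \<le> s" using addableD(1)[OF x] by (auto simp: Box_def)
  have "(i', s') = (i, s)" if "1 \<le> i'" "i' \<le> n" "1 \<le> s'" "add_box L i s = add_box L i' s'" for i' s'
  proof -
    have "insert (i, s, L i s) (boxes L) = insert (i', s', L i' s') (boxes L)"
      using boxes_add_corner[OF B] boxes_add_corner[OF that(1-3)] that(4) by metis
    moreover have "(i', s', L i' s') \<notin> boxes L" by (simp add: boxes_def)
    ultimately have "(i', s', L i' s') = (i, s, L i s)" by blast
    then show ?thesis by simp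
  qed
  then show ?thesis using B by auto
qed

lemma EF_coeff:
  assumes L: "L \<in> states" and x: "addable (boxes L) x" and N: "height_bound (add_at L x) N"
  shows "specializes id point (generic_coeff n (E k) (add_at L x) L)
    (val x powi k * e_rows q1 q3 cu N L (val x) (row_of x))"
    and "specializes id point (generic_coeff n (F k) L (add_at L x))
    (val x powi k * f_rows q1 q3 cu n N L (val x) (row_of x))"
proof -
  obtain i s where i: "x = (i, s, L i s)" "1 \<le> i" "i \<le> n" "1 \<le> s" "row_of x = (i, s)" "add_at L x = add_box L i s"
    "val x = box_value q1 q3 cu L i s" by (rule addable_expand[OF x])
  note U = add_box_unique[OF L x[unfolded i(1)]]
  let ?gv = "box_value (rvar 0) (rvar 1) gen_u L i s"
  have v: "specializes id point (?gv powi k) (val x powi k)"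
    unfolding i(7) by (intro specializes_intros(12) generic_value_specializes i(2)) (use i(7) val_nonzero in metis)
  have "generic_coeff n (E k) (add_at L x) L = ?gv powi k * e_amplitude (rvar 0) (rvar 1) gen_u L i s"
    unfolding generic_coeff_def i(6) by (simp only: tensor_coeff.simps U) simp
  then show "specializes id point (generic_coeff n (E k) (add_at L x) L)
    (val x powi k * e_rows q1 q3 cu N L (val x) (row_of x))"
    using specializes_intros(6)[OF v amplitudes_specialize(1)[OF L x N i(1)]] by (simp only: i(5))
  have "generic_coeff n (F k) L (add_at L x) = ?gv powi k * f_amplitude (rvar 0) (rvar 1) gen_u n L i s"
    unfolding generic_coeff_def i(6) by (simp only: tensor_coeff.simps U) simp
  then show "specializes id point (generic_coeff n (F k) L (add_at L x))
    (val x powi k * f_rows q1 q3 cu n N L (val x) (row_of x))"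
    using specializes_intros(6)[OF v amplitudes_specialize(2)[OF L x N i(1)]] by (simp only: i(5))
qed

lemma EF_coeff_zero:
  assumes L: "L \<in> states" and M: "M \<in> states" and no: "\<not> (\<exists>x. addable (boxes L) x \<and> M = add_at L x)"
  shows "generic_coeff n (E k) M L = 0" "generic_coeff n (F k) L M = 0"
proof -
  have "{(i, s). 1 \<le> i \<and> i \<le> n \<and> 1 \<le> s \<and> M = add_box L i s} = {}"
  proof -
    have False if ib: "1 \<le> i" "i \<le> n" "1 \<le> s" and e: "M = add_box L i s" for i s
    proof -
      have "addable (boxes L) (i, s, L i s)"
        by (rule add_box_state_imp_addable[OF L ib]) (use M e in simp)
      moreover have "M = add_at L (i, s, L i s)" by (simp add: add_at_def e)
      ultimately show False using no by blast
    qed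
    then show ?thesis by auto
  qed
  then show "generic_coeff n (E k) M L = 0" "generic_coeff n (F k) L M = 0"
    unfolding generic_coeff_def by (simp_all only: tensor_coeff.simps sum.empty)
qed

end

unbundle fps_syntax

section \<open>The series \<open>\<psi>\<^sup>\<plusminus>\<close>\<close>

definition lin :: "'k::field fls \<Rightarrow> 'k \<Rightarrow> 'k fls" where "lin x c = 1 - fls_const c * x"

abbreviation expansion_var :: "'k::field fls \<Rightarrow> bool" where
  "expansion_var x \<equiv> x = fls_X \<or> x = fls_X_inv"

lemma lin_mult_nth:
  "(Fs * lin fls_X c) $$ k = Fs $$ k - c * Fs $$ (k - 1)"
  "(Fs * lin fls_X_inv c) $$ k = Fs $$ k - c * Fs $$ (k + 1)"
proof -
  have "Fs * lin fls_X c = Fs - fls_const c * (fls_X * Fs)" "Fs * lin fls_X_inv c = Fs - fls_const c * (fls_X_inv * Fs)"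
    by (simp_all add: lin_def algebra_simps)
  then show "(Fs * lin fls_X c) $$ k = Fs $$ k - c * Fs $$ (k - 1)"
    "(Fs * lin fls_X_inv c) $$ k = Fs $$ k - c * Fs $$ (k + 1)"
    by (simp_all add: fls_X_times_conv_shift fls_X_inv_times_conv_shift)
qed

lemma lin_nonzero: "expansion_var x \<Longrightarrow> lin x c \<noteq> 0"
proof -
  assume x: "expansion_var x"
  have "lin x c $$ 0 = 1"
    using x lin_mult_nth[of 1 c 0] by auto
  then show ?thesis by auto
qed

lemma lin_subdegree:
  "fls_subdegree (lin fls_X c) = 0" "c \<noteq> 0 \<Longrightarrow> fls_subdegree (lin fls_X_inv c) = -1"
proof -
  show "fls_subdegree (lin fls_X c) = 0"
    by (rule fls_subdegree_eqI) (use lin_mult_nth(1)[of 1 c] in auto)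
  show "fls_subdegree (lin fls_X_inv c) = -1" if "c \<noteq> 0"
    by (rule fls_subdegree_eqI) (use lin_mult_nth(2)[of 1 c] that in auto)
qed

lemma geometric_series:
  "(1 / lin fls_X c) $$ k = (if k \<ge> 0 then c powi k else 0)"
  "c \<noteq> 0 \<Longrightarrow> (1 / lin fls_X_inv c) $$ k = (if k \<ge> 1 then - (c powi (- k)) else 0)"
proof -
  have e: "1 / lin x c = Gs" if "Gs * lin x c = 1" "expansion_var x" for Gs and x :: "'a fls"
    using that lin_nonzero[OF that(2), of c] by (simp add: field_simps)
  define Gs where "Gs = fps_to_fls (Abs_fps (\<lambda>n. c ^ n))"
  have Gs: "Gs $$ k = (if k \<ge> 0 then c powi k else 0)" for k
    by (simp add: Gs_def power_int_def)
  have "Gs * lin fls_X c = 1"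
  proof (rule fls_eqI)
    fix k :: int
    consider "k < 0" | "k = 0" | "k \<ge> 1" by linarith
    then show "(Gs * lin fls_X c) $$ k = 1 $$ k"
    proof cases
      case 3
      then have "c powi k = c * c powi (k - 1)"
        using power_int_add_1'[of c "k - 1"] by (cases "c = 0") auto
      then show ?thesis using 3 by (simp add: lin_mult_nth Gs)
    qed (simp_all add: lin_mult_nth Gs)
  qed
  from e[OF this] show "(1 / lin fls_X c) $$ k = (if k \<ge> 0 then c powi k else 0)"
    by (simp add: Gs)
  assume c: "c \<noteq> 0"
  define H where "H = fps_to_fls (Abs_fps (\<lambda>n. if n = 0 then 0 else - (inverse c ^ n)))"
  have H: "H $$ k = (if k \<ge> 1 then - (c powi (- k)) else 0)" for k
    using c by (auto simp: H_def power_int_def power_inverse)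
  have "H * lin fls_X_inv c = 1"
  proof (rule fls_eqI)
    fix k :: int
    consider "k < 0" | "k = 0" | "k \<ge> 1" by linarith
    then show "(H * lin fls_X_inv c) $$ k = 1 $$ k"
    proof cases
      case 3
      have "c powi (- k) = c * c powi (- (k + 1))"
        using power_int_add_1'[of c "- (k + 1)"] c by simp
      then show ?thesis using 3 by (simp add: lin_mult_nth H)
    next
      case 2
      then show ?thesis using c by (simp add: lin_mult_nth H power_int_minus)
    qed (simp_all add: lin_mult_nth H)
  qed
  from e[OF this] show "(1 / lin fls_X_inv c) $$ k = (if k \<ge> 1 then - (c powi (- k)) else 0)"
    by (simp add: H)
qed

definition row_lin :: "'k::field \<Rightarrow> 'k \<Rightarrow> 'k fls \<Rightarrow> 'k \<Rightarrow> 'k fls" where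
  "row_lin q1 q3 x y = (lin x (q3 * y) * lin x (inverse (q1 * q3) * y)) / (lin x y * lin x (inverse q1 * y))"

definition end_lin :: "'k::field \<Rightarrow> 'k \<Rightarrow> 'k fls \<Rightarrow> 'k \<Rightarrow> 'k fls" where
  "end_lin q1 q3 x y = lin x (inverse (q1 * q3) * y) / lin x y"

lemma ratio_lin:
  "row_ratio (fls_const q1) (fls_const q3) (fls_const y * x) = row_lin q1 q3 x y"
  "end_ratio (fls_const q1) (fls_const q3) (fls_const y * x) = end_lin q1 q3 x y"
  by (simp_all add: row_ratio_def end_ratio_def row_lin_def end_lin_def lin_def fls_inverse_const mult.assoc[symmetric])

lemma ratio_lin_nonzero:
  assumes "expansion_var x"
  shows "row_lin q1 q3 x y \<noteq> 0" "end_lin q1 q3 x y \<noteq> 0"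
  using lin_nonzero[OF assms] by (simp_all add: row_lin_def end_lin_def)

definition row_value :: "'k::field \<Rightarrow> 'k \<Rightarrow> (nat \<Rightarrow> 'k) \<Rightarrow> tuple \<Rightarrow> nat \<times> nat \<Rightarrow> 'k" where
  "row_value q1 q3 u L r = q1 ^ L (fst r) (snd r) * q3 ^ (snd r - 1) * u (fst r)"

definition psi_tensor :: "'k::field \<Rightarrow> 'k \<Rightarrow> (nat \<Rightarrow> 'k) \<Rightarrow> nat \<Rightarrow> 'k fls \<Rightarrow> tuple \<Rightarrow> 'k fls" where
  "psi_tensor q1 q3 u n x L =
     (\<Prod>i\<in>{1..n}. psi_fock (fls_const q1) (fls_const q3) (L i) (fls_const (u i) * x))"

text \<open>The telescoped form needs the binomials to be nonzero, which is automatic for Laurent series.\<close>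

lemma psi_tensor_rows:
  fixes q1 q3 :: "'k::field"
  assumes q: "q1 \<noteq> 0" "q3 \<noteq> 0" and x: "expansion_var x"
    and N: "\<And>j t. j \<in> {1..n} \<Longrightarrow> t > N \<Longrightarrow> L j t = 0"
  shows "psi_tensor q1 q3 u n x L = (\<Prod>j\<in>{1..n}. end_lin q1 q3 x (row_value q1 q3 u L (j, Suc N)))
    * (\<Prod>r\<in>{1..n} \<times> {1..N}. row_lin q1 q3 x (row_value q1 q3 u L r))"
proof -
  have "psi_fock (fls_const q1) (fls_const q3) (L j) (fls_const (u j) * x)
      = end_lin q1 q3 x (row_value q1 q3 u L (j, Suc N))
        * (\<Prod>t\<in>{1..N}. row_lin q1 q3 x (row_value q1 q3 u L (j, t)))" if j: "j \<in> {1..n}" for j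
  proof -
    have "psi_fock (fls_const q1) (fls_const q3) (L j) (fls_const (u j) * x)
        = end_ratio (fls_const q1) (fls_const q3) (fls_const q3 ^ N * (fls_const (u j) * x)) *
          (\<Prod>t\<in>{1..N}. row_ratio (fls_const q1) (fls_const q3)
             (fls_const q1 ^ L j t * fls_const q3 ^ (t - 1) * (fls_const (u j) * x)))"
    proof (rule psi_fock_truncated)
      fix t
      have "1 - fls_const q3 ^ t * (fls_const (u j) * x) = lin x (q3 ^ t * u j)"
        by (simp add: lin_def fls_const_power[symmetric] mult.assoc[symmetric])
      moreover have "1 - inverse (fls_const q1 * fls_const q3) * (fls_const q3 ^ t * (fls_const (u j) * x))
          = lin x (inverse (q1 * q3) * (q3 ^ t * u j))"
        by (simp add: lin_def fls_const_power[symmetric] fls_inverse_const mult.assoc[symmetric])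
      ultimately show "1 - fls_const q3 ^ t * (fls_const (u j) * x) \<noteq> 0 \<and>
          1 - inverse (fls_const q1 * fls_const q3) * (fls_const q3 ^ t * (fls_const (u j) * x)) \<noteq> 0"
        using lin_nonzero[OF x] by metis
    qed (use q N j in auto)
    also have "fls_const q3 ^ N * (fls_const (u j) * x) = fls_const (row_value q1 q3 u L (j, Suc N)) * x"
      using N[OF j] by (simp add: row_value_def fls_const_power[symmetric] mult.assoc[symmetric])
    also have "(\<Prod>t\<in>{1..N}. row_ratio (fls_const q1) (fls_const q3)
             (fls_const q1 ^ L j t * fls_const q3 ^ (t - 1) * (fls_const (u j) * x)))
        = (\<Prod>t\<in>{1..N}. row_ratio (fls_const q1) (fls_const q3) (fls_const (row_value q1 q3 u L (j, t)) * x))"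
      by (simp add: row_value_def fls_const_power[symmetric] mult.assoc[symmetric])
    finally show ?thesis by (simp only: ratio_lin)
  qed
  then show ?thesis unfolding psi_tensor_def by (simp add: prod.distrib prod_Times)
qed

subsection \<open>Coefficientwise specialization\<close>

definition fls_specializes :: "(nat \<Rightarrow> complex) \<Rightarrow> ratfun fls \<Rightarrow> complex fls \<Rightarrow> bool" where
  "fls_specializes \<sigma> Fs Gs \<longleftrightarrow> (\<forall>k. specializes id \<sigma> (Fs $$ k) (Gs $$ k))"

lemma fls_specializes_mult_lin:
  assumes "fls_specializes \<sigma> Fs Gs" "specializes id \<sigma> c d"
  shows "fls_specializes \<sigma> (Fs * lin fls_X c) (Gs * lin fls_X d)"
    "fls_specializes \<sigma> (Fs * lin fls_X_inv c) (Gs * lin fls_X_inv d)"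
  using assms unfolding fls_specializes_def lin_mult_nth
  by (auto intro!: specializes_intros(9) specializes_intros(6))

text \<open>The coefficients of a quotient by a binomial satisfy a recursion that starts with zeros.\<close>

lemma fls_specializes_divide_lin:
  assumes Fs: "fls_specializes \<sigma> Fs Gs" and c: "specializes id \<sigma> c d" and d: "d \<noteq> 0"
  shows "fls_specializes \<sigma> (Fs / lin fls_X c) (Gs / lin fls_X d)"
    "fls_specializes \<sigma> (Fs / lin fls_X_inv c) (Gs / lin fls_X_inv d)"
proof -
  have c0: "c \<noteq> 0" using specializes_nonzero[OF ring_embedding_id c d] .
  have FG: "specializes id \<sigma> (Fs $$ k) (Gs $$ k)" for k using Fs by (simp add: fls_specializes_def)
  have ind: "\<forall>k. specializes id \<sigma> (H $$ k) (K $$ k)"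
    if step: "\<And>k. specializes id \<sigma> (H $$ k) (K $$ k) \<Longrightarrow> specializes id \<sigma> (H $$ (k + 1)) (K $$ (k + 1))"
    for H :: "ratfun fls" and K :: "complex fls"
  proof
    fix k
    define m where "m = min (fls_subdegree H) (fls_subdegree K) - 1"
    have low: "specializes id \<sigma> (H $$ j) (K $$ j)" if "j \<le> m" for j
    proof -
      have "H $$ j = 0" "K $$ j = 0" using that by (simp_all add: m_def)
      then show ?thesis using specializes_intros(4) by simp
    qed
    show "specializes id \<sigma> (H $$ k) (K $$ k)"
    proof (cases "k \<ge> m")
      case True
      then show ?thesis
      proof (induction k rule: int_ge_induct)
        case base
        show ?case by (rule low) simp
      next
        case (step i)
        show ?case by (rule that[OF step.IH])
      qed
    qed (use low in simp)
  qed
  define H where "H = Fs / lin fls_X c"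
  define K where "K = Gs / lin fls_X d"
  have "Fs = H * lin fls_X c" "Gs = K * lin fls_X d"
    using lin_nonzero[of fls_X c] lin_nonzero[of fls_X d] by (simp_all add: H_def K_def)
  then have "H $$ (k + 1) = Fs $$ (k + 1) + c * H $$ k" "K $$ (k + 1) = Gs $$ (k + 1) + d * K $$ k" for k
    by (simp_all add: lin_mult_nth)
  then show "fls_specializes \<sigma> (Fs / lin fls_X c) (Gs / lin fls_X d)"
    unfolding fls_specializes_def H_def[symmetric] K_def[symmetric]
    by (intro ind) (simp only:, intro specializes_intros(5) specializes_intros(6) FG c)
  define H' where "H' = Fs / lin fls_X_inv c"
  define K' where "K' = Gs / lin fls_X_inv d"
  have "Fs = H' * lin fls_X_inv c" "Gs = K' * lin fls_X_inv d"
    using lin_nonzero[of fls_X_inv c] lin_nonzero[of fls_X_inv d] by (simp_all add: H'_def K'_def)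
  then have "H' $$ (k + 1) = (H' $$ k - Fs $$ k) / c" "K' $$ (k + 1) = (K' $$ k - Gs $$ k) / d" for k
    using c0 d by (simp_all add: lin_mult_nth)
  then show "fls_specializes \<sigma> (Fs / lin fls_X_inv c) (Gs / lin fls_X_inv d)"
    unfolding fls_specializes_def H'_def[symmetric] K'_def[symmetric]
    by (intro ind) (simp only:, intro specializes_intros(10) specializes_intros(9) FG c d)
qed

lemma fls_specializes_prod:
  assumes "\<And>r Fs Gs. r \<in> A \<Longrightarrow> fls_specializes \<sigma> Fs Gs \<Longrightarrow> fls_specializes \<sigma> (Fs * f r) (Gs * g r)"
    "fls_specializes \<sigma> Fs Gs"
  shows "fls_specializes \<sigma> (Fs * prod f A) (Gs * prod g A)"
  using assms
proof (induction A arbitrary: Fs Gs rule: infinite_finite_induct)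
  case (insert r A)
  have "fls_specializes \<sigma> (Fs * f r * prod f A) (Gs * g r * prod g A)"
    by (rule insert.IH) (use insert.prems in auto)
  then show ?case using insert.hyps by (simp add: mult.assoc)
qed auto

lemma fls_specializes_1: "fls_specializes \<sigma> 1 1"
  unfolding fls_specializes_def using specializes_intros(3,4) by auto

context resonance
begin

definition psi_series :: "complex fls \<Rightarrow> tuple \<Rightarrow> complex fls" where
  "psi_series x L = psi_tensor q1 q3 cu n x L"

lemma row_value_val: "row_value q1 q3 cu L r = val (corner L r)"
  by (simp add: row_value_def val_corner)

lemma psi_series_rows:
  assumes N: "height_bound L N" and x: "expansion_var x"
  shows "psi_series x L = (\<Prod>j\<in>{1..n}. end_lin q1 q3 x (val (corner L (j, Suc N))))
    * (\<Prod>r\<in>rows N. row_lin q1 q3 x (val (corner L r)))"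
  unfolding psi_series_def rows_def
  using psi_tensor_rows[OF q_nonzero(1,3) x, of n N L cu] N
  unfolding row_value_val height_bound_def by blast

lemma psi_specializes:
  assumes L: "L \<in> states"
  shows "specializes id point (generic_coeff n (PsiP k) L L) (psi_series fls_X L $$ int k)"
    "specializes id point (generic_coeff n (PsiM k) L L) (psi_series fls_X_inv L $$ int k)"
proof -
  obtain N where N: "height_bound L N" using height_bound_exists[OF L] by blast
  then have N': "L j t = 0" if "j \<in> {1..n}" "t > N" for j t
    using that unfolding height_bound_def by blast
  have rv: "specializes id point (row_value (rvar 0) (rvar 1) gen_u L r) (val (corner L r))" if "1 \<le> fst r" for r
    unfolding row_value_def val_corner
    by (intro specializes_intros(6) specializes_intros(11) point_var that)
  have i13: "specializes id point (inverse (rvar 0 * rvar 1)) (inverse (q1 * q3))"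
    by (rule specializes_intros(7)[OF specializes_intros(6)[OF point_var(1,2)]]) (use q_nonzero in simp)
  have i1: "specializes id point (inverse (rvar 0)) (inverse q1)"
    by (rule specializes_intros(7)[OF point_var(1) q_nonzero(1)])
  have *: "fls_specializes point (psi_tensor (rvar 0) (rvar 1) gen_u n x L) (psi_series y L)"
    if xy: "(x = fls_X \<and> y = fls_X) \<or> (x = fls_X_inv \<and> y = fls_X_inv)" for x y
  proof -
    have m: "fls_specializes point (Fs * lin x c) (Gs * lin y d)"
      if "fls_specializes point Fs Gs" "specializes id point c d" for Fs Gs c d
      using fls_specializes_mult_lin[OF that] xy by auto
    have dv: "fls_specializes point (Fs / lin x c) (Gs / lin y d)"
      if "fls_specializes point Fs Gs" "specializes id point c d" "d \<noteq> 0" for Fs Gs c d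
      using fls_specializes_divide_lin[OF that] xy by auto
    have row: "fls_specializes point (Fs * row_lin (rvar 0) (rvar 1) x c) (Gs * row_lin q1 q3 y d)"
      if "fls_specializes point Fs Gs" "specializes id point c d" "d \<noteq> 0" for Fs Gs c d
    proof -
      have "fls_specializes point
        (Fs * lin x (rvar 1 * c) * lin x (inverse (rvar 0 * rvar 1) * c) / lin x c / lin x (inverse (rvar 0) * c))
        (Gs * lin y (q3 * d) * lin y (inverse (q1 * q3) * d) / lin y d / lin y (inverse q1 * d))"
        by (intro dv m that specializes_intros(6)[OF point_var(2) that(2)] specializes_intros(6)[OF i13 that(2)]
            specializes_intros(6)[OF i1 that(2)]) (use that(3) q_nonzero in simp)
      then show ?thesis by (simp add: row_lin_def mult.assoc)
    qed
    have ed: "fls_specializes point (Fs * end_lin (rvar 0) (rvar 1) x c) (Gs * end_lin q1 q3 y d)"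
      if "fls_specializes point Fs Gs" "specializes id point c d" "d \<noteq> 0" for Fs Gs c d
    proof -
      have "fls_specializes point (Fs * lin x (inverse (rvar 0 * rvar 1) * c) / lin x c)
        (Gs * lin y (inverse (q1 * q3) * d) / lin y d)"
        by (intro dv m that specializes_intros(6)[OF i13 that(2)])
      then show ?thesis by (simp add: end_lin_def mult.assoc)
    qed
    have "fls_specializes point (1 * (\<Prod>j\<in>{1..n}. end_lin (rvar 0) (rvar 1) x (row_value (rvar 0) (rvar 1) gen_u L (j, Suc N)))
        * (\<Prod>r\<in>{1..n} \<times> {1..N}. row_lin (rvar 0) (rvar 1) x (row_value (rvar 0) (rvar 1) gen_u L r)))
      (1 * (\<Prod>j\<in>{1..n}. end_lin q1 q3 y (val (corner L (j, Suc N))))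
        * (\<Prod>r\<in>{1..n} \<times> {1..N}. row_lin q1 q3 y (val (corner L r))))"
      by (intro fls_specializes_prod fls_specializes_1 row ed rv) (auto simp del: val.simps simp: val_nonzero)
    moreover have "expansion_var x" "expansion_var y" using xy by auto
    ultimately show ?thesis
      using psi_tensor_rows[OF rvar_nonzero rvar_nonzero, of x n N L 0 1 gen_u] N' psi_series_rows[OF N]
      by (simp add: rows_def)
  qed
  have P: "generic_coeff n (PsiP k) L L = psi_tensor (rvar 0) (rvar 1) gen_u n fls_X L $$ int k"
    "generic_coeff n (PsiM k) L L = psi_tensor (rvar 0) (rvar 1) gen_u n fls_X_inv L $$ int k"
    by (simp_all add: generic_coeff_def psi_tensor_def)
  show "specializes id point (generic_coeff n (PsiP k) L L) (psi_series fls_X L $$ int k)"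
    "specializes id point (generic_coeff n (PsiM k) L L) (psi_series fls_X_inv L $$ int k)"
    unfolding P using *[of fls_X fls_X] *[of fls_X_inv fls_X_inv] by (auto simp: fls_specializes_def)
qed

text \<open>Every factor is a quotient of two products with equally many binomials.\<close>

lemma psi_series_subdegree:
  assumes L: "L \<in> states" and x: "expansion_var x"
  shows "fls_subdegree (psi_series x L) = 0" "psi_series x L \<noteq> 0"
proof -
  obtain N where N: "height_bound L N" using height_bound_exists[OF L] by blast
  have nz: "row_lin q1 q3 x y \<noteq> 0" "end_lin q1 q3 x y \<noteq> 0" for y
    using ratio_lin_nonzero[OF x] by auto
  then show "psi_series x L \<noteq> 0" unfolding psi_series_rows[OF N x] by simp
  have sd: "fls_subdegree (lin x c) = fls_subdegree (lin x d)" if "c \<noteq> 0" "d \<noteq> 0" for c d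
    using x lin_subdegree that by (metis (full_types))
  have r: "fls_subdegree (row_lin q1 q3 x (val c)) = 0" for c
  proof -
    have "lin x (q3 * val c) * lin x (inverse (q1 * q3) * val c)
        = row_lin q1 q3 x (val c) * (lin x (val c) * lin x (inverse q1 * val c))"
      using lin_nonzero[OF x] by (simp add: row_lin_def)
    then have "fls_subdegree (lin x (q3 * val c)) + fls_subdegree (lin x (inverse (q1 * q3) * val c))
        = fls_subdegree (row_lin q1 q3 x (val c)) + (fls_subdegree (lin x (val c)) + fls_subdegree (lin x (inverse q1 * val c)))"
      using nz lin_nonzero[OF x] by (simp flip: fls_subdegree_mult)
    moreover have "fls_subdegree (lin x (q3 * val c)) = fls_subdegree (lin x (val c))"
      "fls_subdegree (lin x (inverse (q1 * q3) * val c)) = fls_subdegree (lin x (inverse q1 * val c))"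
      by (rule sd; use q_nonzero val_nonzero in simp)+
    ultimately show ?thesis by linarith
  qed
  have e: "fls_subdegree (end_lin q1 q3 x (val c)) = 0" for c
  proof -
    have "lin x (inverse (q1 * q3) * val c) = end_lin q1 q3 x (val c) * lin x (val c)"
      using lin_nonzero[OF x] by (simp add: end_lin_def)
    then have "fls_subdegree (lin x (inverse (q1 * q3) * val c))
        = fls_subdegree (end_lin q1 q3 x (val c)) + fls_subdegree (lin x (val c))"
      using nz lin_nonzero[OF x] by (simp flip: fls_subdegree_mult)
    moreover have "fls_subdegree (lin x (inverse (q1 * q3) * val c)) = fls_subdegree (lin x (val c))"
      by (rule sd; use q_nonzero val_nonzero in simp)
    ultimately show ?thesis by linarith
  qed
  have pr: "fls_subdegree (prod f A) = 0" if "\<And>x. x \<in> A \<Longrightarrow> fls_subdegree (f x) = 0 \<and> f x \<noteq> 0" "finite A"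
    for f :: "'z \<Rightarrow> complex fls" and A
    using that(2,1) by (induction A rule: finite_induct) (simp_all add: fls_subdegree_mult)
  show "fls_subdegree (psi_series x L) = 0"
    unfolding psi_series_rows[OF N x]
    by (subst fls_subdegree_mult) (use nz pr[of "{1..n}"] pr[of "rows N"] r e in \<open>auto simp del: val.simps\<close>)
qed

lemma psi_series_nth_0:
  assumes "L \<in> states" "expansion_var x"
  shows "psi_series x L $$ 0 \<noteq> 0" "k < 0 \<Longrightarrow> psi_series x L $$ k = 0"
  using nth_fls_subdegree_nonzero[OF psi_series_subdegree(2)[OF assms]] psi_series_subdegree(1)[OF assms]
  by auto

lemma corner_add_at:
  assumes x: "addable (boxes L) x"
  shows "corner (add_at L x) r = (if r = row_of x then nxt1 x else corner L r)"
proof -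
  obtain i s where "x = (i, s, L i s)" "row_of x = (i, s)" "add_at L x = add_box L i s"
    by (rule addable_expand[OF x])
  then show ?thesis by (cases r) (auto simp: corner_def add_box_def)
qed

lemma corner_row_of_addable: "addable (boxes L) x \<Longrightarrow> corner L (row_of x) = x"
  using first_empty_corner[OF addable_first_empty] by simp

lemma row_of_in_rows:
  "x \<in> Box \<Longrightarrow> snd (row_of x) \<le> N \<Longrightarrow> row_of x \<in> rows N"
  by (simp add: row_of_rows_iff)

text \<open>Only the row of the new box changes, and its factor changes as in \<open>row_ratio_step\<close>, with
  \<open>z\<close> the inverse of the expansion variable.\<close>

lemma psi_series_step:
  assumes L: "L \<in> states" and d: "addable (boxes L) d" and x: "expansion_var x"
  shows "psi_series x (add_at L d)
      * gcubic (fls_const q1) (fls_const q2) (fls_const q3) (inverse x) (fls_const (val d))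
    = - (psi_series x L * gcubic (fls_const q1) (fls_const q2) (fls_const q3) (fls_const (val d)) (inverse x))"
proof -
  obtain N where N: "height_bound (add_at L d) N"
    using height_bound_exists[OF add_at_state(1)[OF L d]] by blast
  note H = height_bound_add_at[OF L d N]
  let ?r = "row_of d"
  have rN: "?r \<in> rows N" by (rule row_of_in_rows[OF addableD(1)[OF d] H(2)])
  have x0: "x \<noteq> 0" using x by auto
  define E0 where "E0 = (\<Prod>j\<in>{1..n}. end_lin q1 q3 x (val (corner L (j, Suc N))))"
  define R where "R = (\<Prod>r\<in>rows N - {?r}. row_lin q1 q3 x (val (corner L r)))"
  have P1: "psi_series x L = E0 * (row_lin q1 q3 x (val d) * R)"
    unfolding psi_series_rows[OF H(1) x] E0_def R_def
    by (subst prod.remove[OF finite_rows rN]) (simp only: corner_row_of_addable[OF d])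
  have "(\<Prod>j\<in>{1..n}. end_lin q1 q3 x (val (corner (add_at L d) (j, Suc N)))) = E0"
    unfolding E0_def
  proof (rule prod.cong[OF refl])
    fix j
    have "(j, Suc N) \<noteq> row_of d" using H(2) by (metis snd_conv not_less_eq_eq order_refl)
    then show "end_lin q1 q3 x (val (corner (add_at L d) (j, Suc N))) = end_lin q1 q3 x (val (corner L (j, Suc N)))"
      by (simp add: corner_add_at[OF d])
  qed
  moreover have "(\<Prod>r\<in>rows N - {?r}. row_lin q1 q3 x (val (corner (add_at L d) r))) = R"
    unfolding R_def by (rule prod.cong) (auto simp: corner_add_at[OF d])
  moreover have "corner (add_at L d) ?r = nxt1 d" by (simp add: corner_add_at[OF d])
  ultimately have P2: "psi_series x (add_at L d) = E0 * (row_lin q1 q3 x (q1 * val d) * R)"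
    unfolding psi_series_rows[OF N x]
    by (subst prod.remove[OF finite_rows rN]) (simp only: val_nxt(1))
  let ?y = "fls_const (val d) * x"
  have qq: "fls_const q1 * fls_const q2 * fls_const q3 = 1" using q by simp
  have n1: "1 - fls_const q1 * ?y \<noteq> 0"
    using lin_nonzero[OF x, of "q1 * val d"] by (simp add: lin_def mult.assoc[symmetric])
  have n2: "1 - inverse (fls_const q1) * ?y \<noteq> 0"
    using lin_nonzero[OF x, of "inverse q1 * val d"] by (simp add: lin_def mult.assoc[symmetric] fls_inverse_const)
  have yz: "?y * inverse x = fls_const (val d)" using x0 by simp
  have "row_lin q1 q3 x (q1 * val d) * gcubic (fls_const q1) (fls_const q2) (fls_const q3) (inverse x) (fls_const (val d))
    = - (row_lin q1 q3 x (val d) * gcubic (fls_const q1) (fls_const q2) (fls_const q3) (fls_const (val d)) (inverse x))"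
    using row_ratio_step[OF qq n1 n2, of "inverse x"] unfolding yz
    by (simp add: mult.assoc[symmetric] ratio_lin)
  then show ?thesis unfolding P1 P2 by (simp add: mult_ac)
qed

end

section \<open>Partial fractions\<close>

definition linear_product :: "'k::field multiset \<Rightarrow> 'k poly" where
  "linear_product D = (\<Prod>\<alpha>\<in>#D. [:1, - \<alpha>:])"

lemma linear_product_degree: "Polynomial.degree (linear_product D) \<le> size D"
proof (induction D)
  case (add \<alpha> D)
  have eq: "linear_product (add_mset \<alpha> D) = [:1, - \<alpha>:] * linear_product D"
    by (simp only: linear_product_def image_mset_add_mset prod_mset.add_mset)
  have "Polynomial.degree ([:1, - \<alpha>:] * linear_product D)
      \<le> Polynomial.degree [:1, - \<alpha>:] + Polynomial.degree (linear_product D)"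
    by (rule degree_mult_le)
  moreover have "Polynomial.degree [:1, - \<alpha>:] \<le> 1" by simp
  ultimately show ?case using add unfolding size_add_mset eq by linarith
qed (simp add: linear_product_def)

lemma linear_product_coeff: "Polynomial.coeff (linear_product D) (size D) = (\<Prod>\<alpha>\<in>#D. - \<alpha>)"
proof (induction D)
  case (add \<alpha> D)
  have "Polynomial.coeff (linear_product D) (Suc (size D)) = 0"
    using linear_product_degree[of D] by (intro coeff_eq_0) simp
  then show ?case using add by (simp add: linear_product_def)
qed (simp add: linear_product_def)

lemma poly_linear_product: "poly (linear_product D) x = (\<Prod>\<alpha>\<in>#D. 1 - \<alpha> * x)"
  by (simp add: linear_product_def poly_prod_mset mult.commute)

lemma poly_linear_product_set:
  "poly (linear_product (mset_set C)) x = (\<Prod>c\<in>C. 1 - c * x)"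
  by (simp add: poly_linear_product prod_unfold_prod_mset)

definition pf_residue :: "'k::field multiset \<Rightarrow> 'k set \<Rightarrow> 'k \<Rightarrow> 'k" where
  "pf_residue D C c = (\<Prod>\<alpha>\<in>#D. 1 - \<alpha> / c) / (\<Prod>c'\<in>C - {c}. 1 - c' / c)"

definition pf_constant :: "'k::field multiset \<Rightarrow> 'k set \<Rightarrow> 'k" where
  "pf_constant D C = (\<Prod>\<alpha>\<in>#D. - \<alpha>) / (\<Prod>c\<in>C. - c)"

text \<open>Both sides are polynomials of degree at most \<open>card C\<close> that agree at the inverses of the elements of
  \<open>C\<close> and in the coefficient of degree \<open>card C\<close>.\<close>

lemma partial_fractions:
  fixes C :: "'k::field set"
  assumes C: "finite C" "0 \<notin> C" and D: "size D = card C"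
  shows "(\<Prod>\<alpha>\<in>#D. 1 - \<alpha> * x) = pf_constant D C * (\<Prod>c\<in>C. 1 - c * x)
     + (\<Sum>c\<in>C. pf_residue D C c * (\<Prod>c'\<in>C - {c}. 1 - c' * x))"
proof -
  define Q where "Q = smult (pf_constant D C) (linear_product (mset_set C))
     + (\<Sum>c\<in>C. smult (pf_residue D C c) (linear_product (mset_set (C - {c}))))"
  have poly_Q: "poly Q x = pf_constant D C * (\<Prod>c\<in>C. 1 - c * x)
     + (\<Sum>c\<in>C. pf_residue D C c * (\<Prod>c'\<in>C - {c}. 1 - c' * x))" for x
    by (simp add: Q_def poly_sum poly_linear_product_set)
  have low: "Polynomial.degree (linear_product (mset_set (C - {c}))) < card C" if "c \<in> C" for c
    using linear_product_degree[of "mset_set (C - {c})"] C that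
    by (metis card_Diff1_less size_mset_set order.strict_trans1)
  have "linear_product D = Q"
  proof (rule poly_eqI_degree_lead_coeff[where A = "inverse ` C" and n = "card C"])
    have nz: "(\<Prod>c\<in>C. - c) \<noteq> 0" using C by auto
    have "Polynomial.coeff (linear_product (mset_set C)) (card C) = (\<Prod>c\<in>C. - c)"
      using linear_product_coeff[of "mset_set C"] by (simp add: prod_unfold_prod_mset)
    moreover have "(\<Sum>c\<in>C. pf_residue D C c * Polynomial.coeff (linear_product (mset_set (C - {c}))) (card C)) = 0"
      by (intro sum.neutral ballI) (simp add: coeff_eq_0 low)
    ultimately show "Polynomial.coeff (linear_product D) (card C) = Polynomial.coeff Q (card C)"
      using nz linear_product_coeff[of D] by (simp add: Q_def D coeff_sum pf_constant_def)
    show "card C \<le> card (inverse ` C)" by (simp add: card_image inj_on_def)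
    show "Polynomial.degree (linear_product D) \<le> card C"
      using linear_product_degree[of D] by (simp add: D)
    have "Polynomial.degree (linear_product (mset_set C)) \<le> card C"
      using linear_product_degree[of "mset_set C"] by simp
    then show "Polynomial.degree Q \<le> card C"
      unfolding Q_def
      by (intro degree_add_le degree_sum_le order.trans[OF degree_smult_le] C(1))
         (use low in \<open>auto intro: less_imp_le\<close>)
    fix z assume "z \<in> inverse ` C"
    then obtain c where c: "c \<in> C" "z = inverse c" by auto
    have c0: "c \<noteq> 0" using c C by auto
    have vanish: "(\<Prod>c'\<in>A. 1 - c' * z) = 0" if "c \<in> A" "finite A" for A
      using that c0 by (intro prod_zero) (auto simp: c intro!: bexI[of _ c])
    have sum: "(\<Sum>c''\<in>C. pf_residue D C c'' * (\<Prod>c'\<in>C - {c''}. 1 - c' * z))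
        = pf_residue D C c * (\<Prod>c'\<in>C - {c}. 1 - c' * z)"
    proof -
      have "(\<Sum>c''\<in>C - {c}. pf_residue D C c'' * (\<Prod>c'\<in>C - {c''}. 1 - c' * z)) = 0"
      proof (rule sum.neutral, rule ballI)
        fix d assume "d \<in> C - {c}"
        then have "(\<Prod>c'\<in>C - {d}. 1 - c' * z) = 0" using c C by (intro vanish) auto
        then show "pf_residue D C d * (\<Prod>c'\<in>C - {d}. 1 - c' * z) = 0" by simp
      qed
      then show ?thesis by (simp only: sum.remove[OF C(1) c(1)] add_0_right)
    qed
    have "(\<Prod>c'\<in>C - {c}. 1 - c' / c) \<noteq> 0"
      using C c0 by (auto simp: field_simps)
    then have r: "pf_residue D C c * (\<Prod>c'\<in>C - {c}. 1 - c' * z) = (\<Prod>\<alpha>\<in>#D. 1 - \<alpha> * z)"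
      by (simp add: pf_residue_def c(2) flip: field_class.field_divide_inverse)
    show "poly (linear_product D) z = poly Q z"
      unfolding poly_Q poly_linear_product sum r vanish[OF c(1) C(1)] by simp
  qed
  then have "poly (linear_product D) x = poly Q x" by simp
  then show ?thesis unfolding poly_Q poly_linear_product .
qed

lemma fls_const_diff: "fls_const (x - y) = fls_const x - fls_const (y :: 'k::field)"
  by (simp add: fls_minus_const)

lemma fls_const_div: "fls_const (x / y) = fls_const x / fls_const (y :: 'k::field)"
  by (simp add: fls_const_divide_const)

lemma fls_const_prod: "fls_const (\<Prod>x\<in>A. f x) = (\<Prod>x\<in>A. fls_const (f x :: 'k::field))"
  by (induction A rule: infinite_finite_induct) (simp_all add: fls_const_mult_const[symmetric] del: fls_const_mult_const)

lemma fls_const_prod_mset: "fls_const (\<Prod>x\<in>#A. f x) = (\<Prod>x\<in>#A. fls_const (f x :: 'k::field))"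
  by (induction A) (simp_all add: fls_const_mult_const[symmetric] del: fls_const_mult_const)

text \<open>The two expansions of a function with simple poles differ by the sum of the residues times
  the delta functions at the poles.\<close>

lemma expansion_difference:
  fixes C :: "'k::field set"
  assumes C: "finite C" "0 \<notin> C" and D: "size D = card C"
  shows "((\<Prod>\<alpha>\<in>#D. lin fls_X \<alpha>) / (\<Prod>c\<in>C. lin fls_X c)) $$ k
     - ((\<Prod>\<alpha>\<in>#D. lin fls_X_inv \<alpha>) / (\<Prod>c\<in>C. lin fls_X_inv c)) $$ (- k)
     = (\<Sum>c\<in>C. pf_residue D C c * c powi k)"
proof -
  have *: "(\<Prod>\<alpha>\<in>#D. lin x \<alpha>) / (\<Prod>c\<in>C. lin x c)
      = fls_const (pf_constant D C) + (\<Sum>c\<in>C. fls_const (pf_residue D C c) * (1 / lin x c))"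
    if x: "expansion_var x" for x :: "'k fls"
  proof -
    let ?c = "fls_const :: 'k \<Rightarrow> 'k fls"
    have inj: "inj_on ?c A" for A
    proof (rule inj_onI)
      fix y z assume "?c y = ?c z"
      then have "?c y $$ 0 = ?c z $$ 0" by simp
      then show "y = z" by simp
    qed
    have im: "?c ` C - {?c c} = ?c ` (C - {c})" if "c \<in> C" for c
      using inj_on_image_set_diff[OF inj[of UNIV], of C "{c}"] that by simp
    have im2: "(\<Prod>c'\<in>?c ` A. f c') = (\<Prod>c'\<in>A. f (?c c'))" for f :: "'k fls \<Rightarrow> 'k fls" and A
      by (rule prod.reindex[OF inj, unfolded comp_def])
    have r: "pf_residue (image_mset ?c D) (?c ` C) (?c c) = ?c (pf_residue D C c)" if "c \<in> C" for c
      unfolding pf_residue_def im[OF that] im2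
      by (simp add: fls_const_div fls_const_diff fls_const_prod fls_const_prod_mset image_mset.compositionality comp_def
          del: fls_const_divide_const)
    have k: "pf_constant (image_mset ?c D) (?c ` C) = ?c (pf_constant D C)"
      unfolding pf_constant_def im2
      by (simp add: fls_const_div fls_const_prod fls_const_prod_mset image_mset.compositionality comp_def
          del: fls_const_divide_const)
    have "(\<Prod>\<alpha>\<in>#D. lin x \<alpha>) = ?c (pf_constant D C) * (\<Prod>c\<in>C. lin x c)
       + (\<Sum>c\<in>C. ?c (pf_residue D C c) * (\<Prod>c'\<in>C - {c}. lin x c'))"
    proof -
      have "(\<Prod>\<alpha>\<in>#image_mset ?c D. 1 - \<alpha> * x)
          = pf_constant (image_mset ?c D) (?c ` C) * (\<Prod>c\<in>?c ` C. 1 - c * x)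
          + (\<Sum>c\<in>?c ` C. pf_residue (image_mset ?c D) (?c ` C) c * (\<Prod>c'\<in>?c ` C - {c}. 1 - c' * x))"
        by (rule partial_fractions) (use C D card_image[OF inj, of C] in auto)
      moreover have "(\<Sum>c\<in>?c ` C. pf_residue (image_mset ?c D) (?c ` C) c * (\<Prod>c'\<in>?c ` C - {c}. 1 - c' * x))
          = (\<Sum>c\<in>C. ?c (pf_residue D C c) * (\<Prod>c'\<in>C - {c}. lin x c'))"
        unfolding sum.reindex[OF inj, unfolded comp_def]
        by (rule sum.cong[OF refl]) (simp add: r im im2 lin_def)
      ultimately show ?thesis
        by (simp add: k im2 lin_def image_mset.compositionality comp_def)
    qed
    moreover have nz: "(\<Prod>c\<in>A. lin x c) \<noteq> 0" if "finite A" for A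
      using that lin_nonzero[OF x] by simp
    moreover have "(\<Prod>c'\<in>C - {c}. lin x c') / (\<Prod>c'\<in>C. lin x c') = 1 / lin x c" if "c \<in> C" for c
      using C(1) that nz[of "C - {c}"] by (subst prod.remove[OF C(1) that, of "lin x"]) (simp add: divide_simps)
    ultimately show ?thesis
      using nz[OF C(1)] by (simp add: add_divide_distrib sum_divide_distrib flip: times_divide_eq_right cong: sum.cong)
  qed
  have cm: "(fls_const c * (H :: 'k fls)) $$ j = c * H $$ j" for c H j
    by simp
  have "(fls_const (pf_constant D C)) $$ k = (fls_const (pf_constant D C)) $$ (- k)" by simp
  moreover have "(1 / lin fls_X c) $$ k - (1 / lin fls_X_inv c) $$ (- k) = c powi k" if "c \<in> C" for c
  proof -
    have "c \<noteq> 0" using that C by auto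
    from geometric_series(2)[OF this, of "- k"] show ?thesis
      using geometric_series(1)[of c k] by simp
  qed
  then have "(\<Sum>c\<in>C. pf_residue D C c * c powi k)
      = (\<Sum>c\<in>C. pf_residue D C c * (1 / lin fls_X c) $$ k) - (\<Sum>c\<in>C. pf_residue D C c * (1 / lin fls_X_inv c) $$ (- k))"
    by (simp add: sum_subtractf[symmetric] right_diff_distrib[symmetric] cong: sum.cong)
  ultimately show ?thesis
    by (simp only: * simp_thms fls_plus_nth fls_nth_sum cm add_diff_cancel_left)
qed

text \<open>The residue can be computed from an unreduced fraction with numerator \<open>A\<close>, provided that the factor of
  the pole occurs only once in its denominator.\<close>

lemma residue_value:
  fixes C :: "'k::field set"
  assumes C: "finite C" "c \<in> C" "c \<noteq> 0" and eq: "A + mset_set C = add_mset c B + D"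
    and B: "\<And>\<beta>. \<beta> \<in># B \<Longrightarrow> \<beta> \<noteq> c"
  shows "pf_residue D C c = (\<Prod>\<alpha>\<in>#A. 1 - \<alpha> / c) / (\<Prod>\<beta>\<in>#B. 1 - \<beta> / c)"
proof -
  have "mset_set C = add_mset c (mset_set (C - {c}))"
    using C by (simp add: mset_set.remove)
  then have "A + mset_set (C - {c}) = B + D" using eq by simp
  then have "(\<Prod>\<alpha>\<in>#A + mset_set (C - {c}). 1 - \<alpha> / c) = (\<Prod>\<alpha>\<in>#B + D. 1 - \<alpha> / c)" by simp
  then have "(\<Prod>\<alpha>\<in>#A. 1 - \<alpha> / c) * (\<Prod>c'\<in>C - {c}. 1 - c' / c)
      = (\<Prod>\<alpha>\<in>#B. 1 - \<alpha> / c) * (\<Prod>\<alpha>\<in>#D. 1 - \<alpha> / c)"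
    by (simp add: prod_unfold_prod_mset)
  moreover have "(\<Prod>c'\<in>C - {c}. 1 - c' / c) \<noteq> 0" using C by (auto simp: field_simps)
  moreover have "(\<Prod>\<beta>\<in>#B. 1 - \<beta> / c) \<noteq> 0" using B C(3) by (auto simp: field_simps)
  ultimately show ?thesis by (simp add: pf_residue_def field_simps)
qed

context resonance
begin

section \<open>The residues of \<open>\<psi>\<close>\<close>

lemma count_image_rows: "finite A \<Longrightarrow> count (image_mset f (mset_set A)) P = card {r \<in> A. f r = P}"
proof -
  assume A: "finite A"
  have "count (image_mset f (mset_set A)) P = (\<Sum>y\<in>f -` {P} \<inter> A. 1)"
    unfolding count_image_mset using A by (intro sum.cong) auto
  also have "f -` {P} \<inter> A = {r \<in> A. f r = P}" by auto
  finally show ?thesis by simp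
qed

definition corner_boxes :: "tuple \<Rightarrow> box set" where
  "corner_boxes L = {x. addable (boxes L) x \<or> removable (boxes L) x}"

definition zero_values :: "tuple \<Rightarrow> nat \<Rightarrow> complex multiset" where
  "zero_values L N = image_mset (\<lambda>r. q3 * val (corner L r)) (mset_set (rows N))
     + image_mset (\<lambda>r. q2 * val (corner L r)) (mset_set (rows (Suc N)))"

definition pole_values :: "tuple \<Rightarrow> nat \<Rightarrow> complex multiset" where
  "pole_values L N = image_mset (\<lambda>r. val (corner L r)) (mset_set (rows (Suc N)))
     + image_mset (\<lambda>r. inverse q1 * val (corner L r)) (mset_set (rows N))"

lemma rows_Suc: "rows (Suc N) = rows N \<union> (\<lambda>j. (j, Suc N)) ` {1..n}" "rows N \<inter> (\<lambda>j. (j, Suc N)) ` {1..n} = {}"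
  by (auto simp: rows_def)

lemma prod_rows_Suc: "(\<Prod>r\<in>rows (Suc N). f r) = (\<Prod>r\<in>rows N. f r) * (\<Prod>j\<in>{1..n}. f (j, Suc N))"
  unfolding rows_Suc(1) by (subst prod.union_disjoint) (use rows_Suc(2) in \<open>auto simp: prod.reindex inj_on_def\<close>)

lemma psi_series_zeros_poles:
  assumes N: "height_bound L N" and x: "expansion_var x"
  shows "psi_series x L = (\<Prod>\<alpha>\<in>#zero_values L N. lin x \<alpha>) / (\<Prod>\<beta>\<in>#pole_values L N. lin x \<beta>)"
  unfolding psi_series_rows[OF N x] zero_values_def pole_values_def
  by (simp add: image_mset.compositionality comp_def prod_unfold_prod_mset[symmetric] prod_rows_Suc
      row_lin_def end_lin_def prod.distrib prod_dividef q2_eq mult_ac)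

lemma pole_values_subset:
  assumes L: "L \<in> states" and N: "height_bound L N" and fin: "finite (corner_boxes L)"
  shows "pole_values L N \<subseteq># zero_values L N + mset_set (val ` corner_boxes L)"
proof (rule mset_subset_eqI)
  fix P
  have e: "inverse q1 * y = P \<longleftrightarrow> y = q1 * P" for y using q_nonzero by (simp add: field_simps)
  have "count (mset_set (val ` corner_boxes L)) P
      = (if \<exists>x. (addable (boxes L) x \<or> removable (boxes L) x) \<and> val x = P then 1 else 0)"
    using fin unfolding count_mset_set' corner_boxes_def by (auto simp del: val.simps)
  then show "count (pole_values L N) P \<le> count (zero_values L N + mset_set (val ` corner_boxes L)) P"
    using pole_zero_count[OF L N, of P]
    by (simp add: pole_values_def zero_values_def count_image_rows e del: val.simps)
qed

lemma corner_boxes_val_inj: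
  assumes L: "L \<in> states"
  shows "inj_on val (corner_boxes L)"
proof (rule inj_onI)
  fix x y assume *: "x \<in> corner_boxes L" "y \<in> corner_boxes L" "val x = val y"
  note S = states_ideal[OF L]
  show "x = y"
    using * first_empty_val_inj[OF S addable_first_empty addable_first_empty] removable_val_inj[OF S]
      addable_removable_val[OF S] unfolding corner_boxes_def mem_Collect_eq by metis
qed

lemma addable_row_bound:
  assumes L: "L \<in> states" and N: "height_bound L N" and x: "addable (boxes L) x"
  shows "snd (row_of x) \<le> Suc N"
proof -
  obtain i s where e: "x = (i, s, L i s)" "1 \<le> i" "i \<le> n" "1 \<le> s" "row_of x = (i, s)"
    by (rule addable_expand[OF x])
  have "s \<le> Suc N"
  proof (rule ccontr)
    assume s: "\<not> s \<le> Suc N"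
    then have "L i s = 0" using N e by (auto simp: height_bound_def)
    then have "nxt3 (i, s - 1, 0) = x" using e s by simp
    then have "(i, s - 1, 0) \<in> boxes L" using addableD(5)[OF x, of "(i, s - 1, 0)"] e s by (simp add: Box_def)
    then have "s - 1 \<le> N" using height_bound_boxes[OF N] by (fastforce simp: row_of_def)
    then show False using s by simp
  qed
  then show ?thesis unfolding e(5) by simp
qed

lemma height_bound_mono: "height_bound L N \<Longrightarrow> N \<le> M \<Longrightarrow> height_bound L M"
  by (auto simp: height_bound_def)

lemma height_bound_add:
  assumes L: "L \<in> states" and N: "height_bound L N" and x: "addable (boxes L) x"
  shows "height_bound (add_at L x) (Suc N)"
  using N addable_row_bound[OF assms] by (auto simp: height_bound_def add_at_def add_box_def row_of_def)

lemma finite_corner_boxes: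
  assumes L: "L \<in> states"
  shows "finite {x. addable (boxes L) x}" "finite {x. removable (boxes L) x}" "finite (corner_boxes L)"
proof -
  obtain N where N: "height_bound L N" using height_bound_exists[OF L] by blast
  have "{x. addable (boxes L) x} \<subseteq> corner L ` rows (Suc N)"
  proof
    fix x assume "x \<in> {x. addable (boxes L) x}"
    then have x: "addable (boxes L) x" by simp
    have "row_of x \<in> rows (Suc N)" by (rule row_of_in_rows[OF addableD(1)[OF x] addable_row_bound[OF L N x]])
    then show "x \<in> corner L ` rows (Suc N)" using corner_row_of_addable[OF x] by (metis imageI)
  qed
  then show 1: "finite {x. addable (boxes L) x}" by (rule finite_subset) simp
  have "{x. removable (boxes L) x} \<subseteq> boxes L" by (auto simp: removable_def)
  then show 2: "finite {x. removable (boxes L) x}" using finite_boxes[OF L] finite_subset by blast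
  have "corner_boxes L = {x. addable (boxes L) x} \<union> {x. removable (boxes L) x}"
    by (auto simp: corner_boxes_def)
  then show "finite (corner_boxes L)" using 1 2 by simp
qed

text \<open>The factors of all rows except that of \<open>x\<close>, which are shared out between the amplitudes of \<open>e\<close> and \<open>f\<close>.\<close>

definition rest_factor :: "tuple \<Rightarrow> nat \<Rightarrow> box \<Rightarrow> complex" where
  "rest_factor L N x = (\<Prod>j\<in>{1..n}. end_ratio q1 q3 (val (corner L (j, Suc N)) / val x))
     * (\<Prod>r\<in>rows N - {row_of x}. row_ratio q1 q3 (val (corner L r) / val x))"

lemma rows_before_after:
  assumes "r \<in> rows N"
  shows "rows_before N r \<union> rows_after n N r = rows N - {r}" "rows_before N r \<inter> rows_after n N r = {}"
  using assms by (auto simp: rows_before_def rows_after_def rows_def)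

lemma finite_rows_before_after [simp]: "finite (rows_before N r)" "finite (rows_after n N r)"
  by (simp_all add: rows_before_def rows_after_def)

lemma prod_disjoint_union:
  "A \<union> B = C \<Longrightarrow> A \<inter> B = {} \<Longrightarrow> finite A \<Longrightarrow> finite B \<Longrightarrow> prod f A * prod f B = prod f C"
  using prod.union_disjoint[of A B f] by simp

lemma e_times_f:
  assumes L: "L \<in> states" and x: "addable (boxes L) x" and N: "height_bound (add_at L x) N"
  shows "e_rows q1 q3 cu N L (val x) (row_of x) * f_rows q1 q3 cu n N L (val x) (row_of x)
    = q1 / (1 - q1) ^ 2 * rest_factor L N x"
proof -
  note H = height_bound_add_at[OF L x N]
  have rN: "row_of x \<in> rows N" by (rule row_of_in_rows[OF addableD(1)[OF x] H(2)])
  then have ib: "1 \<le> fst (row_of x)" "fst (row_of x) \<le> n" by (auto simp: rows_def)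
  have e: "end_factor q1 q3 cu N (val x) j = end_ratio q1 q3 (val (corner L (j, Suc N)) / val x)" if "j \<in> {1..n}" for j
    by (rule end_factor_val) (use that H(1) in \<open>auto simp: height_bound_def\<close>)
  have "{1..<fst (row_of x)} \<union> {fst (row_of x)..n} = {1..n}" "{1..<fst (row_of x)} \<inter> {fst (row_of x)..n} = {}"
    using ib by auto
  then have 1: "(\<Prod>j\<in>{1..<fst (row_of x)}. end_factor q1 q3 cu N (val x) j) * (\<Prod>j\<in>{fst (row_of x)..n}. end_factor q1 q3 cu N (val x) j)
      = (\<Prod>j\<in>{1..n}. end_ratio q1 q3 (val (corner L (j, Suc N)) / val x))"
    using e by (subst prod_disjoint_union) (auto intro: prod.cong)
  have 2: "(\<Prod>r\<in>rows_before N (row_of x). row_factor q1 q3 cu L (val x) r) * (\<Prod>r\<in>rows_after n N (row_of x). row_factor q1 q3 cu L (val x) r)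
      = (\<Prod>r\<in>rows N - {row_of x}. row_ratio q1 q3 (val (corner L r) / val x))"
    unfolding row_factor_val by (rule prod_disjoint_union[OF rows_before_after[OF rN]]) simp_all
  show ?thesis
    unfolding e_rows_def f_rows_def rest_factor_def 1[symmetric] 2[symmetric]
    by (simp add: power2_eq_square mult_ac)
qed

lemma prod_ratio_split:
  assumes rN: "r \<in> rows N" and v: "v \<noteq> 0"
  shows "(\<Prod>\<alpha>\<in>#zero_values L N. 1 - \<alpha> / v)
     = ((1 - q3 * val (corner L r) / v) * (1 - q2 * val (corner L r) / v))
       * ((\<Prod>r'\<in>rows N - {r}. (1 - q3 * val (corner L r') / v) * (1 - q2 * val (corner L r') / v))
       * (\<Prod>j\<in>{1..n}. 1 - q2 * val (corner L (j, Suc N)) / v))"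
proof -
  have "(\<Prod>\<alpha>\<in>#zero_values L N. 1 - \<alpha> / v)
     = (\<Prod>r'\<in>rows N. (1 - q3 * val (corner L r') / v) * (1 - q2 * val (corner L r') / v))
       * (\<Prod>j\<in>{1..n}. 1 - q2 * val (corner L (j, Suc N)) / v)"
    unfolding zero_values_def
    by (simp add: image_mset.compositionality comp_def prod_unfold_prod_mset[symmetric] prod_rows_Suc prod.distrib mult_ac)
  then show ?thesis by (simp only: prod.remove[OF finite_rows rN] mult.assoc)
qed

lemma rest_factor_split:
  assumes "row_of x = r"
  shows "rest_factor L N x = ((\<Prod>r'\<in>rows N - {r}. (1 - q3 * val (corner L r') / val x) * (1 - q2 * val (corner L r') / val x))
       * (\<Prod>j\<in>{1..n}. 1 - q2 * val (corner L (j, Suc N)) / val x))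
     / ((\<Prod>r'\<in>rows N - {r}. (1 - val (corner L r') / val x) * (1 - inverse q1 * val (corner L r') / val x))
       * (\<Prod>j\<in>{1..n}. 1 - val (corner L (j, Suc N)) / val x))"
  unfolding rest_factor_def assms row_ratio_def end_ratio_def q2_eq[symmetric]
  by (simp add: prod_dividef mult_ac)

text \<open>After cancellation the denominator consists of one simple factor for each addable or removable
  box; \<open>D\<close> is what remains of the zeros.\<close>

lemma psi_expansion_difference:
  assumes L: "L \<in> states" and N: "height_bound L N"
  obtains D where "zero_values L N + mset_set (val ` corner_boxes L) = pole_values L N + D"
    "\<forall>k. psi_series fls_X L $$ k - psi_series fls_X_inv L $$ (- k)
      = (\<Sum>x\<in>corner_boxes L. pf_residue D (val ` corner_boxes L) (val x) * val x powi k)"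
proof -
  note fin = finite_corner_boxes(3)[OF L]
  obtain D where D: "zero_values L N + mset_set (val ` corner_boxes L) = pole_values L N + D"
    using pole_values_subset[OF L N fin] by (metis subset_mset.add_diff_inverse)
  have "size (zero_values L N) = size (pole_values L N)" by (simp add: zero_values_def pole_values_def)
  then have size: "size D = card (val ` corner_boxes L)"
    using arg_cong[OF D, of size] fin by simp
  have z: "0 \<notin> val ` corner_boxes L" using val_nonzero by (auto simp del: val.simps)
  have "psi_series x L = (\<Prod>\<alpha>\<in>#D. lin x \<alpha>) / (\<Prod>c\<in>val ` corner_boxes L. lin x c)" if x: "expansion_var x" for x
  proof -
    have "(\<Prod>\<alpha>\<in>#zero_values L N. lin x \<alpha>) * (\<Prod>c\<in>val ` corner_boxes L. lin x c)
        = (\<Prod>\<alpha>\<in>#pole_values L N. lin x \<alpha>) * (\<Prod>\<alpha>\<in>#D. lin x \<alpha>)"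
      using arg_cong[OF D, of "\<lambda>M. \<Prod>\<alpha>\<in>#M. lin x \<alpha>"] by (simp add: prod_unfold_prod_mset)
    moreover have "(\<Prod>c\<in>val ` corner_boxes L. lin x c) \<noteq> 0" "(\<Prod>\<alpha>\<in>#pole_values L N. lin x \<alpha>) \<noteq> 0"
      using lin_nonzero[OF x] fin by auto
    ultimately show ?thesis unfolding psi_series_zeros_poles[OF N x] by (simp add: field_simps)
  qed
  then have "psi_series fls_X L $$ k - psi_series fls_X_inv L $$ (- k)
      = (\<Sum>c\<in>val ` corner_boxes L. pf_residue D (val ` corner_boxes L) c * c powi k)" for k
    using expansion_difference[OF _ z size, of k] fin by simp
  then have "psi_series fls_X L $$ k - psi_series fls_X_inv L $$ (- k)
      = (\<Sum>x\<in>corner_boxes L. pf_residue D (val ` corner_boxes L) (val x) * val x powi k)" for k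
    by (simp add: sum.reindex[OF corner_boxes_val_inj[OF L]] del: val.simps)
  then show ?thesis using that[OF D] by blast
qed

lemma residue_addable:
  assumes L: "L \<in> states" and N: "height_bound (add_at L x) N" and x: "addable (boxes L) x"
    and D: "zero_values L N + mset_set (val ` corner_boxes L) = pole_values L N + D"
  shows "pf_residue D (val ` corner_boxes L) (val x) = (1 - q3) * (1 - q2) / (1 - inverse q1) * rest_factor L N x"
proof -
  note H = height_bound_add_at[OF L x N]
  let ?r = "row_of x" and ?v = "val x"
  have rN: "?r \<in> rows N" "?r \<in> rows (Suc N)"
    using row_of_in_rows[OF addableD(1)[OF x]] H(2) by auto
  have cr: "corner L ?r = x" by (rule corner_row_of_addable[OF x])
  define B where "B = image_mset (\<lambda>r. val (corner L r)) (mset_set (rows (Suc N) - {?r}))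
     + image_mset (\<lambda>r. inverse q1 * val (corner L r)) (mset_set (rows N))"
  have pB: "pole_values L N = add_mset ?v B"
    unfolding pole_values_def B_def using mset_set.remove[OF finite_rows rN(2)] by (simp add: cr del: val.simps)
  have B: "\<beta> \<noteq> ?v" if b: "\<beta> \<in># B" for \<beta>
  proof -
    have q1n: "q1 \<noteq> 1" using not_root_of_unity[of 1] by simp
    have 1: "inverse q1 * val (corner L r) \<noteq> ?v" if "r \<in> rows N" for r
    proof (cases "r = ?r")
      case True
      then show ?thesis using q1n q_nonzero val_nonzero[of x] by (auto simp: cr field_simps simp del: val.simps)
    next
      case False
      then show ?thesis using addable_row_nonzero(2)[OF L x that] q_nonzero by (auto simp: field_simps simp del: val.simps)
    qed
    have "\<beta> \<in> (\<lambda>r. val (corner L r)) ` (rows (Suc N) - {?r}) \<union> (\<lambda>r. inverse q1 * val (corner L r)) ` rows N"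
      using b unfolding B_def by simp
    then show ?thesis
    proof (elim UnE imageE)
      fix r assume "\<beta> = val (corner L r)" "r \<in> rows (Suc N) - {?r}"
      then show ?thesis using addable_row_nonzero(1)[OF L x, of r "Suc N"] by (simp del: val.simps)
    next
      fix r assume "\<beta> = inverse q1 * val (corner L r)" "r \<in> rows N"
      then show ?thesis using 1[of r] by (simp del: val.simps)
    qed
  qed
  have "pf_residue D (val ` corner_boxes L) ?v = (\<Prod>\<alpha>\<in>#zero_values L N. 1 - \<alpha> / ?v) / (\<Prod>\<beta>\<in>#B. 1 - \<beta> / ?v)"
    by (rule residue_value) (use finite_corner_boxes(3)[OF L] x D B val_nonzero in \<open>auto simp: pB corner_boxes_def simp del: val.simps\<close>)
  also have "(\<Prod>\<beta>\<in>#B. 1 - \<beta> / ?v) = (1 - inverse q1 * ?v / ?v)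
      * ((\<Prod>r'\<in>rows N - {?r}. (1 - val (corner L r') / ?v) * (1 - inverse q1 * val (corner L r') / ?v))
       * (\<Prod>j\<in>{1..n}. 1 - val (corner L (j, Suc N)) / ?v))"
  proof -
    have "rows (Suc N) - {?r} = (rows N - {?r}) \<union> (\<lambda>j. (j, Suc N)) ` {1..n}"
      using rN(1) by (auto simp: rows_def)
    moreover have "(rows N - {?r}) \<inter> (\<lambda>j. (j, Suc N)) ` {1..n} = {}" by (auto simp: rows_def)
    ultimately have "(\<Prod>r'\<in>rows (Suc N) - {?r}. 1 - val (corner L r') / ?v)
        = (\<Prod>r'\<in>rows N - {?r}. 1 - val (corner L r') / ?v) * (\<Prod>j\<in>{1..n}. 1 - val (corner L (j, Suc N)) / ?v)"
      by (simp add: prod.union_disjoint prod.reindex inj_on_def del: val.simps)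
    moreover have "(\<Prod>r'\<in>rows N. 1 - inverse q1 * val (corner L r') / ?v)
        = (1 - inverse q1 * ?v / ?v) * (\<Prod>r'\<in>rows N - {?r}. 1 - inverse q1 * val (corner L r') / ?v)"
      by (subst prod.remove[OF finite_rows rN(1)]) (simp only: cr)
    ultimately show ?thesis
      unfolding B_def
      by (simp add: image_mset.compositionality comp_def prod_unfold_prod_mset[symmetric] prod.distrib mult_ac del: val.simps)
  qed
  finally show ?thesis
    unfolding prod_ratio_split[OF rN(1) val_nonzero[of x]] rest_factor_split[OF refl] cr
    using val_nonzero[of x] by (simp del: val.simps)
qed

lemma residue_removable:
  assumes K: "K \<in> states" and x: "addable (boxes K) x" and L: "L = add_at K x" and N: "height_bound L N"
    and D: "zero_values L N + mset_set (val ` corner_boxes L) = pole_values L N + D"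
  shows "pf_residue D (val ` corner_boxes L) (val x) = (1 - q3 * q1) * (1 - q2 * q1) / (1 - q1) * rest_factor K N x"
proof -
  have Ls: "L \<in> states" and remx: "removable (boxes L) x"
    unfolding L by (rule add_at_state(1)[OF K x], rule remove_add_at(1)[OF K x])
  note H = height_bound_add_at[OF K x N[unfolded L]]
  let ?r = "row_of x" and ?v = "val x"
  have rN: "?r \<in> rows N" "?r \<in> rows (Suc N)"
    using row_of_in_rows[OF addableD(1)[OF x]] H(2) by auto
  have cr: "corner L ?r = nxt1 x" by (simp add: L corner_add_at[OF x])
  have co: "corner L r = corner K r" if "r \<noteq> ?r" for r using that by (simp add: L corner_add_at[OF x])
  have q1n: "q1 \<noteq> 1" using not_root_of_unity[of 1] by simp
  define B where "B = image_mset (\<lambda>r. val (corner L r)) (mset_set (rows (Suc N)))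
     + image_mset (\<lambda>r. inverse q1 * val (corner L r)) (mset_set (rows N - {?r}))"
  have v1: "inverse q1 * val (nxt1 x) = ?v" using q_nonzero by (simp add: val_nxt field_simps)
  have pB: "pole_values L N = add_mset ?v B"
    unfolding pole_values_def B_def using mset_set.remove[OF finite_rows rN(1)] by (simp add: cr v1 del: val.simps)
  have B: "\<beta> \<noteq> ?v" if b: "\<beta> \<in># B" for \<beta>
  proof -
    have 1: "val (corner L r) \<noteq> ?v" if "r \<in> rows (Suc N)" for r
    proof (cases "r = ?r")
      case True
      then show ?thesis using q1n val_nonzero[of x] by (simp add: cr val_nxt del: val.simps)
    next
      case False
      then show ?thesis using addable_row_nonzero(1)[OF K x that] by (simp add: co del: val.simps)
    qed
    have 2: "inverse q1 * val (corner L r) \<noteq> ?v" if "r \<in> rows N - {?r}" for r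
      using addable_row_nonzero(2)[OF K x, of r N] that q_nonzero by (auto simp: field_simps co simp del: val.simps)
    have "\<beta> \<in> (\<lambda>r. val (corner L r)) ` rows (Suc N) \<union> (\<lambda>r. inverse q1 * val (corner L r)) ` (rows N - {?r})"
      using b unfolding B_def by simp
    then show ?thesis
    proof (elim UnE imageE)
      fix r assume "\<beta> = val (corner L r)" "r \<in> rows (Suc N)"
      then show ?thesis using 1[of r] by (simp del: val.simps)
    next
      fix r assume "\<beta> = inverse q1 * val (corner L r)" "r \<in> rows N - {?r}"
      then show ?thesis using 2[of r] by (simp del: val.simps)
    qed
  qed
  have "pf_residue D (val ` corner_boxes L) ?v = (\<Prod>\<alpha>\<in>#zero_values L N. 1 - \<alpha> / ?v) / (\<Prod>\<beta>\<in>#B. 1 - \<beta> / ?v)"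
    by (rule residue_value) (use finite_corner_boxes(3)[OF Ls] remx D B val_nonzero in \<open>auto simp: pB corner_boxes_def simp del: val.simps\<close>)
  also have "(\<Prod>\<beta>\<in>#B. 1 - \<beta> / ?v) = (1 - val (nxt1 x) / ?v)
      * ((\<Prod>r'\<in>rows N - {?r}. (1 - val (corner L r') / ?v) * (1 - inverse q1 * val (corner L r') / ?v))
       * (\<Prod>j\<in>{1..n}. 1 - val (corner L (j, Suc N)) / ?v))"
  proof -
    have "(\<Prod>r'\<in>rows (Suc N). 1 - val (corner L r') / ?v)
        = (1 - val (nxt1 x) / ?v) * ((\<Prod>r'\<in>rows N - {?r}. 1 - val (corner L r') / ?v)
          * (\<Prod>j\<in>{1..n}. 1 - val (corner L (j, Suc N)) / ?v))"
      unfolding prod_rows_Suc by (subst prod.remove[OF finite_rows rN(1)]) (simp only: cr mult.assoc)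
    then show ?thesis
      unfolding B_def
      by (simp add: image_mset.compositionality comp_def prod_unfold_prod_mset[symmetric] prod.distrib mult_ac del: val.simps)
  qed
  finally have fin: "pf_residue D (val ` corner_boxes L) ?v = (\<Prod>\<alpha>\<in>#zero_values L N. 1 - \<alpha> / ?v) / \<dots>" .
  have "rest_factor K N x = rest_factor L N x"
  proof -
    have "corner L (j, Suc N) = corner K (j, Suc N)" for j
    proof (rule co)
      show "(j, Suc N) \<noteq> row_of x" using H(2) by (metis snd_conv not_less_eq_eq order_refl)
    qed
    then show ?thesis unfolding rest_factor_def by (auto simp: co simp del: val.simps intro!: prod.cong)
  qed
  then show ?thesis
    unfolding fin prod_ratio_split[OF rN(1) val_nonzero[of x]] rest_factor_split[where L = L and N = N and x = x, OF refl] cr val_nxt(1)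
    using val_nonzero[of x] by (simp del: val.simps add: mult.assoc[symmetric])
qed

end

context resonance
begin

section \<open>Relations between the amplitudes\<close>

definition e_amp :: "tuple \<Rightarrow> box \<Rightarrow> complex" where
  "e_amp L x = resonant_coeff q1 q3 u a b n (E 0) (add_at L x) L"

definition f_amp :: "tuple \<Rightarrow> box \<Rightarrow> complex" where
  "f_amp L x = resonant_coeff q1 q3 u a b n (F 0) L (add_at L x)"

lemma amp_rows:
  assumes L: "L \<in> states" and x: "addable (boxes L) x" and N: "height_bound (add_at L x) N"
  shows "e_amp L x = e_rows q1 q3 cu N L (val x) (row_of x)"
    and "f_amp L x = f_rows q1 q3 cu n N L (val x) (row_of x)"
  unfolding e_amp_def f_amp_def
  using coeff_values(3)[OF EF_coeff(1)[OF L x N, of 0]] coeff_values(3)[OF EF_coeff(2)[OF L x N, of 0]] by simp_all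

abbreviation g :: "complex \<Rightarrow> complex \<Rightarrow> complex" where "g \<equiv> gcubic q1 q2 q3"

lemma g_eq_0_iff: "g z w = 0 \<longleftrightarrow> z = q1 * w \<or> z = q2 * w \<or> z = q3 * w"
  by (simp add: gcubic_def)

lemma addable_g_nonzero:
  assumes L: "L \<in> states" and x: "addable (boxes L) x" and y: "addable (boxes L) y"
  shows "g (val x) (val y) \<noteq> 0"
  using addable_val_q1[OF states_ideal[OF L] y addable_first_empty[OF x]]
    addable_val_q2[OF states_ideal[OF L] x addable_first_empty[OF y]]
    addable_val_q3[OF states_ideal[OF L] x addable_first_empty[OF y]]
  by (simp add: g_eq_0_iff del: val.simps)

lemma addable_rows_distinct:
  assumes "addable (boxes L) x" "addable (boxes L) y" "x \<noteq> y"
  shows "row_of x \<noteq> row_of y"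
  using corner_row_of_addable assms by metis

text \<open>Adding a box \<open>y\<close> changes the amplitude of \<open>x\<close> only through the factor of the row of \<open>y\<close>.\<close>

lemma row_factor_add:
  assumes L: "L \<in> states" and x: "addable (boxes L) x" and y: "addable (boxes L) y"
  shows "row_factor q1 q3 cu (add_at L y) (val x) (row_of y) * g (val x) (val y)
    = - (row_factor q1 q3 cu L (val x) (row_of y) * g (val y) (val x))"
    and "r \<noteq> row_of y \<Longrightarrow> row_factor q1 q3 cu (add_at L y) v r = row_factor q1 q3 cu L v r"
proof -
  note S = states_ideal[OF L]
  have nz: "1 - q1 * (val y / val x) \<noteq> 0" "1 - inverse q1 * (val y / val x) \<noteq> 0"
    using addable_val_q1[OF S y addable_first_empty[OF x]] addable_val_q1[OF S x addable_first_empty[OF y]]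
      val_nonzero[of x] q_nonzero by (auto simp: field_simps simp del: val.simps)
  have "corner L (row_of y) = y" "corner (add_at L y) (row_of y) = nxt1 y"
    using corner_row_of_addable[OF y] by (simp_all add: corner_add_at[OF y])
  then have "row_factor q1 q3 cu L (val x) (row_of y) = row_ratio q1 q3 (val y / val x)"
    "row_factor q1 q3 cu (add_at L y) (val x) (row_of y) = row_ratio q1 q3 (q1 * (val y / val x))"
    unfolding row_factor_val by (simp_all add: val_nxt del: val.simps)
  then show "row_factor q1 q3 cu (add_at L y) (val x) (row_of y) * g (val x) (val y)
    = - (row_factor q1 q3 cu L (val x) (row_of y) * g (val y) (val x))"
    using row_ratio_step[OF q nz, of "val x"] val_nonzero[of x] by (simp del: val.simps)
  show "row_factor q1 q3 cu (add_at L y) v r = row_factor q1 q3 cu L v r" if "r \<noteq> row_of y"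
    unfolding row_factor_val using that by (simp add: corner_add_at[OF y] del: val.simps)
qed

lemma prod_row_factor_add:
  assumes L: "L \<in> states" and x: "addable (boxes L) x" and y: "addable (boxes L) y" and A: "finite A"
  shows "row_of y \<in> A \<Longrightarrow> (\<Prod>r\<in>A. row_factor q1 q3 cu (add_at L y) (val x) r) * g (val x) (val y)
    = - ((\<Prod>r\<in>A. row_factor q1 q3 cu L (val x) r) * g (val y) (val x))"
    and "row_of y \<notin> A \<Longrightarrow> (\<Prod>r\<in>A. row_factor q1 q3 cu (add_at L y) (val x) r)
      = (\<Prod>r\<in>A. row_factor q1 q3 cu L (val x) r)"
proof -
  have cong: "(\<Prod>r\<in>B. row_factor q1 q3 cu (add_at L y) (val x) r) = (\<Prod>r\<in>B. row_factor q1 q3 cu L (val x) r)"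
    if "row_of y \<notin> B" for B
    by (rule prod.cong[OF refl], rule row_factor_add(2)[OF L x y]) (use that in auto)
  then show "row_of y \<notin> A \<Longrightarrow> (\<Prod>r\<in>A. row_factor q1 q3 cu (add_at L y) (val x) r)
      = (\<Prod>r\<in>A. row_factor q1 q3 cu L (val x) r)" .
  assume yA: "row_of y \<in> A"
  define R where "R = (\<Prod>r\<in>A - {row_of y}. row_factor q1 q3 cu L (val x) r)"
  have "(\<Prod>r\<in>A - {row_of y}. row_factor q1 q3 cu (add_at L y) (val x) r) = R"
    unfolding R_def by (rule cong) simp
  then have "(\<Prod>r\<in>A. row_factor q1 q3 cu (add_at L y) (val x) r) * g (val x) (val y)
      = row_factor q1 q3 cu (add_at L y) (val x) (row_of y) * g (val x) (val y) * R"
    by (simp only: prod.remove[OF A yA] mult_ac)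
  also have "\<dots> = - (row_factor q1 q3 cu L (val x) (row_of y) * g (val y) (val x)) * R"
    unfolding row_factor_add(1)[OF L x y] ..
  also have "\<dots> = - ((\<Prod>r\<in>A. row_factor q1 q3 cu L (val x) r) * g (val y) (val x))"
    by (simp add: prod.remove[OF A yA] R_def mult_ac del: val.simps)
  finally show "(\<Prod>r\<in>A. row_factor q1 q3 cu (add_at L y) (val x) r) * g (val x) (val y)
    = - ((\<Prod>r\<in>A. row_factor q1 q3 cu L (val x) r) * g (val y) (val x))" .
qed

text \<open>The amplitude of \<open>e\<close> for \<open>x\<close> contains the row of \<open>y\<close> if and only if the amplitude of \<open>e\<close> for \<open>y\<close> does
  not contain the row of \<open>x\<close>; for \<open>f\<close> it is the other way round.\<close>

lemma amp_add:
  assumes L: "L \<in> states" and x: "addable (boxes L) x" and y: "addable (boxes L) y" and ne: "x \<noteq> y"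
  obtains "e_amp (add_at L y) x * g (val x) (val y) = - (e_amp L x * g (val y) (val x))"
      "e_amp (add_at L x) y = e_amp L y"
      "f_amp (add_at L x) y * g (val y) (val x) = - (f_amp L y * g (val x) (val y))"
      "f_amp (add_at L y) x = f_amp L x"
  | "e_amp (add_at L x) y * g (val y) (val x) = - (e_amp L y * g (val x) (val y))"
      "e_amp (add_at L y) x = e_amp L x"
      "f_amp (add_at L y) x * g (val x) (val y) = - (f_amp L x * g (val y) (val x))"
      "f_amp (add_at L x) y = f_amp L y"
proof -
  note A = add_at_commute[OF L x y ne]
  note Lx = add_at_state(1)[OF L x] and Ly = add_at_state(1)[OF L y]
  obtain N where N: "height_bound (add_at (add_at L x) y) N"
    using height_bound_exists[OF add_at_state(1)[OF Lx A(2)]] by blast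
  have N': "height_bound (add_at (add_at L y) x) N" using N by (simp add: A(1))
  have Nx: "height_bound (add_at L x) N" and Ny: "height_bound (add_at L y) N"
    using height_bound_add_at(1)[OF Lx A(2) N] height_bound_add_at(1)[OF Ly A(3) N'] by auto
  note ex = amp_rows[OF L x Nx] and ey = amp_rows[OF L y Ny]
    and eyx = amp_rows[OF Lx A(2) N] and exy = amp_rows[OF Ly A(3) N']
  have rx: "row_of x \<in> rows N" and ry: "row_of y \<in> rows N"
    using row_of_in_rows[OF addableD(1)[OF x] height_bound_add_at(2)[OF L x Nx]]
      row_of_in_rows[OF addableD(1)[OF y] height_bound_add_at(2)[OF L y Ny]] by auto
  have rne: "row_of x \<noteq> row_of y" by (rule addable_rows_distinct[OF x y ne])
  have chg: "e_amp (add_at L y) x * g (val x) (val y) = - (e_amp L x * g (val y) (val x))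
      \<and> e_amp (add_at L x) y = e_amp L y
      \<and> f_amp (add_at L x) y * g (val y) (val x) = - (f_amp L y * g (val x) (val y))
      \<and> f_amp (add_at L y) x = f_amp L x"
    if L: "L \<in> states" and x: "addable (boxes L) x" and y: "addable (boxes L) y"
      and ex: "e_amp L x = e_rows q1 q3 cu N L (val x) (row_of x)" "f_amp L x = f_rows q1 q3 cu n N L (val x) (row_of x)"
      and ey: "e_amp L y = e_rows q1 q3 cu N L (val y) (row_of y)" "f_amp L y = f_rows q1 q3 cu n N L (val y) (row_of y)"
      and exy: "e_amp (add_at L y) x = e_rows q1 q3 cu N (add_at L y) (val x) (row_of x)"
        "f_amp (add_at L y) x = f_rows q1 q3 cu n N (add_at L y) (val x) (row_of x)"
      and eyx: "e_amp (add_at L x) y = e_rows q1 q3 cu N (add_at L x) (val y) (row_of y)"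
        "f_amp (add_at L x) y = f_rows q1 q3 cu n N (add_at L x) (val y) (row_of y)"
      and pos: "row_of y \<in> rows_before N (row_of x)" "row_of x \<notin> rows_before N (row_of y)"
        "row_of x \<in> rows_after n N (row_of y)" "row_of y \<notin> rows_after n N (row_of x)" for x y L
    unfolding ex ey exy eyx e_rows_def f_rows_def
    using prod_row_factor_add[OF L x y finite_rows_before_after(1)] prod_row_factor_add[OF L x y finite_rows_before_after(2)]
      prod_row_factor_add[OF L y x finite_rows_before_after(1)] prod_row_factor_add[OF L y x finite_rows_before_after(2)] pos
    by (simp add: mult.assoc del: val.simps)
  have "(row_of y \<in> rows_before N (row_of x) \<and> row_of x \<notin> rows_before N (row_of y) \<and>
      row_of x \<in> rows_after n N (row_of y) \<and> row_of y \<notin> rows_after n N (row_of x))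
    \<or> (row_of x \<in> rows_before N (row_of y) \<and> row_of y \<notin> rows_before N (row_of x) \<and>
      row_of y \<in> rows_after n N (row_of x) \<and> row_of x \<notin> rows_after n N (row_of y))"
    using rx ry rne by (cases "row_of x"; cases "row_of y") (auto simp: rows_before_def rows_after_def rows_def)
  then show ?thesis
  proof
    assume "row_of y \<in> rows_before N (row_of x) \<and> row_of x \<notin> rows_before N (row_of y) \<and>
      row_of x \<in> rows_after n N (row_of y) \<and> row_of y \<notin> rows_after n N (row_of x)"
    then show ?thesis using chg[OF L x y ex ey exy eyx] that(1) by blast
  next
    assume "row_of x \<in> rows_before N (row_of y) \<and> row_of y \<notin> rows_before N (row_of x) \<and>
      row_of y \<in> rows_after n N (row_of x) \<and> row_of x \<notin> rows_after n N (row_of y)"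
    then show ?thesis using chg[OF L y x ey ex eyx exy] that(2) by blast
  qed
qed

lemma ee_exchange:
  assumes L: "L \<in> states" and x: "addable (boxes L) x" and y: "addable (boxes L) y" and ne: "x \<noteq> y"
  shows "e_amp L x * e_amp (add_at L x) y * g (val y) (val x) = - (e_amp L y * e_amp (add_at L y) x * g (val x) (val y))"
  by (rule amp_add[OF assms]) (simp_all only: mult.assoc mult_minus_right mult.left_commute minus_minus mult.commute)

lemma ff_exchange:
  assumes L: "L \<in> states" and x: "addable (boxes L) x" and y: "addable (boxes L) y" and ne: "x \<noteq> y"
  shows "f_amp (add_at L x) y * f_amp L x * g (val y) (val x) = - (f_amp (add_at L y) x * f_amp L y * g (val x) (val y))"
  by (rule amp_add[OF assms]) (simp_all only: mult.assoc mult_minus_right mult.left_commute minus_minus mult.commute)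

text \<open>The factors that \<open>e\<close> and \<open>f\<close> acquire are inverse to each other, and they are neither zero nor infinite
  since no two boxes that are both addable have values related by some \<open>q\<^sub>k\<close>.\<close>

lemma ef_exchange:
  assumes L: "L \<in> states" and x: "addable (boxes L) x" and y: "addable (boxes L) y" and ne: "x \<noteq> y"
  shows "e_amp (add_at L y) x * f_amp (add_at L x) y = e_amp L x * f_amp L y"
proof -
  have nz: "g (val x) (val y) \<noteq> 0" "g (val y) (val x) \<noteq> 0"
    using addable_g_nonzero[OF L] x y by auto
  have *: "p * q = r * s" if "p * G = - (r * H)" "q * H = - (s * G)" "G \<noteq> 0" "H \<noteq> 0" for p q r s G H :: complex
  proof -
    have "(p * q) * (G * H) = (p * G) * (q * H)" by simp
    also have "\<dots> = (r * s) * (G * H)" unfolding that(1,2) by simp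
    finally show ?thesis using that(3,4) by simp
  qed
  show ?thesis
  proof (rule amp_add[OF assms])
    assume "e_amp (add_at L y) x * g (val x) (val y) = - (e_amp L x * g (val y) (val x))"
      "f_amp (add_at L x) y * g (val y) (val x) = - (f_amp L y * g (val x) (val y))"
    then show ?thesis using nz by (rule *)
  qed simp
qed

lemma g_1_1: "g 1 1 = (1 - q1) * (1 - q2) * (1 - q3)"
  by (simp add: gcubic_def)

lemma one_minus_q_nonzero: "1 - q1 \<noteq> 0" "1 - q2 \<noteq> 0" "1 - q3 \<noteq> 0"
  using not_root_of_unity[of 1] by auto

text \<open>The product of the two amplitudes is \<open>rest_factor\<close> up to a constant, and so is the residue of \<open>\<psi>\<close>.  The
  constants agree up to \<open>\<plusminus> 1 / g(1, 1)\<close>, where the sign distinguishes removable from addable boxes; for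
  removable boxes this uses \<open>(1 - q\<^sub>1q\<^sub>2) (1 - q\<^sub>1q\<^sub>3) = q\<^sub>1 (1 - q\<^sub>2) (1 - q\<^sub>3)\<close>.\<close>

lemma ef_diagonal:
  assumes L: "L \<in> states"
  shows "(\<Sum>x | removable (boxes L) x. e_amp (remove_at L x) x * f_amp (remove_at L x) x * val x powi k)
     - (\<Sum>x | addable (boxes L) x. e_amp L x * f_amp L x * val x powi k)
     = 1 / g 1 1 * (psi_series fls_X L $$ k - psi_series fls_X_inv L $$ (- k))"
proof -
  obtain N0 where N0: "height_bound L N0" using height_bound_exists[OF L] by blast
  define N where "N = Suc N0"
  have N: "height_bound L N" unfolding N_def by (rule height_bound_mono[OF N0]) simp
  obtain D where D: "zero_values L N + mset_set (val ` corner_boxes L) = pole_values L N + D"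
    "\<forall>k. psi_series fls_X L $$ k - psi_series fls_X_inv L $$ (- k)
      = (\<Sum>x\<in>corner_boxes L. pf_residue D (val ` corner_boxes L) (val x) * val x powi k)"
    using psi_expansion_difference[OF L N] .
  let ?r = "\<lambda>x. pf_residue D (val ` corner_boxes L) (val x)"
  note nz = one_minus_q_nonzero
  have add: "e_amp L x * f_amp L x = - (1 / g 1 1 * ?r x)" if x: "addable (boxes L) x" for x
  proof -
    have Nx: "height_bound (add_at L x) N" unfolding N_def by (rule height_bound_add[OF L N0 x])
    have e: "1 - inverse q1 = - (1 - q1) / q1" using q_nonzero by (simp add: field_simps)
    have "e_amp L x * f_amp L x = q1 / (1 - q1) ^ 2 * rest_factor L N x"
      unfolding amp_rows[OF L x Nx] by (rule e_times_f[OF L x Nx])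
    also have "\<dots> = - (1 / g 1 1 * ((1 - q3) * (1 - q2) / (1 - inverse q1) * rest_factor L N x))"
      unfolding g_1_1 e using nz q_nonzero by (simp add: power2_eq_square divide_simps) (simp add: algebra_simps)
    finally show ?thesis unfolding residue_addable[OF L Nx x D(1)] .
  qed
  have rem: "e_amp (remove_at L x) x * f_amp (remove_at L x) x = 1 / g 1 1 * ?r x" if x: "removable (boxes L) x" for x
  proof -
    note K = remove_at_state[OF L x]
    have NK: "height_bound (add_at (remove_at L x) x) N" using N K(4) by simp
    have "(1 - q3 * q1) * (1 - q2 * q1) = q1 * (1 - q2) * (1 - q3)"
    proof -
      have "(1 - q3 * q1) * (1 - q2 * q1) = 1 - q1 * q2 - q1 * q3 + q1 * (q1 * q2 * q3)" by (simp add: algebra_simps)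
      also have "\<dots> = q1 * q2 * q3 - q1 * q2 - q1 * q3 + q1" unfolding q by simp
      also have "\<dots> = q1 * (1 - q2) * (1 - q3)" by (simp add: algebra_simps)
      finally show ?thesis .
    qed
    note qe = this
    have "e_amp (remove_at L x) x * f_amp (remove_at L x) x = q1 / (1 - q1) ^ 2 * rest_factor (remove_at L x) N x"
      unfolding amp_rows[OF K(1,3) NK] by (rule e_times_f[OF K(1,3) NK])
    also have "\<dots> = 1 / g 1 1 * ((1 - q3 * q1) * (1 - q2 * q1) / (1 - q1) * rest_factor (remove_at L x) N x)"
      unfolding g_1_1 qe using nz q_nonzero by (simp add: power2_eq_square divide_simps)
    finally show ?thesis unfolding residue_removable[OF K(1,3) K(4)[symmetric] N D(1)] .
  qed
  have dj: "{x. removable (boxes L) x} \<inter> {x. addable (boxes L) x} = {}"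
    by (auto simp: removable_def addable_def)
  have "corner_boxes L = {x. removable (boxes L) x} \<union> {x. addable (boxes L) x}" by (auto simp: corner_boxes_def)
  then have "(\<Sum>x\<in>corner_boxes L. ?r x * val x powi k)
      = (\<Sum>x | removable (boxes L) x. ?r x * val x powi k) + (\<Sum>x | addable (boxes L) x. ?r x * val x powi k)"
    using sum.union_disjoint[OF finite_corner_boxes(2,1)[OF L] dj] by simp
  moreover have "(\<Sum>x | removable (boxes L) x. e_amp (remove_at L x) x * f_amp (remove_at L x) x * val x powi k)
      = 1 / g 1 1 * (\<Sum>x | removable (boxes L) x. ?r x * val x powi k)"
    unfolding sum_distrib_left by (rule sum.cong) (auto simp: rem simp del: val.simps)
  moreover have "(\<Sum>x | addable (boxes L) x. e_amp L x * f_amp L x * val x powi k)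
      = - (1 / g 1 1 * (\<Sum>x | addable (boxes L) x. ?r x * val x powi k))"
    unfolding sum_distrib_left sum_negf[symmetric] by (rule sum.cong) (auto simp: add simp del: val.simps)
  ultimately show ?thesis unfolding D(2)[rule_format] by (simp only: distrib_left diff_minus_eq_add)
qed

end

section \<open>Linear extension and the action of words\<close>

lemma lookup_vscale [simp]: "Poly_Mapping.lookup (vscale c v) k = c * Poly_Mapping.lookup v k"
  by (simp add: vscale_def Poly_Mapping.map.rep_eq when_def)

lemma vscale_simps:
  "vscale c (v + w) = vscale c v + vscale c w" "vscale (c + d) v = vscale c v + vscale d v"
  "vscale c (vscale d v) = vscale (c * d) v" "vscale 1 v = v" "vscale 0 v = 0" "vscale c 0 = 0"
  "vscale c (Poly_Mapping.single L d) = Poly_Mapping.single L (c * d)"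
  "vscale c (v - w) = vscale c v - vscale c w" "vscale (- c) v = - vscale c v"
  by (rule poly_mapping_eqI; simp add: lookup_add algebra_simps lookup_single when_def lookup_minus)+

lemma vscale_sum: "vscale c (\<Sum>x\<in>A. f x) = (\<Sum>x\<in>A. vscale c (f x))"
  by (induction A rule: infinite_finite_induct) (simp_all add: vscale_simps)

lemma vscale_sum_left: "vscale (\<Sum>x\<in>A. f x) v = (\<Sum>x\<in>A. vscale (f x) v)"
  by (induction A rule: infinite_finite_induct) (simp_all add: vscale_simps)

definition lin_ext :: "('b \<Rightarrow> ('b \<Rightarrow>\<^sub>0 complex)) \<Rightarrow> ('b \<Rightarrow>\<^sub>0 complex) \<Rightarrow> ('b \<Rightarrow>\<^sub>0 complex)" where
  "lin_ext \<phi> v = (\<Sum>L\<in>Poly_Mapping.keys v. vscale (Poly_Mapping.lookup v L) (\<phi> L))"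

lemma lin_ext_superset:
  assumes "finite A" "Poly_Mapping.keys v \<subseteq> A"
  shows "lin_ext \<phi> v = (\<Sum>L\<in>A. vscale (Poly_Mapping.lookup v L) (\<phi> L))"
  unfolding lin_ext_def by (rule sum.mono_neutral_left) (use assms in \<open>auto simp: in_keys_iff vscale_simps\<close>)

lemma lin_ext_add: "lin_ext \<phi> (v + w) = lin_ext \<phi> v + lin_ext \<phi> w"
proof -
  define A where "A = Poly_Mapping.keys v \<union> Poly_Mapping.keys w"
  have A: "finite A" "Poly_Mapping.keys v \<subseteq> A" "Poly_Mapping.keys w \<subseteq> A" "Poly_Mapping.keys (v + w) \<subseteq> A"
    using keys_add[of v w] by (auto simp: A_def)
  show ?thesis
    unfolding lin_ext_superset[OF A(1,2)] lin_ext_superset[OF A(1,3)] lin_ext_superset[OF A(1,4)]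
    by (simp add: lookup_add vscale_simps sum.distrib)
qed

lemma lin_ext_vscale: "lin_ext \<phi> (vscale c v) = vscale c (lin_ext \<phi> v)"
proof -
  have "Poly_Mapping.keys (vscale c v) \<subseteq> Poly_Mapping.keys v" by (auto simp: in_keys_iff)
  then show ?thesis
    by (subst lin_ext_superset[of "Poly_Mapping.keys v"]) (auto simp: lin_ext_def vscale_sum vscale_simps)
qed

lemma lin_ext_single: "lin_ext \<phi> (Poly_Mapping.single L c) = vscale c (\<phi> L)"
  by (subst lin_ext_superset[of "{L}"]) auto

lemma lin_ext_0 [simp]: "lin_ext \<phi> 0 = 0"
  by (simp add: lin_ext_def)

lemma lin_ext_sum: "lin_ext \<phi> (\<Sum>x\<in>A. f x) = (\<Sum>x\<in>A. lin_ext \<phi> (f x))"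
  by (induction A rule: infinite_finite_induct) (simp_all add: lin_ext_add)

fun word_act :: "('g \<Rightarrow> 'b \<Rightarrow> ('b \<Rightarrow>\<^sub>0 complex)) \<Rightarrow> 'g list \<Rightarrow> ('b \<Rightarrow>\<^sub>0 complex) \<Rightarrow> ('b \<Rightarrow>\<^sub>0 complex)" where
  "word_act \<phi> [] v = v"
| "word_act \<phi> (x # w) v = lin_ext (\<phi> x) (word_act \<phi> w v)"

lemma word_act_append: "word_act \<phi> (w @ w') v = word_act \<phi> w (word_act \<phi> w' v)"
  by (induction w) simp_all

lemma word_act_linear:
  "word_act \<phi> w (v + v') = word_act \<phi> w v + word_act \<phi> w v'"
  "word_act \<phi> w (vscale c v) = vscale c (word_act \<phi> w v)" "word_act \<phi> w 0 = 0"
  by (induction w) (simp_all add: lin_ext_add lin_ext_vscale)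

definition free_act :: "(generator \<Rightarrow> 'b \<Rightarrow> ('b \<Rightarrow>\<^sub>0 complex)) \<Rightarrow> free_alg \<Rightarrow> ('b \<Rightarrow>\<^sub>0 complex) \<Rightarrow> ('b \<Rightarrow>\<^sub>0 complex)" where
  "free_act \<phi> x v = (\<Sum>w\<in>Poly_Mapping.keys x. vscale (Poly_Mapping.lookup x w) (word_act \<phi> w v))"

context
  fixes \<phi> :: "generator \<Rightarrow> 'b \<Rightarrow> ('b \<Rightarrow>\<^sub>0 complex)"
begin

lemma free_act_superset:
  assumes "finite A" "Poly_Mapping.keys x \<subseteq> A"
  shows "free_act \<phi> x v = (\<Sum>w\<in>A. vscale (Poly_Mapping.lookup x w) (word_act \<phi> w v))"
  unfolding free_act_def by (rule sum.mono_neutral_left) (use assms in \<open>auto simp: in_keys_iff vscale_simps\<close>)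

lemma free_act_add_left: "free_act \<phi> (x + y) v = free_act \<phi> x v + free_act \<phi> y v"
proof -
  define A where "A = Poly_Mapping.keys x \<union> Poly_Mapping.keys y"
  have A: "finite A" "Poly_Mapping.keys x \<subseteq> A" "Poly_Mapping.keys y \<subseteq> A" "Poly_Mapping.keys (x + y) \<subseteq> A"
    using keys_add[of x y] by (auto simp: A_def)
  show ?thesis
    unfolding free_act_superset[OF A(1,2)] free_act_superset[OF A(1,3)] free_act_superset[OF A(1,4)]
    by (simp add: lookup_add vscale_simps sum.distrib)
qed

lemma free_act_0_left [simp]: "free_act \<phi> 0 v = 0"
  by (simp add: free_act_def)

lemma free_act_uminus_left: "free_act \<phi> (- x) v = - free_act \<phi> x v"
  using free_act_add_left[of x "- x" v] by (simp add: eq_neg_iff_add_eq_0 add.commute)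

lemma free_act_diff_left: "free_act \<phi> (x - y) v = free_act \<phi> x v - free_act \<phi> y v"
  using free_act_add_left[of x "- y" v] by (simp add: free_act_uminus_left)

lemma free_act_sum_left: "free_act \<phi> (\<Sum>x\<in>A. f x) v = (\<Sum>x\<in>A. free_act \<phi> (f x) v)"
  by (induction A rule: infinite_finite_induct) (simp_all add: free_act_add_left)

lemma free_act_single: "free_act \<phi> (Poly_Mapping.single w c) v = vscale c (word_act \<phi> w v)"
  by (subst free_act_superset[of "{w}"]) auto

lemma free_act_add: "free_act \<phi> x (v + w) = free_act \<phi> x v + free_act \<phi> x w"
  by (simp add: free_act_def word_act_linear vscale_simps sum.distrib)

lemma free_act_vscale: "free_act \<phi> x (vscale c v) = vscale c (free_act \<phi> x v)"
  by (simp add: free_act_def word_act_linear vscale_simps vscale_sum mult.commute)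

lemma free_act_0 [simp]: "free_act \<phi> x 0 = 0"
  by (simp add: free_act_def word_act_linear vscale_simps)

lemma free_act_sum: "free_act \<phi> x (\<Sum>y\<in>A. f y) = (\<Sum>y\<in>A. free_act \<phi> x (f y))"
  by (induction A rule: infinite_finite_induct) (simp_all add: free_act_add)

lemma free_act_mult: "free_act \<phi> (x * y) v = free_act \<phi> x (free_act \<phi> y v)"
proof -
  let ?s = "\<lambda>x w. Poly_Mapping.single w (Poly_Mapping.lookup x w) :: free_alg"
  have 1: "free_act \<phi> (Poly_Mapping.single w c * Poly_Mapping.single w' c') v
      = free_act \<phi> (Poly_Mapping.single w c) (free_act \<phi> (Poly_Mapping.single w' c') v)" for w w' c c'
    by (simp add: mult_single free_act_single plus_list_def word_act_append word_act_linear vscale_simps)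
  have "free_act \<phi> ((\<Sum>w\<in>Poly_Mapping.keys x. ?s x w) * (\<Sum>w\<in>Poly_Mapping.keys y. ?s y w)) v
      = free_act \<phi> (\<Sum>w\<in>Poly_Mapping.keys x. ?s x w) (free_act \<phi> (\<Sum>w\<in>Poly_Mapping.keys y. ?s y w) v)"
    by (simp add: sum_product free_act_sum_left free_act_sum 1) (rule sum.swap)
  then show ?thesis unfolding poly_mapping_eq_sum_single[symmetric] .
qed

lemma free_act_1 [simp]: "free_act \<phi> 1 v = v"
proof -
  have one: "(1 :: free_alg) = Poly_Mapping.single [] 1" by (simp flip: single_one add: zero_list_def)
  show ?thesis unfolding one free_act_single by (simp add: vscale_simps)
qed

lemma free_act_fconst [simp]: "free_act \<phi> (fconst c) v = vscale c v"
  by (simp add: fconst_def free_act_single)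

lemma free_act_fgen: "free_act \<phi> (fgen x) v = lin_ext (\<phi> x) v"
  by (simp add: fgen_def free_act_single vscale_simps)

text \<open>It suffices to know the action on basis vectors.\<close>

lemma free_act_basis:
  "free_act \<phi> x v = (\<Sum>L\<in>Poly_Mapping.keys v. vscale (Poly_Mapping.lookup v L) (free_act \<phi> x (Poly_Mapping.single L 1)))"
proof -
  have "free_act \<phi> x (\<Sum>L\<in>Poly_Mapping.keys v. Poly_Mapping.single L (Poly_Mapping.lookup v L))
      = (\<Sum>L\<in>Poly_Mapping.keys v. vscale (Poly_Mapping.lookup v L) (free_act \<phi> x (Poly_Mapping.single L 1)))"
    by (simp add: free_act_sum vscale_simps flip: free_act_vscale)
  then show ?thesis unfolding poly_mapping_eq_sum_single[symmetric] .
qed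

end

section \<open>Substituting into polynomials in two variables\<close>

lemma poly_map_poly_hom:
  fixes c :: "'r::comm_ring_1 \<Rightarrow> 's::comm_ring_1"
  assumes c: "c 0 = 0" "\<And>x y. c (x + y) = c x + c y" "\<And>x y. c (x * y) = c x * c y"
  shows "poly (map_poly c (P + Q)) z = poly (map_poly c P) z + poly (map_poly c Q) z"
    and "poly (map_poly c (P * Q)) z = poly (map_poly c P) z * poly (map_poly c Q) z"
proof -
  have add: "map_poly c (P + Q) = map_poly c P + map_poly c Q" for P Q
    by (rule poly_eqI) (simp add: coeff_map_poly c)
  show "poly (map_poly c (P + Q)) z = poly (map_poly c P) z + poly (map_poly c Q) z" by (simp add: add)
  have sm: "map_poly c (smult a Q) = smult (c a) (map_poly c Q)" for a
    by (rule poly_eqI) (simp add: coeff_map_poly c)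
  show "poly (map_poly c (P * Q)) z = poly (map_poly c P) z * poly (map_poly c Q) z"
  proof (induction P)
    case (pCons a P)
    then show ?case
      by (simp add: add sm c map_poly_pCons algebra_simps)
  qed simp
qed

lemma poly_map_poly_sum:
  fixes c :: "'r::zero \<Rightarrow> 's::comm_ring_1"
  assumes "c 0 = 0"
  shows "poly (map_poly c P) z = (\<Sum>m\<le>Polynomial.degree P. c (Polynomial.coeff P m) * z ^ m)"
proof -
  have "poly (map_poly c P) z = (\<Sum>m\<le>Polynomial.degree (map_poly c P). Polynomial.coeff (map_poly c P) m * z ^ m)"
    by (rule poly_altdef)
  also have "\<dots> = (\<Sum>m\<le>Polynomial.degree P. Polynomial.coeff (map_poly c P) m * z ^ m)"
  proof (rule sum.mono_neutral_left)
    have "Polynomial.degree (map_poly c P) \<le> Polynomial.degree P"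
      by (rule degree_le) (simp add: coeff_map_poly coeff_eq_0 assms)
    then show "{..Polynomial.degree (map_poly c P)} \<subseteq> {..Polynomial.degree P}" by simp
  qed (auto intro!: le_degree)
  finally show ?thesis by (simp add: coeff_map_poly assms)
qed

lemma gcubic_substitution:
  fixes c :: "complex poly \<Rightarrow> 's::comm_ring_1"
  assumes c: "c 0 = 0" "c 1 = 1" "\<And>x y. c (x + y) = c x + c y" "\<And>x y. c (x * y) = c x * c y"
  shows "poly (map_poly c (gzw q1 q2 q3)) z = gcubic (c [:q1:]) (c [:q2:]) (c [:q3:]) z (c [:0, 1:])"
    and "poly (map_poly c (gwz q1 q2 q3)) z = gcubic (c [:q1:]) (c [:q2:]) (c [:q3:]) (c [:0, 1:]) z"
proof -
  note hom = poly_map_poly_hom[of c, OF c(1,3,4)]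
  have minus: "poly (map_poly c (P - Q)) z = poly (map_poly c P) z - poly (map_poly c Q) z" for P Q
    using hom(1)[of "P - Q" Q z] by simp
  have const: "poly (map_poly c [:a:]) z = c a" for a by (simp add: map_poly_pCons c)
  have zv: "poly (map_poly c zvar) z = z" by (simp add: zvar_def map_poly_pCons c)
  have wv: "poly (map_poly c wvar) z = c [:0, 1:]" by (simp add: wvar_def map_poly_pCons c)
  show "poly (map_poly c (gzw q1 q2 q3)) z = gcubic (c [:q1:]) (c [:q2:]) (c [:q3:]) z (c [:0, 1:])"
    "poly (map_poly c (gwz q1 q2 q3)) z = gcubic (c [:q1:]) (c [:q2:]) (c [:q3:]) (c [:0, 1:]) z"
    unfolding gzw_def gwz_def gcubic_def hom(2) minus zv wv const by simp_all
qed

text \<open>What \<^const>\<open>series_mult\<close> does to a coefficient function in the outer variable, once the inner variable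
  is replaced by the value of a box.\<close>

definition shift_sum :: "complex poly poly \<Rightarrow> complex \<Rightarrow> (int \<Rightarrow> complex) \<Rightarrow> int \<Rightarrow> complex" where
  "shift_sum P w h i = (\<Sum>m\<le>Polynomial.degree P. poly (Polynomial.coeff P m) w * h (i + int m))"

lemma shift_sum_powi:
  assumes "z \<noteq> 0"
  shows "shift_sum (gzw q1 q2 q3) w (\<lambda>i. z powi i) i = gcubic q1 q2 q3 z w * z powi i"
    and "shift_sum (gwz q1 q2 q3) w (\<lambda>i. z powi i) i = gcubic q1 q2 q3 w z * z powi i"
proof -
  have "shift_sum P w (\<lambda>i. z powi i) i = poly (map_poly (\<lambda>p. poly p w) P) z * z powi i" for P
    using assms by (simp add: shift_sum_def poly_map_poly_sum power_int_add sum_distrib_left mult_ac)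
  then show "shift_sum (gzw q1 q2 q3) w (\<lambda>i. z powi i) i = gcubic q1 q2 q3 z w * z powi i"
    "shift_sum (gwz q1 q2 q3) w (\<lambda>i. z powi i) i = gcubic q1 q2 q3 w z * z powi i"
    by (simp_all add: gcubic_substitution[of "\<lambda>p. poly p w"])
qed

text \<open>For the coefficients of a Laurent series, shifting is multiplication by \<open>z\<close>.\<close>

lemma shift_sum_fls:
  fixes G :: "complex fls"
  shows "shift_sum (gzw q1 q2 q3) w (\<lambda>i. fls_nth G i) i
      = fls_nth (G * gcubic (fls_const q1) (fls_const q2) (fls_const q3) fls_X_inv (fls_const w)) i"
    and "shift_sum (gwz q1 q2 q3) w (\<lambda>i. fls_nth G i) i
      = fls_nth (G * gcubic (fls_const q1) (fls_const q2) (fls_const q3) (fls_const w) fls_X_inv) i"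
    and "shift_sum (gzw q1 q2 q3) w (\<lambda>i. fls_nth G (- i)) i
      = fls_nth (G * gcubic (fls_const q1) (fls_const q2) (fls_const q3) fls_X (fls_const w)) (- i)"
    and "shift_sum (gwz q1 q2 q3) w (\<lambda>i. fls_nth G (- i)) i
      = fls_nth (G * gcubic (fls_const q1) (fls_const q2) (fls_const q3) (fls_const w) fls_X) (- i)"
proof -
  let ?c = "\<lambda>p. fls_const (poly p w)"
  have c: "?c 0 = 0" "?c 1 = 1" "?c (x + y) = ?c x + ?c y" "?c (x * y) = ?c x * ?c y" for x y
    by (simp_all add: fls_plus_const)
  have t: "fls_nth (G * (fls_const d * fls_X_inv ^ m)) j = d * fls_nth G (j + int m)"
    "fls_nth (G * (fls_const d * fls_X ^ m)) j = d * fls_nth G (j - int m)" for d m j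
  proof -
    have eq: "G * (fls_const d * y) = fls_const d * (y * G)" for y by (simp only: mult_ac)
    show "fls_nth (G * (fls_const d * fls_X_inv ^ m)) j = d * fls_nth G (j + int m)"
      "fls_nth (G * (fls_const d * fls_X ^ m)) j = d * fls_nth G (j - int m)"
      unfolding eq by (simp_all add: fls_X_inv_power_times_conv_shift fls_X_power_times_conv_shift)
  qed
  have "shift_sum P w (\<lambda>i. fls_nth G i) i = fls_nth (G * poly (map_poly ?c P) fls_X_inv) i" for P
    unfolding shift_sum_def poly_map_poly_sum[of ?c, OF c(1)] sum_distrib_left fls_nth_sum t ..
  then show "shift_sum (gzw q1 q2 q3) w (\<lambda>i. fls_nth G i) i
      = fls_nth (G * gcubic (fls_const q1) (fls_const q2) (fls_const q3) fls_X_inv (fls_const w)) i"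
    "shift_sum (gwz q1 q2 q3) w (\<lambda>i. fls_nth G i) i
      = fls_nth (G * gcubic (fls_const q1) (fls_const q2) (fls_const q3) (fls_const w) fls_X_inv) i"
    by (simp_all add: gcubic_substitution[of ?c] fls_plus_const)
  have "shift_sum P w (\<lambda>i. fls_nth G (- i)) i = fls_nth (G * poly (map_poly ?c P) fls_X) (- i)" for P
    unfolding shift_sum_def poly_map_poly_sum[of ?c, OF c(1)] sum_distrib_left fls_nth_sum t
    by (simp add: algebra_simps)
  then show "shift_sum (gzw q1 q2 q3) w (\<lambda>i. fls_nth G (- i)) i
      = fls_nth (G * gcubic (fls_const q1) (fls_const q2) (fls_const q3) fls_X (fls_const w)) (- i)"
    "shift_sum (gwz q1 q2 q3) w (\<lambda>i. fls_nth G (- i)) i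
      = fls_nth (G * gcubic (fls_const q1) (fls_const q2) (fls_const q3) (fls_const w) fls_X) (- i)"
    by (simp_all add: gcubic_substitution[of ?c] fls_plus_const)
qed

lemma free_act_series_mult:
  assumes D: "\<And>i j. free_act \<phi> (D i j) v = (\<Sum>t\<in>T. vscale (h t i * w t powi j) (c t))"
    and w: "\<And>t. t \<in> T \<Longrightarrow> w t \<noteq> 0"
  shows "free_act \<phi> (series_mult P D i j) v = (\<Sum>t\<in>T. vscale (shift_sum P (w t) (h t) i * w t powi j) (c t))"
proof -
  have "free_act \<phi> (series_mult P D i j) v = (\<Sum>m\<le>Polynomial.degree P. \<Sum>k\<le>Polynomial.degree (Polynomial.coeff P m).
      \<Sum>t\<in>T. vscale (Polynomial.coeff (Polynomial.coeff P m) k * (h t (i + int m) * w t powi (j + int k))) (c t))"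
    by (simp add: series_mult_def free_act_sum_left free_act_mult D vscale_sum vscale_simps)
  also have "\<dots> = (\<Sum>t\<in>T. \<Sum>m\<le>Polynomial.degree P. \<Sum>k\<le>Polynomial.degree (Polynomial.coeff P m).
      vscale (Polynomial.coeff (Polynomial.coeff P m) k * (h t (i + int m) * w t powi (j + int k))) (c t))"
    by (simp only: sum.swap[of _ _ T])
  also have "\<dots> = (\<Sum>t\<in>T. vscale (shift_sum P (w t) (h t) i * w t powi j) (c t))"
  proof (rule sum.cong[OF refl])
    fix t assume t: "t \<in> T"
    have "(\<Sum>m\<le>Polynomial.degree P. \<Sum>k\<le>Polynomial.degree (Polynomial.coeff P m).
        Polynomial.coeff (Polynomial.coeff P m) k * (h t (i + int m) * w t powi (j + int k)))
      = shift_sum P (w t) (h t) i * w t powi j"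
      using w[OF t] by (simp add: shift_sum_def poly_altdef sum_distrib_right sum_distrib_left power_int_add mult_ac)
    then show "(\<Sum>m\<le>Polynomial.degree P. \<Sum>k\<le>Polynomial.degree (Polynomial.coeff P m).
      vscale (Polynomial.coeff (Polynomial.coeff P m) k * (h t (i + int m) * w t powi (j + int k))) (c t))
      = vscale (shift_sum P (w t) (h t) i * w t powi j) (c t)"
      by (simp flip: vscale_sum_left)
  qed
  finally show ?thesis .
qed

section \<open>The Serre relation for six orders\<close>

text \<open>The structure function for \<open>q\<^sub>1q\<^sub>2q\<^sub>3 = 1\<close>: \<open>\<alpha>\<close> and \<open>\<beta>\<close> are the first two elementary symmetric functions
  of the parameters.  Exchanging them exchanges the arguments up to sign, so that \<open>e\<close> and \<open>f\<close> can be
  treated together.\<close>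

definition cubic :: "'k::comm_ring_1 \<Rightarrow> 'k \<Rightarrow> 'k \<Rightarrow> 'k \<Rightarrow> 'k" where
  "cubic \<alpha> \<beta> z w = z ^ 3 - \<alpha> * (z ^ 2 * w) + \<beta> * (z * w ^ 2) - w ^ 3"

text \<open>The coefficient with which the modes of the nested commutator weigh the order \<open>x, y, z\<close>.\<close>

definition serre_weight :: "complex \<Rightarrow> complex \<Rightarrow> complex \<Rightarrow> complex" where
  "serre_weight x y z = y / x - x / y - z / y + y / z"

lemma serre_expansion:
  fixes S1 S2 S3 A1 A2 A3 wx wy wz :: complex
  assumes w: "wx + wy + wz = 0"
  shows "wy * ((S1 + A1) * (S2 + A2) * (S3 + A3)) - wx * ((S1 - A1) * (S3 + A3) * (S2 + A2))
    + wz * ((S3 + A3) * (S1 - A1) * (S2 - A2)) - wy * ((S3 - A3) * (S2 - A2) * (S1 - A1))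
    + wx * ((S2 - A2) * (S3 - A3) * (S1 + A1)) - wz * ((S2 + A2) * (S1 + A1) * (S3 - A3))
    = - 4 * (wz * A1 * (S2 * S3) - wy * A2 * (S1 * S3) + wx * A3 * (S1 * S2))"
proof -
  have "wy = - wx - wz" using w by (simp add: algebra_simps add_eq_0_iff)
  then show ?thesis by (simp only:) (simp add: algebra_simps)
qed

text \<open>Multiplied by \<open>xyz\<close>, the weight of the order \<open>x, y, z\<close> is \<open>(x + z)(y\<^sup>2 - xz)\<close>: it depends on
  the middle entry only.  Splitting each \<open>g\<close> into its symmetric part and its antisymmetric part, the
  terms of even degree in the antisymmetric parts cancel between an order and its reverse, those of
  degree three because the three weights add up to 0, and those of degree one by a direct computation.\<close>

lemma serre_polynomial_identity:
  fixes x y z \<alpha> \<beta> :: complex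
  assumes "x \<noteq> 0" "y \<noteq> 0" "z \<noteq> 0"
  shows "serre_weight x y z * (cubic \<alpha> \<beta> x y * cubic \<alpha> \<beta> x z * cubic \<alpha> \<beta> y z)
    - serre_weight y x z * (cubic \<alpha> \<beta> y x * cubic \<alpha> \<beta> y z * cubic \<alpha> \<beta> x z)
    + serre_weight y z x * (cubic \<alpha> \<beta> y z * cubic \<alpha> \<beta> y x * cubic \<alpha> \<beta> z x)
    - serre_weight z y x * (cubic \<alpha> \<beta> z y * cubic \<alpha> \<beta> z x * cubic \<alpha> \<beta> y x)
    + serre_weight z x y * (cubic \<alpha> \<beta> z x * cubic \<alpha> \<beta> z y * cubic \<alpha> \<beta> x y)
    - serre_weight x z y * (cubic \<alpha> \<beta> x z * cubic \<alpha> \<beta> x y * cubic \<alpha> \<beta> z y) = 0"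
    (is "?S = 0")
proof -
  define m k where "m = (\<beta> - \<alpha>) / 2" and "k = 1 - (\<alpha> + \<beta>) / 2"
  define S A where "S a b = m * (a * b * (a + b))" and "A a b = (a - b) * (a * a + b * b + k * (a * b))" for a b :: complex
  have c: "cubic \<alpha> \<beta> a b = S a b + A a b" "cubic \<alpha> \<beta> b a = S a b - A a b" for a b
    by (simp_all add: cubic_def S_def A_def m_def k_def power2_eq_square power3_eq_cube field_simps)
  define W where "W a b c = (a + c) * (b * b - a * c)" for a b c :: complex
  have w: "serre_weight a b c * (a * b * c) = W a b c" if "a \<noteq> 0" "b \<noteq> 0" "c \<noteq> 0" for a b c
    using that by (simp add: serre_weight_def W_def field_simps)
  have W: "W c b a = W a b c" for a b c by (simp add: W_def algebra_simps)
  have W0: "W y x z + W x y z + W x z y = 0" by (simp add: W_def algebra_simps)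
  have T: "W x z y * A x y * (S x z * S y z) - W x y z * A x z * (S x y * S y z) + W y x z * A y z * (S x y * S x z) = 0"
  proof -
    let ?c = "m * m * (x * y * z) * ((x + y) * (x + z) * (y + z))"
    have t: "W x z y * A x y * (S x z * S y z) = ?c * ((z * (z * z - x * y)) * A x y)"
      "W x y z * A x z * (S x y * S y z) = ?c * ((y * (y * y - x * z)) * A x z)"
      "W y x z * A y z * (S x y * S x z) = ?c * ((x * (x * x - y * z)) * A y z)"
      unfolding W_def S_def by (simp_all only: mult_ac)
    have "W x z y * A x y * (S x z * S y z) - W x y z * A x z * (S x y * S y z) + W y x z * A y z * (S x y * S x z)
      = ?c * ((z * (z * z - x * y)) * A x y - (y * (y * y - x * z)) * A x z + (x * (x * x - y * z)) * A y z)"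
      unfolding t by (simp only: right_diff_distrib distrib_left)
    also have "(z * (z * z - x * y)) * A x y - (y * (y * y - x * z)) * A x z + (x * (x * x - y * z)) * A y z = 0"
      by (simp add: A_def algebra_simps)
    finally show ?thesis by simp
  qed
  have "?S * (x * y * z) =
     (serre_weight x y z * (x * y * z)) * (cubic \<alpha> \<beta> x y * cubic \<alpha> \<beta> x z * cubic \<alpha> \<beta> y z)
    - (serre_weight y x z * (y * x * z)) * (cubic \<alpha> \<beta> y x * cubic \<alpha> \<beta> y z * cubic \<alpha> \<beta> x z)
    + (serre_weight y z x * (y * z * x)) * (cubic \<alpha> \<beta> y z * cubic \<alpha> \<beta> y x * cubic \<alpha> \<beta> z x)
    - (serre_weight z y x * (z * y * x)) * (cubic \<alpha> \<beta> z y * cubic \<alpha> \<beta> z x * cubic \<alpha> \<beta> y x)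
    + (serre_weight z x y * (z * x * y)) * (cubic \<alpha> \<beta> z x * cubic \<alpha> \<beta> z y * cubic \<alpha> \<beta> x y)
    - (serre_weight x z y * (x * z * y)) * (cubic \<alpha> \<beta> x z * cubic \<alpha> \<beta> x y * cubic \<alpha> \<beta> z y)"
    by (simp only: distrib_right left_diff_distrib) (simp only: mult_ac)
  also have "\<dots> = W x y z * ((S x y + A x y) * (S x z + A x z) * (S y z + A y z))
    - W y x z * ((S x y - A x y) * (S y z + A y z) * (S x z + A x z))
    + W x z y * ((S y z + A y z) * (S x y - A x y) * (S x z - A x z))
    - W x y z * ((S y z - A y z) * (S x z - A x z) * (S x y - A x y))
    + W y x z * ((S x z - A x z) * (S y z - A y z) * (S x y + A x y))
    - W x z y * ((S x z + A x z) * (S x y + A x y) * (S y z - A y z))"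
    unfolding w[OF assms(1,2,3)] w[OF assms(2,1,3)] w[OF assms(2,3,1)] w[OF assms(3,2,1)] w[OF assms(3,1,2)] w[OF assms(1,3,2)]
      c(1)[of x y] c(2)[of y x] c(1)[of x z] c(2)[of z x] c(1)[of y z] c(2)[of z y] W[of x z y] W[of x y z] W[of y x z] ..
  also have "\<dots> = 0" unfolding serre_expansion[OF W0] T by simp
  finally show ?thesis using assms by simp
qed

text \<open>The exchange relations force the six amplitudes to be proportional to the signed products of \<open>g\<close>.
  One may divide by the factors of the order \<open>x, y, z\<close>: two of them are nonzero because this amplitude
  is, and the third one because otherwise the cyclic degeneration would occur.\<close>

lemma serre_six_core:
  fixes x y z :: complex
  assumes nz: "x \<noteq> 0" "y \<noteq> 0" "z \<noteq> 0"
    and e1: "Axyz * cubic \<alpha> \<beta> y x = - (Ayxz * cubic \<alpha> \<beta> x y)"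
    and e2: "Ayzx * cubic \<alpha> \<beta> z y = - (Azyx * cubic \<alpha> \<beta> y z)"
    and e3: "Azxy * cubic \<alpha> \<beta> x z = - (Axzy * cubic \<alpha> \<beta> z x)"
    and e4: "Axyz * cubic \<alpha> \<beta> z y = - (Axzy * cubic \<alpha> \<beta> y z)"
    and e5: "Ayxz * cubic \<alpha> \<beta> z x = - (Ayzx * cubic \<alpha> \<beta> x z)"
    and nd: "cubic \<alpha> \<beta> x y \<noteq> 0 \<or> cubic \<alpha> \<beta> y x \<noteq> 0" "cubic \<alpha> \<beta> y z \<noteq> 0 \<or> cubic \<alpha> \<beta> z y \<noteq> 0"
      "cubic \<alpha> \<beta> x z \<noteq> 0 \<or> cubic \<alpha> \<beta> z x \<noteq> 0"
    and A: "Axyz \<noteq> 0"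
    and nocyc: "\<not> (cubic \<alpha> \<beta> x z = 0 \<and> cubic \<alpha> \<beta> z y = 0 \<and> cubic \<alpha> \<beta> y x = 0)"
  shows "serre_weight x y z * Axyz + serre_weight y x z * Ayxz + serre_weight y z x * Ayzx
    + serre_weight z y x * Azyx + serre_weight z x y * Azxy + serre_weight x z y * Axzy = 0"
proof -
  let ?g = "cubic \<alpha> \<beta>"
  have xy: "?g x y \<noteq> 0" using e1 nd(1) A by auto
  have yz: "?g y z \<noteq> 0" using e4 nd(2) A by auto
  have xz: "?g x z \<noteq> 0"
  proof
    assume 0: "?g x z = 0"
    then have "Ayxz = 0" "Axzy = 0" using e5 e3 nd(3) by auto
    then show False using e1 e4 A nocyc 0 by auto
  qed
  define C where "C = Axyz / (?g x y * ?g x z * ?g y z)"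
  have a1: "Axyz = C * (?g x y * ?g x z * ?g y z)" using xy yz xz by (simp add: C_def)
  have "Ayxz * ?g x y = - (C * (?g y x * ?g y z * ?g x z)) * ?g x y" using e1 unfolding a1 by (simp add: mult_ac minus_equation_iff)
  then have a2: "Ayxz = - (C * (?g y x * ?g y z * ?g x z))" using xy mult_right_cancel by blast
  have "Axzy * ?g y z = - (C * (?g x z * ?g x y * ?g z y)) * ?g y z" using e4 unfolding a1 by (simp add: mult_ac minus_equation_iff)
  then have a3: "Axzy = - (C * (?g x z * ?g x y * ?g z y))" using yz mult_right_cancel by blast
  have "Ayzx * ?g x z = (C * (?g y z * ?g y x * ?g z x)) * ?g x z" using e5[symmetric] unfolding a2 by (simp add: mult_ac)
  then have a4: "Ayzx = C * (?g y z * ?g y x * ?g z x)" using xz mult_right_cancel by blast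
  have "Azxy * ?g x z = (C * (?g z x * ?g z y * ?g x y)) * ?g x z" using e3 unfolding a3 by (simp add: mult_ac)
  then have a5: "Azxy = C * (?g z x * ?g z y * ?g x y)" using xz mult_right_cancel by blast
  have "Azyx * ?g y z = - (C * (?g z y * ?g z x * ?g y x)) * ?g y z" using e2 unfolding a4 by (simp add: mult_ac minus_equation_iff)
  then have a6: "Azyx = - (C * (?g z y * ?g z x * ?g y x))" using yz mult_right_cancel by blast
  have "serre_weight x y z * Axyz + serre_weight y x z * Ayxz + serre_weight y z x * Ayzx
    + serre_weight z y x * Azyx + serre_weight z x y * Azxy + serre_weight x z y * Axzy
    = C * (serre_weight x y z * (?g x y * ?g x z * ?g y z)
    - serre_weight y x z * (?g y x * ?g y z * ?g x z)
    + serre_weight y z x * (?g y z * ?g y x * ?g z x)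
    - serre_weight z y x * (?g z y * ?g z x * ?g y x)
    + serre_weight z x y * (?g z x * ?g z y * ?g x y)
    - serre_weight x z y * (?g x z * ?g x y * ?g z y))"
    unfolding a1 a2 a3 a4 a5 a6 by (simp add: algebra_simps)
  also have "\<dots> = 0" unfolding serre_polynomial_identity[OF nz] by simp
  finally show ?thesis .
qed

section \<open>Quadratic and cubic relations of exchange type\<close>

text \<open>The common features of \<open>e\<close>, which adds boxes, and \<open>f\<close>, which removes them.  If a step becomes
  possible only by the previous one, then its value makes the structure function vanish (\<open>forced\<close>).\<close>

locale exchange_system =
  fixes states :: "'s set" and ok :: "'s \<Rightarrow> 'b \<Rightarrow> bool" and go :: "'s \<Rightarrow> 'b \<Rightarrow> 's"
    and am :: "'s \<Rightarrow> 'b \<Rightarrow> complex" and v :: "'b \<Rightarrow> complex" and \<alpha> \<beta> :: complex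
  assumes go: "L \<in> states \<Longrightarrow> ok L x \<Longrightarrow> go L x \<in> states"
    and finite_ok: "L \<in> states \<Longrightarrow> finite {x. ok L x}"
    and nonzero: "v x \<noteq> 0"
    and diamond: "L \<in> states \<Longrightarrow> ok L x \<Longrightarrow> ok L y \<Longrightarrow> x \<noteq> y \<Longrightarrow> ok (go L x) y \<and> go (go L x) y = go (go L y) x"
    and exchange: "L \<in> states \<Longrightarrow> ok L x \<Longrightarrow> ok L y \<Longrightarrow> x \<noteq> y \<Longrightarrow>
      am L x * am (go L x) y * cubic \<alpha> \<beta> (v y) (v x) = - (am L y * am (go L y) x * cubic \<alpha> \<beta> (v x) (v y))"
    and forced: "L \<in> states \<Longrightarrow> ok L x \<Longrightarrow> ok (go L x) y \<Longrightarrow> \<not> ok L y \<Longrightarrow> cubic \<alpha> \<beta> (v y) (v x) = 0"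
    and once: "L \<in> states \<Longrightarrow> ok L x \<Longrightarrow> \<not> ok (go L x) x"
    and nondegenerate: "cubic \<alpha> \<beta> (v x) (v y) \<noteq> 0 \<or> cubic \<alpha> \<beta> (v y) (v x) \<noteq> 0"
    and no_cycle: "L \<in> states \<Longrightarrow> ok L x \<Longrightarrow> ok (go L x) y \<Longrightarrow> ok (go (go L x) y) z \<Longrightarrow>
      \<not> (cubic \<alpha> \<beta> (v x) (v z) = 0 \<and> cubic \<alpha> \<beta> (v z) (v y) = 0 \<and> cubic \<alpha> \<beta> (v y) (v x) = 0)"
begin

abbreviation G :: "'b \<Rightarrow> 'b \<Rightarrow> complex" where "G x y \<equiv> cubic \<alpha> \<beta> (v x) (v y)"

definition op :: "int \<Rightarrow> 's \<Rightarrow> ('s \<Rightarrow>\<^sub>0 complex)" where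
  "op k L = (\<Sum>x | ok L x. Poly_Mapping.single (go L x) (v x powi k * am L x))"

definition chains2 :: "'s \<Rightarrow> ('b \<times> 'b) set" where
  "chains2 L = {(x, y). ok L x \<and> ok (go L x) y}"

lemma chains2_Sigma: "chains2 L = (SIGMA x:{x. ok L x}. {y. ok (go L x) y})"
  by (auto simp: chains2_def)

lemma finite_chains2: "L \<in> states \<Longrightarrow> finite (chains2 L)"
  unfolding chains2_Sigma by (intro finite_SigmaI finite_ok) (auto intro: go)

definition pair_vector :: "'s \<Rightarrow> 'b \<times> 'b \<Rightarrow> ('s \<Rightarrow>\<^sub>0 complex)" where
  "pair_vector L t = Poly_Mapping.single (go (go L (fst t)) (snd t)) (am L (fst t) * am (go L (fst t)) (snd t))"

lemma op_op:
  assumes L: "L \<in> states"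
  shows "lin_ext (op i) (op j L) = (\<Sum>t\<in>chains2 L. vscale (v (snd t) powi i * v (fst t) powi j) (pair_vector L t))"
proof -
  have "lin_ext (op i) (op j L) = (\<Sum>x | ok L x. \<Sum>y | ok (go L x) y.
      vscale (v y powi i * v x powi j) (pair_vector L (x, y)))"
    unfolding op_def[of j] lin_ext_sum lin_ext_single op_def[of i] vscale_sum
    by (simp add: vscale_simps pair_vector_def mult_ac)
  also have "\<dots> = (\<Sum>t\<in>chains2 L. vscale (v (snd t) powi i * v (fst t) powi j) (pair_vector L t))"
    unfolding chains2_Sigma
    by (subst sum.Sigma) (use finite_ok[OF L] finite_ok[OF go[OF L]] in \<open>auto simp: split_def\<close>)
  finally show ?thesis .
qed

text \<open>Terms with a reversed partner cancel it; in the others the order is forced and \<open>g\<close> vanishes.\<close>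

lemma sum_involution:
  fixes f :: "'t \<Rightarrow> ('s \<Rightarrow>\<^sub>0 complex)"
  assumes T: "finite T" and s: "\<And>t. s (s t) = t"
    and pair: "\<And>t. t \<in> T \<Longrightarrow> s t \<in> T \<Longrightarrow> f (s t) = - f t" and alone: "\<And>t. t \<in> T \<Longrightarrow> s t \<notin> T \<Longrightarrow> f t = 0"
  shows "(\<Sum>t\<in>T. f t) = 0"
proof -
  define T1 where "T1 = {t \<in> T. s t \<in> T}"
  have 1: "(\<Sum>t\<in>T. f t) = (\<Sum>t\<in>T1. f t)"
    by (rule sum.mono_neutral_right) (use T alone in \<open>auto simp: T1_def\<close>)
  have 2: "(\<Sum>t\<in>T1. f t) = (\<Sum>t\<in>T1. f (s t))"
    by (rule sum.reindex_bij_witness[of _ s s]) (auto simp: T1_def s)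
  have 3: "(\<Sum>t\<in>T1. f (s t)) = - (\<Sum>t\<in>T1. f t)"
    unfolding sum_negf[symmetric] by (rule sum.cong) (auto simp: T1_def pair)
  have eq: "(\<Sum>t\<in>T. f t) = - (\<Sum>t\<in>T. f t)" unfolding 1 by (rule trans[OF 2 3])
  show ?thesis
  proof (rule poly_mapping_eqI)
    fix k
    have "(\<Sum>t\<in>T. f t) + (\<Sum>t\<in>T. f t) = 0" by (rule eq_neg_iff_add_eq_0[THEN iffD1, OF eq])
    then have "Poly_Mapping.lookup ((\<Sum>t\<in>T. f t) + (\<Sum>t\<in>T. f t)) k = 0" by (simp only: lookup_zero)
    then have "Poly_Mapping.lookup (\<Sum>t\<in>T. f t) k + Poly_Mapping.lookup (\<Sum>t\<in>T. f t) k = 0"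
      unfolding lookup_add .
    then show "Poly_Mapping.lookup (\<Sum>t\<in>T. f t) k = Poly_Mapping.lookup 0 k"
      by (simp flip: mult_2)
  qed
qed

lemma quadratic_relation:
  assumes L: "L \<in> states"
  shows "(\<Sum>t\<in>chains2 L. vscale (G (snd t) (fst t) * (v (snd t) powi i * v (fst t) powi j)) (pair_vector L t))
    + (\<Sum>t\<in>chains2 L. vscale (G (snd t) (fst t) * (v (fst t) powi i * v (snd t) powi j)) (pair_vector L t)) = 0"
proof -
  let ?c = "\<lambda>t. v (snd t) powi i * v (fst t) powi j + v (fst t) powi i * v (snd t) powi j"
  let ?s = "\<lambda>t. (snd t, fst t)"
  have "(\<Sum>t\<in>chains2 L. vscale (G (snd t) (fst t) * ?c t) (pair_vector L t)) = 0"
  proof (rule sum_involution[OF finite_chains2[OF L], of ?s])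
    fix t assume t: "t \<in> chains2 L" "?s t \<in> chains2 L"
    obtain x y where xy: "t = (x, y)" by (cases t)
    have ok: "ok L x" "ok L y" using t by (auto simp: xy chains2_def)
    have ne: "x \<noteq> y" using t once[OF L] by (auto simp: xy chains2_def)
    have e: "am L y * am (go L y) x * G x y = - (am L x * am (go L x) y * G y x)"
      using exchange[OF L ok ne] by simp
    have "G x y * ?c (y, x) * (am L y * am (go L y) x) = ?c (x, y) * (am L y * am (go L y) x * G x y)"
      by (simp add: add.commute)
    also have "\<dots> = - (G y x * ?c (x, y) * (am L x * am (go L x) y))"
      unfolding e by simp
    finally show "vscale (G (snd (?s t)) (fst (?s t)) * ?c (?s t)) (pair_vector L (?s t))
        = - vscale (G (snd t) (fst t) * ?c t) (pair_vector L t)"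
      using diamond[OF L ok ne] by (simp add: xy pair_vector_def vscale_simps single_uminus[symmetric])
  next
    fix t assume t: "t \<in> chains2 L" "?s t \<notin> chains2 L"
    obtain x y where xy: "t = (x, y)" by (cases t)
    have ok: "ok L x" "ok (go L x) y" using t by (auto simp: xy chains2_def)
    have ne: "x \<noteq> y" using ok once[OF L] by auto
    have "\<not> ok L y" using t diamond[OF L _ ok(1)] ne by (auto simp: xy chains2_def)
    then have "G y x = 0" by (rule forced[OF L ok])
    then show "vscale (G (snd t) (fst t) * ?c t) (pair_vector L t) = 0"
      by (simp add: xy vscale_simps)
  qed simp
  then show ?thesis by (simp add: distrib_left vscale_simps sum.distrib)
qed

definition two_step :: "'s \<Rightarrow> 'b \<Rightarrow> 'b \<Rightarrow> ('s \<Rightarrow> complex) \<Rightarrow> complex" where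
  "two_step L x y \<Phi> = (if ok L x \<and> ok (go L x) y then am L x * am (go L x) y * \<Phi> (go (go L x) y) else 0)"

text \<open>Amplitudes of impossible steps count as 0.  With this convention the exchange relation needs no side
  condition.\<close>

lemma two_step_exchange:
  assumes L: "L \<in> states"
  shows "two_step L x y \<Phi> * G y x = - (two_step L y x \<Phi> * G x y)"
proof (cases "x = y")
  case True
  then show ?thesis using once[OF L] by (auto simp: two_step_def)
next
  case ne: False
  show ?thesis
  proof (cases "ok L x \<and> ok L y")
    case True
    then have ok: "ok L x" "ok L y" by auto
    note d = diamond[OF L ok ne] diamond[OF L ok(2,1) ne[symmetric]]
    have "two_step L x y \<Phi> * G y x = (am L x * am (go L x) y * G y x) * \<Phi> (go (go L x) y)"
      using ok d by (simp add: two_step_def)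
    also have "\<dots> = - (am L y * am (go L y) x * G x y) * \<Phi> (go (go L y) x)"
      unfolding exchange[OF L ok ne] using d by simp
    also have "\<dots> = - (two_step L y x \<Phi> * G x y)"
      using ok d by (simp add: two_step_def)
    finally show ?thesis .
  next
    case False
    have 1: "two_step L x y \<Phi> * G y x = 0" if "\<not> (ok L x \<and> ok L y)" for x y
      using that forced[OF L, of x y] by (auto simp: two_step_def)
    show ?thesis using 1[of x y] 1[of y x] False by auto
  qed
qed

definition three_step :: "'s \<Rightarrow> 's \<Rightarrow> 'b \<Rightarrow> 'b \<Rightarrow> 'b \<Rightarrow> complex" where
  "three_step N L x y z = two_step L x y (\<lambda>M. if ok M z \<and> go M z = N then am M z else 0)"

lemma three_step_later:
  "three_step N L x y z = (if ok L x then am L x * two_step (go L x) y z (\<lambda>M. if M = N then 1 else 0) else 0)"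
  by (auto simp: three_step_def two_step_def)

lemma three_step_exchange:
  assumes L: "L \<in> states"
  shows "three_step N L x y z * G y x = - (three_step N L y x z * G x y)"
    and "three_step N L x y z * G z y = - (three_step N L x z y * G y z)"
proof -
  show "three_step N L x y z * G y x = - (three_step N L y x z * G x y)"
    unfolding three_step_def by (rule two_step_exchange[OF L])
  show "three_step N L x y z * G z y = - (three_step N L x z y * G y z)"
    unfolding three_step_later using two_step_exchange[OF go[OF L], of x y z]
    by (auto simp: mult.assoc)
qed

lemma three_step_no_cycle:
  assumes L: "L \<in> states" and "three_step N L x y z \<noteq> 0"
  shows "\<not> (G x z = 0 \<and> G z y = 0 \<and> G y x = 0)"
proof -
  have "ok L x" "ok (go L x) y" "ok (go (go L x) y) z"
    using assms(2) by (auto simp: three_step_def two_step_def split: if_splits)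
  then show ?thesis by (rule no_cycle[OF L])
qed

lemma serre_six:
  assumes L: "L \<in> states"
  shows "serre_weight (v x) (v y) (v z) * three_step N L x y z + serre_weight (v y) (v x) (v z) * three_step N L y x z
    + serre_weight (v y) (v z) (v x) * three_step N L y z x + serre_weight (v z) (v y) (v x) * three_step N L z y x
    + serre_weight (v z) (v x) (v y) * three_step N L z x y + serre_weight (v x) (v z) (v y) * three_step N L x z y = 0"
proof -
  have core: "serre_weight (v x) (v y) (v z) * three_step N L x y z + serre_weight (v y) (v x) (v z) * three_step N L y x z
    + serre_weight (v y) (v z) (v x) * three_step N L y z x + serre_weight (v z) (v y) (v x) * three_step N L z y x
    + serre_weight (v z) (v x) (v y) * three_step N L z x y + serre_weight (v x) (v z) (v y) * three_step N L x z y = 0"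
    if "three_step N L x y z \<noteq> 0" for x y z
    by (rule serre_six_core[OF nonzero nonzero nonzero three_step_exchange(1)[OF L] three_step_exchange(1)[OF L]
          three_step_exchange(1)[OF L] three_step_exchange(2)[OF L] three_step_exchange(2)[OF L]
          nondegenerate nondegenerate nondegenerate that three_step_no_cycle[OF L that]])
  show ?thesis
  proof (cases "three_step N L x y z = 0 \<and> three_step N L y x z = 0 \<and> three_step N L y z x = 0
      \<and> three_step N L z y x = 0 \<and> three_step N L z x y = 0 \<and> three_step N L x z y = 0")
    case True
    then show ?thesis by simp
  next
    case False
    then consider "three_step N L x y z \<noteq> 0" | "three_step N L y x z \<noteq> 0" | "three_step N L y z x \<noteq> 0"
      | "three_step N L z y x \<noteq> 0" | "three_step N L z x y \<noteq> 0" | "three_step N L x z y \<noteq> 0" by blast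
    then show ?thesis
      by cases (drule core, simp only: add_ac)+
  qed
qed

text \<open>The six permuted sums are all equal.\<close>

lemma sum_symmetrize:
  fixes f :: "'b \<Rightarrow> 'b \<Rightarrow> 'b \<Rightarrow> complex"
  assumes "\<And>x y z. f x y z + f y x z + f y z x + f z y x + f z x y + f x z y = 0"
  shows "(\<Sum>x\<in>B. \<Sum>y\<in>B. \<Sum>z\<in>B. f x y z) = 0"
proof -
  define S where "S = (\<Sum>x\<in>B. \<Sum>y\<in>B. \<Sum>z\<in>B. f x y z)"
  have a: "(\<Sum>x\<in>B. \<Sum>y\<in>B. \<Sum>z\<in>B. h y x z) = (\<Sum>x\<in>B. \<Sum>y\<in>B. \<Sum>z\<in>B. h x y z)"
    for h :: "'b \<Rightarrow> 'b \<Rightarrow> 'b \<Rightarrow> complex" by (rule sum.swap)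
  have b: "(\<Sum>x\<in>B. \<Sum>y\<in>B. \<Sum>z\<in>B. h x z y) = (\<Sum>x\<in>B. \<Sum>y\<in>B. \<Sum>z\<in>B. h x y z)"
    for h :: "'b \<Rightarrow> 'b \<Rightarrow> 'b \<Rightarrow> complex" by (rule sum.cong[OF refl], rule sum.swap)
  have p1: "(\<Sum>x\<in>B. \<Sum>y\<in>B. \<Sum>z\<in>B. f y x z) = S" unfolding S_def by (rule a)
  have p2: "(\<Sum>x\<in>B. \<Sum>y\<in>B. \<Sum>z\<in>B. f x z y) = S" unfolding S_def by (rule b)
  have p3: "(\<Sum>x\<in>B. \<Sum>y\<in>B. \<Sum>z\<in>B. f y z x) = S" using a[of "\<lambda>x y z. f x z y"] p2 by simp
  have p4: "(\<Sum>x\<in>B. \<Sum>y\<in>B. \<Sum>z\<in>B. f z x y) = S" using b[of "\<lambda>x y z. f y x z"] p1 by simp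
  have p5: "(\<Sum>x\<in>B. \<Sum>y\<in>B. \<Sum>z\<in>B. f z y x) = S" using a[of "\<lambda>x y z. f z x y"] p4 by simp
  have "0 = (\<Sum>x\<in>B. \<Sum>y\<in>B. \<Sum>z\<in>B. f x y z + f y x z + f y z x + f z y x + f z x y + f x z y)"
    using assms by simp
  also have "\<dots> = S + S + S + S + S + S"
    by (simp only: sum.distrib p1 p2 p3 p4 p5 S_def[symmetric])
  finally show ?thesis unfolding S_def[symmetric] by simp
qed

lemma op_op_op_lookup:
  assumes L: "L \<in> states"
  obtains B where "\<And>i j k. Poly_Mapping.lookup (lin_ext (op i) (lin_ext (op j) (op k L))) N
    = (\<Sum>x\<in>B. \<Sum>y\<in>B. \<Sum>z\<in>B. v x powi k * v y powi j * v z powi i * three_step N L x y z)"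
proof -
  define X where "X = {x. ok L x}"
  define Y where "Y x = {y. ok (go L x) y}" for x
  define Z where "Z x y = {z. ok (go (go L x) y) z}" for x y
  define B where "B = X \<union> (\<Union>x\<in>X. Y x) \<union> (\<Union>x\<in>X. \<Union>y\<in>Y x. Z x y)"
  have gx: "go L x \<in> states" if "x \<in> X" for x using go[OF L] that by (simp add: X_def)
  have gxy: "go (go L x) y \<in> states" if "x \<in> X" "y \<in> Y x" for x y using go[OF gx] that by (simp add: Y_def)
  have fX: "finite X" unfolding X_def by (rule finite_ok[OF L])
  have fY: "finite (Y x)" if "x \<in> X" for x unfolding Y_def by (rule finite_ok[OF gx[OF that]])
  have fZ: "finite (Z x y)" if "x \<in> X" "y \<in> Y x" for x y unfolding Z_def by (rule finite_ok[OF gxy[OF that]])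
  have fB: "finite B" using fX fY fZ by (auto simp: B_def)
  have "Poly_Mapping.lookup (lin_ext (op i) (lin_ext (op j) (op k L))) N
    = (\<Sum>x\<in>B. \<Sum>y\<in>B. \<Sum>z\<in>B. v x powi k * v y powi j * v z powi i * three_step N L x y z)" for i j k
  proof -
    let ?f = "\<lambda>x y z. v x powi k * v y powi j * v z powi i * three_step N L x y z"
    have "lin_ext (op i) (lin_ext (op j) (op k L)) = (\<Sum>x\<in>X. \<Sum>y\<in>Y x. \<Sum>z\<in>Z x y.
        Poly_Mapping.single (go (go (go L x) y) z)
          (v x powi k * v y powi j * v z powi i * (am L x * am (go L x) y * am (go (go L x) y) z)))"
      unfolding op_def lin_ext_sum lin_ext_single vscale_sum lin_ext_vscale X_def Y_def Z_def
      by (simp add: vscale_simps mult_ac)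
    then have "Poly_Mapping.lookup (lin_ext (op i) (lin_ext (op j) (op k L))) N
        = (\<Sum>x\<in>X. \<Sum>y\<in>Y x. \<Sum>z\<in>Z x y. if go (go (go L x) y) z = N
            then v x powi k * v y powi j * v z powi i * (am L x * am (go L x) y * am (go (go L x) y) z) else 0)"
      by (simp only: lookup_sum lookup_single when_def)
    also have "\<dots> = (\<Sum>x\<in>X. \<Sum>y\<in>Y x. \<Sum>z\<in>Z x y. ?f x y z)"
      by (intro sum.cong refl) (auto simp: X_def Y_def Z_def three_step_def two_step_def)
    also have "\<dots> = (\<Sum>x\<in>X. \<Sum>y\<in>Y x. \<Sum>z\<in>B. ?f x y z)"
    proof (rule sum.cong[OF refl], rule sum.cong[OF refl], rule sum.mono_neutral_left[OF fB])
      fix x y assume xy: "x \<in> X" "y \<in> Y x"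
      show "Z x y \<subseteq> B" using xy by (auto simp: B_def)
      show "\<forall>z\<in>B - Z x y. ?f x y z = 0" by (auto simp: Z_def three_step_def two_step_def)
    qed
    also have "\<dots> = (\<Sum>x\<in>X. \<Sum>y\<in>B. \<Sum>z\<in>B. ?f x y z)"
    proof (rule sum.cong[OF refl], rule sum.mono_neutral_left[OF fB])
      fix x assume x: "x \<in> X"
      show "Y x \<subseteq> B" using x by (auto simp: B_def)
      show "\<forall>y\<in>B - Y x. (\<Sum>z\<in>B. ?f x y z) = 0" by (auto simp: Y_def three_step_def two_step_def)
    qed
    also have "\<dots> = (\<Sum>x\<in>B. \<Sum>y\<in>B. \<Sum>z\<in>B. ?f x y z)"
    proof (rule sum.mono_neutral_left[OF fB])
      show "X \<subseteq> B" by (auto simp: B_def)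
      show "\<forall>x\<in>B - X. (\<Sum>y\<in>B. \<Sum>z\<in>B. ?f x y z) = 0" by (auto simp: X_def three_step_def two_step_def)
    qed
    finally show ?thesis .
  qed
  then show ?thesis by (rule that)
qed

lemma serre_relation:
  assumes L: "L \<in> states"
  shows "lin_ext (op 0) (lin_ext (op 1) (op (-1) L)) - lin_ext (op 0) (lin_ext (op (-1)) (op 1 L))
    - (lin_ext (op 1) (lin_ext (op (-1)) (op 0 L)) - lin_ext (op (-1)) (lin_ext (op 1) (op 0 L))) = 0"
proof (rule poly_mapping_eqI)
  fix N
  obtain B where B: "\<And>i j k. Poly_Mapping.lookup (lin_ext (op i) (lin_ext (op j) (op k L))) N
    = (\<Sum>x\<in>B. \<Sum>y\<in>B. \<Sum>z\<in>B. v x powi k * v y powi j * v z powi i * three_step N L x y z)"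
    using op_op_op_lookup[OF L] by blast
  have w: "v x powi (-1) * v y powi 1 * v z powi 0 * c - v x powi 1 * v y powi (-1) * v z powi 0 * c
      - (v x powi 0 * v y powi (-1) * v z powi 1 * c - v x powi 0 * v y powi 1 * v z powi (-1) * c)
      = serre_weight (v x) (v y) (v z) * c" for x y z c
    using nonzero by (simp add: serre_weight_def power_int_minus field_simps)
  have "(\<Sum>x\<in>B. \<Sum>y\<in>B. \<Sum>z\<in>B. serre_weight (v x) (v y) (v z) * three_step N L x y z) = 0"
    by (rule sum_symmetrize) (rule serre_six[OF L])
  then show "Poly_Mapping.lookup (lin_ext (op 0) (lin_ext (op 1) (op (-1) L)) - lin_ext (op 0) (lin_ext (op (-1)) (op 1 L))
    - (lin_ext (op 1) (lin_ext (op (-1)) (op 0 L)) - lin_ext (op (-1)) (lin_ext (op 1) (op 0 L)))) N = Poly_Mapping.lookup 0 N"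
    by (simp only: lookup_minus B sum_subtractf[symmetric] w lookup_zero)
qed

end

context resonance
begin

section \<open>The two exchange systems\<close>

abbreviation sg1 :: complex where "sg1 \<equiv> q1 + q2 + q3"
abbreviation sg2 :: complex where "sg2 \<equiv> q1 * q2 + q1 * q3 + q2 * q3"

lemma g_cubic: "g z w = cubic sg1 sg2 z w" "g w z = - cubic sg2 sg1 z w"
proof -
  have 1: "g z w = cubic sg1 sg2 z w" for z w
  proof -
    have "g z w = z ^ 3 - sg1 * (z ^ 2 * w) + sg2 * (z * w ^ 2) - (q1 * q2 * q3) * w ^ 3"
      by (simp add: gcubic_def algebra_simps power2_eq_square power3_eq_cube)
    then show ?thesis unfolding q cubic_def by simp
  qed
  then show "g z w = cubic sg1 sg2 z w" .
  show "g w z = - cubic sg2 sg1 z w" unfolding 1 by (simp add: cubic_def algebra_simps)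
qed

lemma q_product_nonunit: "q1 * q1 \<noteq> 1" "q2 * q2 \<noteq> 1" "q3 * q3 \<noteq> 1" "q1 * q2 \<noteq> 1" "q1 * q3 \<noteq> 1" "q2 * q3 \<noteq> 1"
proof -
  show "q1 * q1 \<noteq> 1" "q2 * q2 \<noteq> 1" "q3 * q3 \<noteq> 1"
    using not_root_of_unity[of 2] by (simp_all add: power2_eq_square)
  have "q1 \<noteq> 1" "q2 \<noteq> 1" "q3 \<noteq> 1" using one_minus_q_nonzero by auto
  moreover have "(q1 * q2) * q3 = 1" "(q1 * q3) * q2 = 1" "(q2 * q3) * q1 = 1" using q by (simp_all only: mult_ac)
  ultimately show "q1 * q2 \<noteq> 1" "q1 * q3 \<noteq> 1" "q2 * q3 \<noteq> 1" by auto
qed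

lemma g_nondegenerate:
  assumes "z \<noteq> 0"
  shows "g z w \<noteq> 0 \<or> g w z \<noteq> 0"
proof (rule ccontr)
  assume "\<not> ?thesis"
  then have "z = q1 * w \<or> z = q2 * w \<or> z = q3 * w" "w = q1 * z \<or> w = q2 * z \<or> w = q3 * z"
    by (auto simp: g_eq_0_iff)
  moreover have "\<not> (z = a * w \<and> w = b * z)" if "a * b \<noteq> 1" for a b
  proof
    assume e: "z = a * w \<and> w = b * z"
    then have "1 * z = (a * b) * z" by (metis mult.assoc mult_1)
    then show False using that assms by (simp only: mult_cancel_right) auto
  qed
  ultimately show False using q_product_nonunit by (metis mult.commute)
qed

lemma q_triple_nonunit:
  "q1 * (q1 * q1) \<noteq> 1" "q2 * (q1 * q1) \<noteq> 1" "q3 * (q1 * q1) \<noteq> 1"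
  "q1 * (q2 * q2) \<noteq> 1" "q2 * (q2 * q2) \<noteq> 1" "q3 * (q2 * q2) \<noteq> 1"
  "q1 * (q3 * q3) \<noteq> 1" "q2 * (q3 * q3) \<noteq> 1" "q3 * (q3 * q3) \<noteq> 1"
proof -
  show "q1 * (q1 * q1) \<noteq> 1" "q2 * (q2 * q2) \<noteq> 1" "q3 * (q3 * q3) \<noteq> 1"
    using not_root_of_unity[of 3] by (simp_all add: power3_eq_cube mult.assoc)
  have c: "x * (y * y) \<noteq> 1" if "x * y * z = 1" "y \<noteq> z" for x y z :: complex
  proof
    assume "x * (y * y) = 1"
    then have "(x * y) * y = (x * y) * z" using that(1) by (simp add: mult.assoc)
    moreover have "x * y \<noteq> 0" using that(1) by auto
    ultimately show False using that(2) by simp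
  qed
  show "q2 * (q1 * q1) \<noteq> 1" by (rule c[of _ _ q3]) (use q q_distinct in \<open>simp_all add: mult_ac\<close>)
  show "q3 * (q1 * q1) \<noteq> 1" by (rule c[of _ _ q2]) (use q q_distinct in \<open>simp_all add: mult_ac\<close>)
  show "q1 * (q2 * q2) \<noteq> 1" by (rule c[of _ _ q3]) (use q q_distinct in \<open>simp_all add: mult_ac\<close>)
  show "q3 * (q2 * q2) \<noteq> 1" by (rule c[of _ _ q1]) (use q q_distinct in \<open>simp_all add: mult_ac\<close>)
  show "q1 * (q3 * q3) \<noteq> 1" by (rule c[of _ _ q2]) (use q q_distinct in \<open>simp_all add: mult_ac\<close>)
  show "q2 * (q3 * q3) \<noteq> 1" by (rule c[of _ _ q1]) (use q q_distinct in \<open>simp_all add: mult_ac\<close>)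
qed

text \<open>In a cyclic degeneration the three boxes would form a chain in which each step is forced by
  the previous one.  Two steps in different directions are impossible, since the fourth corner of
  the square would already have to be present; two equal steps multiply the value by \<open>q\<^sub>k\<^sup>2\<close>, and no
  \<open>q\<^sub>j q\<^sub>k\<^sup>2\<close> is 1.\<close>

lemma no_cycle_e:
  assumes L: "L \<in> states" and x: "addable (boxes L) x" and y: "addable (boxes (add_at L x)) y"
    and z: "addable (boxes (add_at (add_at L x) y)) z"
  shows "\<not> (g (val x) (val z) = 0 \<and> g (val z) (val y) = 0 \<and> g (val y) (val x) = 0)"
proof
  assume 0: "g (val x) (val z) = 0 \<and> g (val z) (val y) = 0 \<and> g (val y) (val x) = 0"
  note Lx = add_at_state[OF L x]
  note Lxy = add_at_state[OF Lx(1) y]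
  note S = states_ideal[OF L] and xB = addableD(1)[OF x]
  have "\<not> addable (boxes L) y" using addable_g_nonzero[OF L _ x] 0 by blast
  then have ys: "y = nxt1 x \<or> y = nxt2 x \<or> y = nxt3 x" using addable_after y unfolding Lx(2) by blast
  have "\<not> addable (boxes (add_at L x)) z" using addable_g_nonzero[OF Lx(1) _ y] 0 by blast
  then have zs: "z = nxt1 y \<or> z = nxt2 y \<or> z = nxt3 y" using addable_after z unfolding Lxy(2) by blast
  have sq: False if d: "d = nxt1 x \<or> d = nxt2 x \<or> d = nxt3 x" "d \<noteq> y" "nxt1 d = z \<or> nxt2 d = z \<or> nxt3 d = z" for d
  proof -
    have dB: "d \<in> Box" using d(1) xB by auto
    have "d \<in> boxes (add_at (add_at L x) y)"
      using addableD(3,4,5)[OF z dB] d(3) by auto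
    moreover have "d \<noteq> x" using d(1) nxt_distinct[OF xB] by metis
    ultimately have "d \<in> boxes L" using d(2) unfolding Lxy(2) Lx(2) by simp
    then have "x \<in> boxes L" using ideal_setD(1,2,3)[OF S xB] d(1) by auto
    then show False using addableD(2)[OF x] by simp
  qed
  note dist = nxt_distinct[OF xB] nxt_distinct(1,2,3)[OF xB, symmetric]
  have "(y = nxt1 x \<and> z = nxt1 y) \<or> (y = nxt2 x \<and> z = nxt2 y) \<or> (y = nxt3 x \<and> z = nxt3 y)"
    using ys zs
  proof (elim disjE)
    assume "y = nxt1 x" "z = nxt2 y" then show ?thesis using sq[of "nxt2 x"] dist by (simp add: nxt_commute)
  next
    assume "y = nxt1 x" "z = nxt3 y" then show ?thesis using sq[of "nxt3 x"] dist by (simp add: nxt_commute)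
  next
    assume "y = nxt2 x" "z = nxt1 y" then show ?thesis using sq[of "nxt1 x"] dist by (simp add: nxt_commute)
  next
    assume "y = nxt2 x" "z = nxt3 y" then show ?thesis using sq[of "nxt3 x"] dist by (simp add: nxt_commute)
  next
    assume "y = nxt3 x" "z = nxt1 y" then show ?thesis using sq[of "nxt1 x"] dist by (simp add: nxt_commute)
  next
    assume "y = nxt3 x" "z = nxt2 y" then show ?thesis using sq[of "nxt2 x"] dist by (simp add: nxt_commute)
  qed auto
  then have "val z = q1 * q1 * val x \<or> val z = q2 * q2 * val x \<or> val z = q3 * q3 * val x"
    using xB by (auto simp: val_nxt mult.assoc simp del: val.simps)
  moreover have "val x = q1 * val z \<or> val x = q2 * val z \<or> val x = q3 * val z" using 0 by (simp only: g_eq_0_iff)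
  moreover have "\<not> (val z = c * val x \<and> val x = d * val z)" if "d * c \<noteq> 1" for c d
  proof
    assume "val z = c * val x \<and> val x = d * val z"
    then have "1 * val x = (d * c) * val x" by (metis mult.assoc mult_1)
    then show False using that val_nonzero[of x] by (simp only: mult_cancel_right) auto
  qed
  ultimately show False using q_triple_nonunit by metis
qed

lemma nxt_val_g: "x \<in> Box \<Longrightarrow> y = nxt1 x \<or> y = nxt2 x \<or> y = nxt3 x \<Longrightarrow> g (val y) (val x) = 0"
  by (auto simp: g_eq_0_iff val_nxt simp del: val.simps)

lemma e_system: "exchange_system states (\<lambda>L. addable (boxes L)) add_at e_amp val sg1 sg2"
proof unfold_locales
  fix L x y z
  show "add_at L x \<in> states" if "L \<in> states" "addable (boxes L) x" by (rule add_at_state(1)[OF that])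
  show "finite {x. addable (boxes L) x}" if "L \<in> states" by (rule finite_corner_boxes(1)[OF that])
  show "val x \<noteq> 0" by (rule val_nonzero)
  show "addable (boxes (add_at L x)) y \<and> add_at (add_at L x) y = add_at (add_at L y) x"
    if "L \<in> states" "addable (boxes L) x" "addable (boxes L) y" "x \<noteq> y"
    using add_at_commute[OF that] by simp
  show "e_amp L x * e_amp (add_at L x) y * cubic sg1 sg2 (val y) (val x)
      = - (e_amp L y * e_amp (add_at L y) x * cubic sg1 sg2 (val x) (val y))"
    if "L \<in> states" "addable (boxes L) x" "addable (boxes L) y" "x \<noteq> y"
    using ee_exchange[OF that] unfolding g_cubic(1) .
  show "cubic sg1 sg2 (val y) (val x) = 0"
    if "L \<in> states" "addable (boxes L) x" "addable (boxes (add_at L x)) y" "\<not> addable (boxes L) y"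
    using nxt_val_g[OF addableD(1)[OF that(2)]] addable_after that(3,4)
    unfolding add_at_state(2)[OF that(1,2)] g_cubic(1)[symmetric] by blast
  show "\<not> addable (boxes (add_at L x)) x" if "L \<in> states" "addable (boxes L) x"
    unfolding add_at_state(2)[OF that] by (auto simp: addable_def)
  show "cubic sg1 sg2 (val x) (val y) \<noteq> 0 \<or> cubic sg1 sg2 (val y) (val x) \<noteq> 0"
    using g_nondegenerate[OF val_nonzero] unfolding g_cubic(1) .
  show "\<not> (cubic sg1 sg2 (val x) (val z) = 0 \<and> cubic sg1 sg2 (val z) (val y) = 0 \<and> cubic sg1 sg2 (val y) (val x) = 0)"
    if "L \<in> states" "addable (boxes L) x" "addable (boxes (add_at L x)) y" "addable (boxes (add_at (add_at L x) y)) z"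
    using no_cycle_e[OF that] unfolding g_cubic(1) .
qed

lemma remove_at_commute:
  assumes L: "L \<in> states" and x: "removable (boxes L) x" and y: "removable (boxes L) y" and ne: "x \<noteq> y"
  shows "removable (boxes (remove_at L x)) y" "remove_at (remove_at L x) y = remove_at (remove_at L y) x"
proof -
  note X = remove_at_state[OF L x] and Y = remove_at_state[OF L y]
  show 1: "removable (boxes (remove_at L x)) y" using y ne unfolding X(2) removable_def by auto
  have 2: "removable (boxes (remove_at L y)) x" using x ne unfolding Y(2) removable_def by auto
  show "remove_at (remove_at L x) y = remove_at (remove_at L y) x"
    by (rule boxes_inj) (use remove_at_state(1,2)[OF X(1) 1] remove_at_state(1,2)[OF Y(1) 2] X(2) Y(2) in auto)
qed

text \<open>Removing boxes is adding boxes in the opposite order; accordingly the two arguments of \<open>g\<close> change places.\<close>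

lemma f_system: "exchange_system states (\<lambda>L. removable (boxes L)) remove_at (\<lambda>L x. f_amp (remove_at L x) x) val sg2 sg1"
proof unfold_locales
  fix L x y z
  show "remove_at L x \<in> states" if "L \<in> states" "removable (boxes L) x" by (rule remove_at_state(1)[OF that])
  show "finite {x. removable (boxes L) x}" if "L \<in> states" by (rule finite_corner_boxes(2)[OF that])
  show "val x \<noteq> 0" by (rule val_nonzero)
  show "removable (boxes (remove_at L x)) y \<and> remove_at (remove_at L x) y = remove_at (remove_at L y) x"
    if "L \<in> states" "removable (boxes L) x" "removable (boxes L) y" "x \<noteq> y"
    using remove_at_commute[OF that] by simp
  have neg: "cubic sg2 sg1 z w = - g w z" for z w by (simp add: g_cubic(2)[of w z])
  show "f_amp (remove_at L x) x * f_amp (remove_at (remove_at L x) y) y * cubic sg2 sg1 (val y) (val x)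
      = - (f_amp (remove_at L y) y * f_amp (remove_at (remove_at L y) x) x * cubic sg2 sg1 (val x) (val y))"
    if L: "L \<in> states" and x: "removable (boxes L) x" and y: "removable (boxes L) y" and ne: "x \<noteq> y"
  proof -
    note X = remove_at_state[OF L x] and Y = remove_at_state[OF L y]
    note c = remove_at_commute[OF L x y ne] and c' = remove_at_commute[OF L y x ne[symmetric]]
    define K where "K = remove_at (remove_at L x) y"
    note K = remove_at_state[OF X(1) c(1), folded K_def] and K' = remove_at_state[OF Y(1) c'(1), folded c(2) K_def]
    have "f_amp (add_at K x) y * f_amp K x * g (val y) (val x) = - (f_amp (add_at K y) x * f_amp K y * g (val x) (val y))"
      by (rule ff_exchange[OF K(1) K'(3) K(3) ne])
    then show ?thesis
      unfolding K(4) K'(4) neg c(2)[symmetric] K_def[symmetric] by simp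
  qed
  show "cubic sg2 sg1 (val y) (val x) = 0"
    if L: "L \<in> states" and x: "removable (boxes L) x" and y: "removable (boxes (remove_at L x)) y" "\<not> removable (boxes L) y"
  proof -
    have "x = nxt1 y \<or> x = nxt2 y \<or> x = nxt3 y"
      using y unfolding remove_at_state(2)[OF L x] removable_def by blast
    moreover have "y \<in> Box" by (rule removableD(1)[OF states_ideal[OF remove_at_state(1)[OF L x]] y(1)])
    ultimately show ?thesis using nxt_val_g unfolding neg by simp
  qed
  show "\<not> removable (boxes (remove_at L x)) x" if "L \<in> states" "removable (boxes L) x"
    unfolding remove_at_state(2)[OF that] by (auto simp: removable_def)
  show "cubic sg2 sg1 (val x) (val y) \<noteq> 0 \<or> cubic sg2 sg1 (val y) (val x) \<noteq> 0"
    using g_nondegenerate[OF val_nonzero, of x "val y"] unfolding neg by auto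
  show "\<not> (cubic sg2 sg1 (val x) (val z) = 0 \<and> cubic sg2 sg1 (val z) (val y) = 0 \<and> cubic sg2 sg1 (val y) (val x) = 0)"
    if L: "L \<in> states" and x: "removable (boxes L) x" and y: "removable (boxes (remove_at L x)) y"
      and z: "removable (boxes (remove_at (remove_at L x) y)) z"
  proof -
    note X = remove_at_state[OF L x]
    note Y = remove_at_state[OF X(1) y]
    note Z = remove_at_state[OF Y(1) z]
    have "\<not> (g (val z) (val x) = 0 \<and> g (val x) (val y) = 0 \<and> g (val y) (val z) = 0)"
      by (rule no_cycle_e[OF Z(1,3)]) (simp_all add: Z(4) Y(3,4) X(3))
    then show ?thesis unfolding neg by auto
  qed
qed

section \<open>The action of the generators\<close>

fun gen_act :: "generator \<Rightarrow> tuple \<Rightarrow> (tuple \<Rightarrow>\<^sub>0 complex)" where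
  "gen_act (Mode (E k)) L = (\<Sum>x | addable (boxes L) x. Poly_Mapping.single (add_at L x) (val x powi k * e_amp L x))"
| "gen_act (Mode (F k)) L =
     (\<Sum>x | removable (boxes L) x. Poly_Mapping.single (remove_at L x) (val x powi k * f_amp (remove_at L x) x))"
| "gen_act (Mode (PsiP k)) L = Poly_Mapping.single L (psi_series fls_X L $$ int k)"
| "gen_act (Mode (PsiM k)) L = Poly_Mapping.single L (psi_series fls_X_inv L $$ int k)"
| "gen_act PsiP0_inv L = Poly_Mapping.single L (inverse (psi_series fls_X L $$ 0))"
| "gen_act PsiM0_inv L = Poly_Mapping.single L (inverse (psi_series fls_X_inv L $$ 0))"

lemma add_at_inj:
  assumes L: "L \<in> states" and "addable (boxes L) x" "addable (boxes L) y" "add_at L x = add_at L y"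
  shows "x = y"
proof -
  have "insert x (boxes L) = insert y (boxes L)"
    using add_at_state(2)[OF L assms(2)] add_at_state(2)[OF L assms(3)] assms(4) by simp
  then show ?thesis using addableD(2)[OF assms(2)] addableD(2)[OF assms(3)] by blast
qed

text \<open>For \<open>e\<close> and \<open>f\<close>, coefficients between tuples that do not differ by one box vanish identically, and
  adding a box leads from one basis vector of the module to another only if the box is addable.\<close>

lemma gen_act_coeff:
  assumes L: "L \<in> states" and M: "M \<in> states"
  shows "specializes id point (generic_coeff n X M L) (Poly_Mapping.lookup (gen_act (Mode X) L) M)"
proof (cases X)
  case (E k)
  have lk: "Poly_Mapping.lookup (gen_act (Mode (E k)) L) M
      = (\<Sum>x | addable (boxes L) x. if add_at L x = M then val x powi k * e_amp L x else 0)"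
    by (simp only: gen_act.simps lookup_sum lookup_single when_def)
  show ?thesis
  proof (cases "\<exists>x. addable (boxes L) x \<and> M = add_at L x")
    case True
    then obtain x where x: "addable (boxes L) x" "M = add_at L x" by blast
    obtain N where N: "height_bound (add_at L x) N" using height_bound_exists M x(2) by blast
    have "Poly_Mapping.lookup (gen_act (Mode (E k)) L) M = (\<Sum>y | addable (boxes L) y. if y = x then val x powi k * e_amp L x else 0)"
      unfolding lk by (rule sum.cong) (use add_at_inj[OF L] x in auto)
    also have "\<dots> = val x powi k * e_amp L x"
      using x(1) finite_corner_boxes(1)[OF L] by (simp add: sum.delta)
    finally show ?thesis using EF_coeff(1)[OF L x(1) N, of k] unfolding E x(2) amp_rows[OF L x(1) N] by simp
  next
    case False
    then have "Poly_Mapping.lookup (gen_act (Mode (E k)) L) M = 0"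
      unfolding lk by (intro sum.neutral) auto
    then show ?thesis unfolding E EF_coeff_zero(1)[OF L M False] using specializes_intros(4) by simp
  qed
next
  case (F k)
  have lk: "Poly_Mapping.lookup (gen_act (Mode (F k)) L) M
      = (\<Sum>x | removable (boxes L) x. if remove_at L x = M then val x powi k * f_amp (remove_at L x) x else 0)"
    by (simp only: gen_act.simps lookup_sum lookup_single when_def)
  show ?thesis
  proof (cases "\<exists>x. addable (boxes M) x \<and> L = add_at M x")
    case True
    then obtain x where x: "addable (boxes M) x" "L = add_at M x" by blast
    obtain N where N: "height_bound (add_at M x) N" using height_bound_exists L x(2) by blast
    have rx: "removable (boxes L) x" "remove_at L x = M" unfolding x(2) by (rule remove_add_at[OF M x(1)])+
    have yx: "y = x" if "removable (boxes L) y" "remove_at L y = M" for y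
      using add_at_inj[OF M _ x(1), of y] remove_at_state(3,4)[OF L that(1)] that(2) x(2) by simp
    have "Poly_Mapping.lookup (gen_act (Mode (F k)) L) M = (\<Sum>y | removable (boxes L) y. if y = x then val x powi k * f_amp M x else 0)"
      unfolding lk
    proof (rule sum.cong[OF refl])
      fix y assume "y \<in> {y. removable (boxes L) y}"
      then have y: "removable (boxes L) y" by simp
      show "(if remove_at L y = M then val y powi k * f_amp (remove_at L y) y else 0)
          = (if y = x then val x powi k * f_amp M x else 0)"
        using yx[OF y] rx(2) by (cases "y = x") (simp_all del: val.simps, blast)
    qed
    also have "\<dots> = val x powi k * f_amp M x"
      using rx(1) finite_corner_boxes(2)[OF L] by (simp add: sum.delta)
    finally show ?thesis using EF_coeff(2)[OF M x(1) N, of k] unfolding F x(2) amp_rows[OF M x(1) N] by simp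
  next
    case False
    have "remove_at L x \<noteq> M" if "removable (boxes L) x" for x
      using False remove_at_state(3,4)[OF L that] by metis
    then have "Poly_Mapping.lookup (gen_act (Mode (F k)) L) M = 0"
      unfolding lk by (intro sum.neutral) auto
    then show ?thesis unfolding F EF_coeff_zero(2)[OF M L False] using specializes_intros(4) by simp
  qed
next
  case (PsiP k)
  show ?thesis
  proof (cases "M = L")
    case True
    then show ?thesis using psi_specializes(1)[OF L] by (simp add: PsiP)
  next
    case False
    then show ?thesis using specializes_intros(4) by (simp add: PsiP generic_coeff_def lookup_single when_def)
  qed
next
  case (PsiM k)
  show ?thesis
  proof (cases "M = L")
    case True
    then show ?thesis using psi_specializes(2)[OF L] by (simp add: PsiM)
  next
    case False
    then show ?thesis using specializes_intros(4) by (simp add: PsiM generic_coeff_def lookup_single when_def)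
  qed
qed

definition psi_plus :: "tuple \<Rightarrow> int \<Rightarrow> complex" where "psi_plus L i = psi_series fls_X L $$ i"
definition psi_minus :: "tuple \<Rightarrow> int \<Rightarrow> complex" where "psi_minus L i = psi_series fls_X_inv L $$ (- i)"

text \<open>With \<open>\<psi>(z)\<close> as a Laurent series, the relations between \<open>\<psi>\<close> and \<open>e\<close>, \<open>f\<close> say how \<open>\<psi>\<close> changes
  when a box is added.\<close>

lemma psi_shift:
  assumes L: "L \<in> states" and x: "addable (boxes L) x" and psi: "\<Psi> = psi_plus \<or> \<Psi> = psi_minus"
  shows "shift_sum (gzw q1 q2 q3) (val x) (\<Psi> (add_at L x)) i + shift_sum (gwz q1 q2 q3) (val x) (\<Psi> L) i = 0"
  using psi
proof
  assume P: "\<Psi> = psi_plus"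
  have e: "\<Psi> M = (\<lambda>i. psi_series fls_X M $$ i)" for M by (simp add: P psi_plus_def fun_eq_iff)
  show ?thesis unfolding e shift_sum_fls(1,2)
    using psi_series_step[OF L x, of fls_X] by (simp add: fls_inverse_X del: val.simps)
next
  assume P: "\<Psi> = psi_minus"
  have e: "\<Psi> M = (\<lambda>i. psi_series fls_X_inv M $$ (- i))" for M by (simp add: P psi_minus_def fun_eq_iff)
  show ?thesis unfolding e shift_sum_fls(3,4)
    using psi_series_step[OF L x, of fls_X_inv] by (simp add: fls_inverse_X_inv del: val.simps)
qed

abbreviation A :: "free_alg \<Rightarrow> (tuple \<Rightarrow>\<^sub>0 complex) \<Rightarrow> (tuple \<Rightarrow>\<^sub>0 complex)" where "A \<equiv> free_act gen_act"

lemma A_psi: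
  assumes L: "L \<in> states"
  shows "A (gpsip i) (Poly_Mapping.single L c) = Poly_Mapping.single L (c * psi_plus L i)"
    and "A (gpsim i) (Poly_Mapping.single L c) = Poly_Mapping.single L (c * psi_minus L i)"
  using psi_series_nth_0(2)[OF L, of fls_X i] psi_series_nth_0(2)[OF L, of fls_X_inv "- i"]
  by (simp_all add: gpsip_def gpsim_def free_act_fgen lin_ext_single vscale_simps psi_plus_def psi_minus_def)

lemma A_e: "A (ge k) v = lin_ext (gen_act (Mode (E k))) v"
  and A_f: "A (gf k) v = lin_ext (gen_act (Mode (F k))) v"
  by (simp_all add: ge_def gf_def free_act_fgen)

lemma lin_ext_diff: "lin_ext \<phi> (v - w) = lin_ext \<phi> v - lin_ext \<phi> w"
proof -
  have "lin_ext \<phi> (v - w) + lin_ext \<phi> w = lin_ext \<phi> v" by (simp flip: lin_ext_add)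
  then show ?thesis by (simp add: algebra_simps)
qed

lemma rel_ee_zero:
  assumes L: "L \<in> states" and r: "r \<in> rel_ee q1 q2 q3"
  shows "A r (Poly_Mapping.single L 1) = 0"
proof -
  interpret e: exchange_system states "\<lambda>L. addable (boxes L)" add_at e_amp val sg1 sg2 by (rule e_system)
  have op: "gen_act (Mode (E k)) = e.op k" for k by (rule ext) (simp add: e.op_def)
  obtain i j where r: "r = series_mult (gzw q1 q2 q3) (\<lambda>i j. ge i * ge j) i j + series_mult (gwz q1 q2 q3) (\<lambda>i j. ge j * ge i) i j"
    using r by (auto simp: rel_ee_def)
  have 1: "A (ge i * ge j) (Poly_Mapping.single L 1)
      = (\<Sum>t\<in>e.chains2 L. vscale (val (snd t) powi i * val (fst t) powi j) (e.pair_vector L t))" for i j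
    by (simp only: free_act_mult A_e lin_ext_single op vscale_simps(4) e.op_op[OF L])
  have 2: "A (ge j * ge i) (Poly_Mapping.single L 1)
      = (\<Sum>t\<in>e.chains2 L. vscale (val (fst t) powi i * val (snd t) powi j) (e.pair_vector L t))" for i j
    unfolding 1 by (simp only: mult.commute)
  show ?thesis
    unfolding r free_act_add_left free_act_series_mult[where D = "\<lambda>i j. ge i * ge j", OF 1 val_nonzero]
      free_act_series_mult[where D = "\<lambda>i j. ge j * ge i", OF 2 val_nonzero]
      shift_sum_powi[OF val_nonzero] g_cubic(1) mult.assoc
    by (rule e.quadratic_relation[OF L])
qed

lemma rel_ff_zero:
  assumes L: "L \<in> states" and r: "r \<in> rel_ff q1 q2 q3"
  shows "A r (Poly_Mapping.single L 1) = 0"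
proof -
  interpret f: exchange_system states "\<lambda>L. removable (boxes L)" remove_at "\<lambda>L x. f_amp (remove_at L x) x" val sg2 sg1
    by (rule f_system)
  have op: "gen_act (Mode (F k)) = f.op k" for k by (rule ext) (simp add: f.op_def)
  obtain i j where r: "r = series_mult (gwz q1 q2 q3) (\<lambda>i j. gf i * gf j) i j + series_mult (gzw q1 q2 q3) (\<lambda>i j. gf j * gf i) i j"
    using r by (auto simp: rel_ff_def)
  have 1: "A (gf i * gf j) (Poly_Mapping.single L 1)
      = (\<Sum>t\<in>f.chains2 L. vscale (val (snd t) powi i * val (fst t) powi j) (f.pair_vector L t))" for i j
    by (simp only: free_act_mult A_f lin_ext_single op vscale_simps(4) f.op_op[OF L])
  have 2: "A (gf j * gf i) (Poly_Mapping.single L 1)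
      = (\<Sum>t\<in>f.chains2 L. vscale (val (fst t) powi i * val (snd t) powi j) (f.pair_vector L t))" for i j
    unfolding 1 by (simp only: mult.commute)
  have "A r (Poly_Mapping.single L 1) =
    - ((\<Sum>t\<in>f.chains2 L. vscale (f.G (snd t) (fst t) * (val (snd t) powi i * val (fst t) powi j)) (f.pair_vector L t))
     + (\<Sum>t\<in>f.chains2 L. vscale (f.G (snd t) (fst t) * (val (fst t) powi i * val (snd t) powi j)) (f.pair_vector L t)))"
    unfolding r free_act_add_left free_act_series_mult[where D = "\<lambda>i j. gf i * gf j", OF 1 val_nonzero]
      free_act_series_mult[where D = "\<lambda>i j. gf j * gf i", OF 2 val_nonzero]
      shift_sum_powi[OF val_nonzero] g_cubic(2) mult.assoc
    by (simp only: mult_minus_left vscale_simps(9) sum_negf minus_add_distrib)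
  then show ?thesis unfolding f.quadratic_relation[OF L] by simp
qed

lemma rel_psie_zero:
  assumes L: "L \<in> states" and r: "r \<in> rel_psie q1 q2 q3"
  shows "A r (Poly_Mapping.single L 1) = 0"
proof -
  obtain psi i j where r: "r = series_mult (gzw q1 q2 q3) (\<lambda>i j. psi i * ge j) i j + series_mult (gwz q1 q2 q3) (\<lambda>i j. ge j * psi i) i j"
    and psi: "psi = gpsip \<or> psi = gpsim"
    using r by (auto simp: rel_psie_def)
  obtain \<Psi> where P: "\<Psi> = psi_plus \<or> \<Psi> = psi_minus"
    and act: "\<And>M i c. M \<in> states \<Longrightarrow> A (psi i) (Poly_Mapping.single M c) = Poly_Mapping.single M (c * \<Psi> M i)"
    using psi A_psi by metis
  let ?T = "{x. addable (boxes L) x}" and ?c = "\<lambda>x. Poly_Mapping.single (add_at L x) (e_amp L x)"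
  have 1: "A (psi i * ge j) (Poly_Mapping.single L 1) = (\<Sum>x\<in>?T. vscale (\<Psi> (add_at L x) i * val x powi j) (?c x))" for i j
    unfolding free_act_mult A_e lin_ext_single vscale_simps(4) gen_act.simps free_act_sum
    by (rule sum.cong) (simp_all add: act add_at_state(1)[OF L] vscale_simps mult_ac del: val.simps)
  have 2: "A (ge j * psi i) (Poly_Mapping.single L 1) = (\<Sum>x\<in>?T. vscale (\<Psi> L i * val x powi j) (?c x))" for i j
    unfolding free_act_mult act[OF L] A_e lin_ext_single gen_act.simps vscale_sum
    by (rule sum.cong) (simp_all add: vscale_simps mult_ac del: val.simps)
  have "A r (Poly_Mapping.single L 1) = (\<Sum>x\<in>?T. vscale ((shift_sum (gzw q1 q2 q3) (val x) (\<Psi> (add_at L x)) i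
      + shift_sum (gwz q1 q2 q3) (val x) (\<Psi> L) i) * val x powi j) (?c x))"
    unfolding r free_act_add_left free_act_series_mult[where D = "\<lambda>i j. psi i * ge j", OF 1 val_nonzero]
      free_act_series_mult[where D = "\<lambda>i j. ge j * psi i", OF 2 val_nonzero]
    by (simp only: distrib_right vscale_simps(2) sum.distrib)
  also have "\<dots> = 0"
    by (rule sum.neutral) (simp add: psi_shift[OF L _ P] vscale_simps del: val.simps)
  finally show ?thesis .
qed

lemma rel_psif_zero:
  assumes L: "L \<in> states" and r: "r \<in> rel_psif q1 q2 q3"
  shows "A r (Poly_Mapping.single L 1) = 0"
proof -
  obtain psi i j where r: "r = series_mult (gwz q1 q2 q3) (\<lambda>i j. psi i * gf j) i j + series_mult (gzw q1 q2 q3) (\<lambda>i j. gf j * psi i) i j"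
    and psi: "psi = gpsip \<or> psi = gpsim"
    using r by (auto simp: rel_psif_def)
  obtain \<Psi> where P: "\<Psi> = psi_plus \<or> \<Psi> = psi_minus"
    and act: "\<And>M i c. M \<in> states \<Longrightarrow> A (psi i) (Poly_Mapping.single M c) = Poly_Mapping.single M (c * \<Psi> M i)"
    using psi A_psi by metis
  let ?T = "{x. removable (boxes L) x}" and ?c = "\<lambda>x. Poly_Mapping.single (remove_at L x) (f_amp (remove_at L x) x)"
  have 1: "A (psi i * gf j) (Poly_Mapping.single L 1) = (\<Sum>x\<in>?T. vscale (\<Psi> (remove_at L x) i * val x powi j) (?c x))" for i j
    unfolding free_act_mult A_f lin_ext_single vscale_simps(4) gen_act.simps free_act_sum
    by (rule sum.cong) (simp_all add: act remove_at_state(1)[OF L] vscale_simps mult_ac del: val.simps)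
  have 2: "A (gf j * psi i) (Poly_Mapping.single L 1) = (\<Sum>x\<in>?T. vscale (\<Psi> L i * val x powi j) (?c x))" for i j
    unfolding free_act_mult act[OF L] A_f lin_ext_single gen_act.simps vscale_sum
    by (rule sum.cong) (simp_all add: vscale_simps mult_ac del: val.simps)
  have "A r (Poly_Mapping.single L 1) = (\<Sum>x\<in>?T. vscale ((shift_sum (gzw q1 q2 q3) (val x) (\<Psi> L) i
      + shift_sum (gwz q1 q2 q3) (val x) (\<Psi> (remove_at L x)) i) * val x powi j) (?c x))"
    unfolding r free_act_add_left free_act_series_mult[where D = "\<lambda>i j. psi i * gf j", OF 1 val_nonzero]
      free_act_series_mult[where D = "\<lambda>i j. gf j * psi i", OF 2 val_nonzero]
    by (simp only: distrib_right vscale_simps(2) sum.distrib add.commute)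
  also have "\<dots> = 0"
  proof (rule sum.neutral, rule ballI)
    fix x assume "x \<in> ?T"
    then have x: "removable (boxes L) x" by simp
    show "vscale ((shift_sum (gzw q1 q2 q3) (val x) (\<Psi> L) i
      + shift_sum (gwz q1 q2 q3) (val x) (\<Psi> (remove_at L x)) i) * val x powi j) (?c x) = 0"
      using psi_shift[OF remove_at_state(1,3)[OF L x] P, of i] unfolding remove_at_state(4)[OF L x]
      by (simp add: vscale_simps del: val.simps)
  qed
  finally show ?thesis .
qed

lemma rel_psipsi_zero:
  assumes L: "L \<in> states" and r: "r \<in> rel_psipsi"
  shows "A r (Poly_Mapping.single L 1) = 0"
proof -
  have act: "\<exists>\<Psi>. \<forall>i c. A (psi i) (Poly_Mapping.single L c) = Poly_Mapping.single L (c * \<Psi> i)"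
    if "psi = gpsip \<or> psi = gpsim" for psi
    using that A_psi[OF L] by blast
  obtain psi psi' i j where r: "r = comm (psi i) (psi' j)" and psi: "psi = gpsip \<or> psi = gpsim" "psi' = gpsip \<or> psi' = gpsim"
    using r unfolding rel_psipsi_def by blast
  obtain \<Psi> where 1: "\<And>i c. A (psi i) (Poly_Mapping.single L c) = Poly_Mapping.single L (c * \<Psi> i)"
    using act[OF psi(1)] by blast
  obtain \<Psi>' where 2: "\<And>i c. A (psi' i) (Poly_Mapping.single L c) = Poly_Mapping.single L (c * \<Psi>' i)"
    using act[OF psi(2)] by blast
  show ?thesis
    unfolding r comm_def free_act_diff_left free_act_mult 1 2 by (simp add: mult.commute)
qed

lemma rel_inv_zero:
  assumes L: "L \<in> states" and r: "r \<in> rel_inv"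
  shows "A r (Poly_Mapping.single L 1) = 0"
proof -
  have "psi_plus L 0 \<noteq> 0" "psi_minus L 0 \<noteq> 0"
    using psi_series_nth_0(1)[OF L] by (simp_all add: psi_plus_def psi_minus_def)
  then show ?thesis
    using r A_psi[OF L] unfolding rel_inv_def
    by (auto simp: free_act_diff_left free_act_mult free_act_fgen lin_ext_single vscale_simps psi_plus_def psi_minus_def)
qed

lemma rel_serre_zero:
  assumes L: "L \<in> states" and r: "r \<in> rel_serre"
  shows "A r (Poly_Mapping.single L 1) = 0"
proof -
  interpret e: exchange_system states "\<lambda>L. addable (boxes L)" add_at e_amp val sg1 sg2 by (rule e_system)
  interpret f: exchange_system states "\<lambda>L. removable (boxes L)" remove_at "\<lambda>L x. f_amp (remove_at L x) x" val sg2 sg1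
    by (rule f_system)
  have op: "gen_act (Mode (E k)) = e.op k" "gen_act (Mode (F k)) = f.op k" for k
    by (rule ext, simp add: e.op_def f.op_def)+
  have "A (comm (ge 0) (comm (ge 1) (ge (-1)))) (Poly_Mapping.single L 1) = 0"
    unfolding comm_def free_act_diff_left free_act_mult A_e lin_ext_diff lin_ext_single op vscale_simps(4)
    by (rule e.serre_relation[OF L])
  moreover have "A (comm (gf 0) (comm (gf 1) (gf (-1)))) (Poly_Mapping.single L 1) = 0"
    unfolding comm_def free_act_diff_left free_act_mult A_f lin_ext_diff lin_ext_single op vscale_simps(4)
    by (rule f.serre_relation[OF L])
  ultimately show ?thesis using r by (auto simp: rel_serre_def)
qed

text \<open>Removing and adding different boxes commutes, and the amplitudes agree by \<open>ef_exchange\<close>.  What remains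
  is diagonal, where one adds or removes a box and undoes it.\<close>

lemma rel_ef_zero:
  assumes L: "L \<in> states" and r: "r \<in> rel_ef q1 q2 q3"
  shows "A r (Poly_Mapping.single L 1) = 0"
proof -
  obtain i j where r: "r = comm (ge i) (gf j) - fconst (1 / g 1 1) * (gpsip (i + j) - gpsim (i + j))"
    using r by (auto simp: rel_ef_def)
  define P where "P d x = Poly_Mapping.single (add_at (remove_at L d) x)
      (val d powi j * f_amp (remove_at L d) d * (val x powi i * e_amp (remove_at L d) x))" for d x
  define Q where "Q d x = Poly_Mapping.single (remove_at (add_at L x) d)
      (val x powi i * e_amp L x * (val d powi j * f_amp (remove_at (add_at L x) d) d))" for d x
  define T where "T = {(d, x). removable (boxes L) d \<and> addable (boxes (remove_at L d)) x}"
  define U where "U = {(d, x). addable (boxes L) x \<and> removable (boxes (add_at L x)) d}"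
  define OD where "OD = {(d, x). removable (boxes L) d \<and> addable (boxes L) x \<and> addable (boxes (remove_at L d)) x}"
  note fin = finite_corner_boxes[OF L]
  have finO: "finite OD" unfolding OD_def
    by (rule finite_subset[OF _ finite_cartesian_product[OF fin(2,1)]]) auto
  have finI: "finite ((\<lambda>x. (x, x)) ` {x. removable (boxes L) x})" "finite ((\<lambda>x. (x, x)) ` {x. addable (boxes L) x})"
    using fin by auto
  \<comment> \<open>Off the diagonal, a box can be removed before or after another one is added.\<close>
  have T: "T = (\<lambda>x. (x, x)) ` {x. removable (boxes L) x} \<union> OD"
  proof -
    have *: "addable (boxes L) x" if d: "removable (boxes L) d" and x: "addable (boxes (remove_at L d)) x" "d \<noteq> x" for d x
      using add_at_commute(2)[OF remove_at_state(1,3)[OF L d] x(1) x(2)] unfolding remove_at_state(4)[OF L d] .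
    have "(d, x) \<in> T \<longleftrightarrow> (d, x) \<in> (\<lambda>x. (x, x)) ` {x. removable (boxes L) x} \<union> OD" for d x
    proof (cases "d = x")
      case True
      then show ?thesis using remove_at_state(3)[OF L, of x] unfolding T_def OD_def image_iff by blast
    next
      case False
      then show ?thesis using *[of d x] unfolding T_def OD_def image_iff by blast
    qed
    then show ?thesis by (simp only: set_eq_iff split_paired_All) blast
  qed
  have U: "U = (\<lambda>x. (x, x)) ` {x. addable (boxes L) x} \<union> OD"
  proof -
    have 1: "removable (boxes L) d" if x: "addable (boxes L) x" and d: "removable (boxes (add_at L x)) d" "d \<noteq> x" for d x
      using d x unfolding add_at_state(2)[OF L x] removable_def by auto
    have 2: "addable (boxes (remove_at L d)) x"
      if x: "addable (boxes L) x" and d: "removable (boxes (add_at L x)) d" "removable (boxes L) d" for d x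
    proof -
      have "x \<noteq> nxt1 d \<and> x \<noteq> nxt2 d \<and> x \<noteq> nxt3 d"
        using d(1) unfolding add_at_state(2)[OF L x] removable_def by blast
      then show ?thesis using x unfolding remove_at_state(2)[OF L d(2)] addable_def by blast
    qed
    have 3: "removable (boxes (add_at L x)) d"
      if x: "addable (boxes L) x" "addable (boxes (remove_at L d)) x" and d: "removable (boxes L) d" for d x
    proof -
      have dB: "d \<in> Box" using removableD(1)[OF states_ideal[OF L] d] .
      have "x \<noteq> nxt1 d \<and> x \<noteq> nxt2 d \<and> x \<noteq> nxt3 d"
        using x(2) dB unfolding remove_at_state(2)[OF L d] addable_def by blast
      then show ?thesis using d unfolding add_at_state(2)[OF L x(1)] removable_def by blast
    qed
    have "(d, x) \<in> U \<longleftrightarrow> (d, x) \<in> (\<lambda>x. (x, x)) ` {x. addable (boxes L) x} \<union> OD" for d x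
    proof (cases "d = x")
      case True
      then show ?thesis using remove_add_at(1)[OF L, of x] unfolding U_def OD_def image_iff by blast
    next
      case False
      then show ?thesis using 1[of x d] 2[of x d] 3[of x d] unfolding U_def OD_def image_iff by blast
    qed
    then show ?thesis by (simp only: set_eq_iff split_paired_All) blast
  qed
  have disj: "(\<lambda>x. (x, x)) ` {x. removable (boxes L) x} \<inter> OD = {}" "(\<lambda>x. (x, x)) ` {x. addable (boxes L) x} \<inter> OD = {}"
    by (auto simp: OD_def addable_def removable_def)
  have PQ: "P d x = Q d x" if dx: "(d, x) \<in> OD" for d x
  proof -
    have d: "removable (boxes L) d" and x: "addable (boxes L) x" using dx by (auto simp: OD_def)
    have ne: "x \<noteq> d" using d x by (auto simp: addable_def removable_def)
    define K where "K = remove_at L d"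
    note K = remove_at_state[OF L d, folded K_def]
    have "(d, x) \<in> T" using dx T by blast
    then have xK: "addable (boxes K) x" by (simp add: T_def K_def)
    note c = add_at_commute[OF K(1) xK K(3) ne]
    have e: "remove_at (add_at L x) d = add_at K x"
      using remove_add_at(2)[OF add_at_state(1)[OF K(1) xK] c(2)] unfolding c(1) K(4) .
    have "e_amp (add_at K d) x * f_amp (add_at K x) d = e_amp K x * f_amp K d"
      by (rule ef_exchange[OF K(1) xK K(3) ne])
    then have "e_amp L x * f_amp (add_at K x) d = e_amp K x * f_amp K d" unfolding K(4) .
    then show ?thesis unfolding P_def Q_def K_def[symmetric] e by (simp add: mult_ac)
  qed
  have actT: "A (ge i * gf j) (Poly_Mapping.single L 1) = (\<Sum>(d, x)\<in>T. P d x)"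
  proof -
    have "A (ge i * gf j) (Poly_Mapping.single L 1)
        = (\<Sum>d | removable (boxes L) d. \<Sum>x | addable (boxes (remove_at L d)) x. P d x)"
      by (simp only: free_act_mult A_e A_f lin_ext_single vscale_simps gen_act.simps mult_1 lin_ext_sum vscale_sum P_def)
    moreover have "T = (SIGMA d:{d. removable (boxes L) d}. {x. addable (boxes (remove_at L d)) x})"
      by (auto simp: T_def)
    ultimately show ?thesis
      using fin(2) finite_corner_boxes(1)[OF remove_at_state(1)[OF L]] by (simp add: sum.Sigma)
  qed
  have actU: "A (gf j * ge i) (Poly_Mapping.single L 1) = (\<Sum>(d, x)\<in>U. Q d x)"
  proof -
    have "A (gf j * ge i) (Poly_Mapping.single L 1)
        = (\<Sum>x | addable (boxes L) x. \<Sum>d | removable (boxes (add_at L x)) d. Q d x)"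
      by (simp only: free_act_mult A_e A_f lin_ext_single vscale_simps gen_act.simps mult_1 lin_ext_sum vscale_sum Q_def)
    also have "\<dots> = (\<Sum>(x, d)\<in>(SIGMA x:{x. addable (boxes L) x}. {d. removable (boxes (add_at L x)) d}). Q d x)"
      using fin(1) finite_corner_boxes(2)[OF add_at_state(1)[OF L]] by (simp add: sum.Sigma)
    also have "\<dots> = (\<Sum>(d, x)\<in>U. Q d x)"
      by (rule sum.reindex_bij_witness[of _ prod.swap prod.swap]) (auto simp: U_def)
    finally show ?thesis .
  qed
  have "A (ge i * gf j) (Poly_Mapping.single L 1) - A (gf j * ge i) (Poly_Mapping.single L 1)
      = (\<Sum>x | removable (boxes L) x. P x x) - (\<Sum>x | addable (boxes L) x. Q x x)"
  proof -
    have "(\<Sum>(d, x)\<in>OD. P d x) = (\<Sum>(d, x)\<in>OD. Q d x)" by (rule sum.cong) (auto simp: PQ)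
    moreover have "(\<Sum>(d, x)\<in>(\<lambda>x. (x, x)) ` S. R d x) = (\<Sum>x\<in>S. R x x)" for S and R :: "box \<Rightarrow> box \<Rightarrow> (tuple \<Rightarrow>\<^sub>0 complex)"
      by (subst sum.reindex) (auto simp: inj_on_def)
    ultimately show ?thesis
      unfolding actT actU T U sum.union_disjoint[OF finI(1) finO disj(1)] sum.union_disjoint[OF finI(2) finO disj(2)]
      by simp
  qed
  also have "\<dots> = Poly_Mapping.single L
      ((\<Sum>x | removable (boxes L) x. e_amp (remove_at L x) x * f_amp (remove_at L x) x * val x powi (i + j))
        - (\<Sum>x | addable (boxes L) x. e_amp L x * f_amp L x * val x powi (i + j)))"
  proof -
    have "P x x = Poly_Mapping.single L (e_amp (remove_at L x) x * f_amp (remove_at L x) x * val x powi (i + j))"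
      if "removable (boxes L) x" for x
      unfolding P_def remove_at_state(4)[OF L that] using val_nonzero[of x] by (simp add: power_int_add mult_ac del: val.simps)
    moreover have "Q x x = Poly_Mapping.single L (e_amp L x * f_amp L x * val x powi (i + j))"
      if "addable (boxes L) x" for x
      unfolding Q_def remove_add_at(2)[OF L that] using val_nonzero[of x] by (simp add: power_int_add mult_ac del: val.simps)
    ultimately show ?thesis by (simp add: single_diff single_sum[symmetric] del: val.simps)
  qed
  also have "\<dots> = Poly_Mapping.single L (1 / g 1 1 * (psi_plus L (i + j) - psi_minus L (i + j)))"
    unfolding ef_diagonal[OF L] psi_plus_def psi_minus_def ..
  finally show ?thesis
    unfolding r comm_def by (simp add: free_act_diff_left free_act_mult A_psi[OF L] vscale_simps right_diff_distrib single_diff)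
qed

lemma relations_zero:
  assumes "L \<in> states" "r \<in> relations q1 q2 q3"
  shows "A r (Poly_Mapping.single L 1) = 0"
  using assms rel_ee_zero rel_ff_zero rel_psie_zero rel_psif_zero rel_ef_zero rel_psipsi_zero rel_inv_zero rel_serre_zero
  unfolding relations_def by blast

end

section \<open>Modules over the quotient algebra\<close>

lemma free_ring_ring: "ring free_ring"
  by unfold_locales
    (auto simp: free_ring_def Units_def algebra_simps intro: exI[of _ "- x" for x])

definition supported_on :: "'b set \<Rightarrow> ('b \<Rightarrow>\<^sub>0 complex) set" where
  "supported_on S = {v. Poly_Mapping.keys v \<subseteq> S}"

lemma supported_on_iff: "v \<in> supported_on S \<longleftrightarrow> (\<forall>L. L \<notin> S \<longrightarrow> Poly_Mapping.lookup v L = 0)"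
  by (auto simp: supported_on_def in_keys_iff)

lemma supported_on_subspace: "subspace_of_free (supported_on S)"
  by (auto simp: subspace_of_free_def supported_on_iff lookup_add)

lemma supported_on_sum: "(\<And>x. x \<in> A \<Longrightarrow> f x \<in> supported_on S) \<Longrightarrow> (\<Sum>x\<in>A. f x) \<in> supported_on S"
  by (simp add: supported_on_iff lookup_sum)

lemma supported_on_vscale: "v \<in> supported_on S \<Longrightarrow> vscale c v \<in> supported_on S"
  by (simp add: supported_on_iff)

lemma supported_on_single: "L \<in> S \<Longrightarrow> Poly_Mapping.single L c \<in> supported_on S"
  by (auto simp: supported_on_iff lookup_single when_def)

lemma lin_ext_supported:
  assumes "\<And>L. L \<in> S \<Longrightarrow> \<phi> L \<in> supported_on T" "v \<in> supported_on S"
  shows "lin_ext \<phi> v \<in> supported_on T"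
  unfolding lin_ext_def
  by (intro supported_on_sum supported_on_vscale) (use assms in \<open>auto simp: supported_on_def\<close>)

text \<open>The component of degree \<open>d\<close> is the part of \<open>v\<close> supported on the basis vectors of degree \<open>d\<close>.\<close>

lemma decomposition_by_degree:
  fixes v :: "'b \<Rightarrow>\<^sub>0 complex" and deg :: "'b \<Rightarrow> int"
  assumes v: "v \<in> supported_on S"
  shows "\<exists>!w. finite {d. w d \<noteq> 0} \<and> (\<forall>d. w d \<in> supported_on {L \<in> S. deg L = d})
    \<and> v = (\<Sum>d | w d \<noteq> 0. w d)"
proof -
  have lookup_sum_degree: "Poly_Mapping.lookup (\<Sum>d | w d \<noteq> 0. w d) L = Poly_Mapping.lookup (w (deg L)) L"
    if fin: "finite {d. w d \<noteq> 0}" and w: "\<forall>d. w d \<in> supported_on {L \<in> S. deg L = d}"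
    for w :: "int \<Rightarrow> ('b \<Rightarrow>\<^sub>0 complex)" and L
  proof -
    have "Poly_Mapping.lookup (\<Sum>d | w d \<noteq> 0. w d) L
        = (\<Sum>d | w d \<noteq> 0. if d = deg L then Poly_Mapping.lookup (w (deg L)) L else 0)"
      unfolding lookup_sum by (rule sum.cong) (use w in \<open>auto simp: supported_on_iff\<close>)
    also have "\<dots> = Poly_Mapping.lookup (w (deg L)) L" using fin by (simp add: sum.delta)
    finally show ?thesis .
  qed
  define w0 :: "int \<Rightarrow> ('b \<Rightarrow>\<^sub>0 complex)" where
    "w0 d = (\<Sum>L\<in>{L \<in> Poly_Mapping.keys v. deg L = d}. Poly_Mapping.single L (Poly_Mapping.lookup v L))" for d
  have lookup_w0: "Poly_Mapping.lookup (w0 d) L = (if deg L = d then Poly_Mapping.lookup v L else 0)" for d L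
  proof -
    have "Poly_Mapping.lookup (w0 d) L
        = (\<Sum>K\<in>{K \<in> Poly_Mapping.keys v. deg K = d}. if K = L then Poly_Mapping.lookup v L else 0)"
      unfolding w0_def lookup_sum by (rule sum.cong) (auto simp: lookup_single when_def)
    also have "\<dots> = (if deg L = d then Poly_Mapping.lookup v L else 0)"
      by (simp add: sum.delta in_keys_iff)
    finally show ?thesis .
  qed
  have "{d. w0 d \<noteq> 0} \<subseteq> deg ` Poly_Mapping.keys v"
  proof
    fix d assume "d \<in> {d. w0 d \<noteq> 0}"
    then have "w0 d \<noteq> 0" by simp
    then have "{L \<in> Poly_Mapping.keys v. deg L = d} \<noteq> {}" unfolding w0_def by (metis sum.empty)
    then show "d \<in> deg ` Poly_Mapping.keys v" by blast
  qed
  then have fin0: "finite {d. w0 d \<noteq> 0}" by (rule finite_subset) simp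
  have supp0: "\<forall>d. w0 d \<in> supported_on {L \<in> S. deg L = d}"
    using v by (auto simp: supported_on_iff lookup_w0)
  show ?thesis
  proof (rule ex1I[of _ w0], intro conjI)
    show "v = (\<Sum>d | w0 d \<noteq> 0. w0 d)"
      by (rule poly_mapping_eqI) (simp add: lookup_sum_degree[OF fin0 supp0] lookup_w0)
  next
    fix w assume w: "finite {d. w d \<noteq> 0} \<and> (\<forall>d. w d \<in> supported_on {L \<in> S. deg L = d})
      \<and> v = (\<Sum>d | w d \<noteq> 0. w d)"
    have lv: "Poly_Mapping.lookup v L = Poly_Mapping.lookup (w (deg L)) L" for L
      using lookup_sum_degree[of w L] w by simp
    have "Poly_Mapping.lookup (w d) L = Poly_Mapping.lookup (w0 d) L" for d L
    proof (cases "deg L = d")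
      case False
      have "w d \<in> supported_on {L \<in> S. deg L = d}" using w by blast
      with False show ?thesis by (auto simp: supported_on_iff lookup_w0)
    qed (auto simp: lookup_w0 lv)
    then show "w = w0" by (auto intro!: ext poly_mapping_eqI)
  qed (use fin0 supp0 in auto)
qed

text \<open>An action of the free algebra that kills the defining relations on a basis descends to the
  quotient, because the elements acting by zero form a two-sided ideal.\<close>

lemma graded_module_of_relations:
  fixes \<phi> :: "generator \<Rightarrow> 'b \<Rightarrow> ('b \<Rightarrow>\<^sub>0 complex)" and deg :: "'b \<Rightarrow> int"
  assumes hom: "\<And>g L. L \<in> S \<Longrightarrow> \<phi> g L \<in> supported_on {M \<in> S. deg M = deg L + gen_degree g}"
    and rel: "\<And>r L. r \<in> relations q1 q2 q3 \<Longrightarrow> L \<in> S \<Longrightarrow> free_act \<phi> r (Poly_Mapping.single L 1) = 0"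
  obtains act where
    "graded_alg_module (E_alg q1 q2 q3) (\<lambda>c. E_proj q1 q2 q3 (fconst c)) (E_homogeneous q1 q2 q3)
       (supported_on S) (\<lambda>d. supported_on {L \<in> S. deg L = d}) act"
    "\<And>x v. v \<in> supported_on S \<Longrightarrow> act (E_proj q1 q2 q3 x) v = free_act \<phi> x v"
proof -
  let ?V = "supported_on S" and ?D = "\<lambda>d. supported_on {L \<in> S. deg L = d}"
  let ?I = "rel_ideal q1 q2 q3" and ?\<pi> = "E_proj q1 q2 q3"
  interpret R: ring free_ring by (rule free_ring_ring)
  have D_mono: "?D d \<subseteq> ?V" for d by (auto simp: supported_on_def)
  have word_hom: "word_act \<phi> w v \<in> ?D (sum_list (map gen_degree w) + d)" if "v \<in> ?D d" for w v d
  proof (induction w)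
    case (Cons g w)
    have "\<phi> g L \<in> ?D (gen_degree g + (sum_list (map gen_degree w) + d))"
      if "L \<in> {L \<in> S. deg L = sum_list (map gen_degree w) + d}" for L
      using hom[of L g] that by (simp add: ac_simps)
    from lin_ext_supported[OF this Cons.IH] show ?case by (simp add: ac_simps)
  qed (use that in simp)
  have word_V: "word_act \<phi> w v \<in> ?V" if v: "v \<in> ?V" for w v
  proof (induction w)
    case (Cons g w)
    have "\<phi> g L \<in> ?V" if "L \<in> S" for L using hom[OF that, of g] by (auto simp: supported_on_def)
    from lin_ext_supported[OF this Cons.IH] show ?case by simp
  qed (use that in simp)
  have act_V: "free_act \<phi> x v \<in> ?V" if "v \<in> ?V" for x v
    unfolding free_act_def by (intro supported_on_sum supported_on_vscale word_V that)
  define J where "J = {x. \<forall>v\<in>?V. free_act \<phi> x v = 0}"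
  have "ideal J free_ring"
  proof (rule idealI[OF free_ring_ring])
    show "subgroup J (add_monoid free_ring)"
    proof (rule R.add.subgroupI)
      have "0 \<in> J" by (simp add: J_def)
      then show "J \<noteq> {}" by blast
      fix x assume x: "x \<in> J"
      have "\<ominus>\<^bsub>free_ring\<^esub> x = - x"
        by (rule R.minus_equality) (auto simp: free_ring_def)
      then show "\<ominus>\<^bsub>free_ring\<^esub> x \<in> J" using x by (simp add: J_def free_act_uminus_left)
    qed (auto simp: J_def free_ring_def free_act_add_left)
  qed (auto simp: J_def free_ring_def free_act_mult act_V)
  moreover have "relations q1 q2 q3 \<subseteq> J"
  proof
    fix r assume r: "r \<in> relations q1 q2 q3"
    have "free_act \<phi> r v = 0" if "v \<in> ?V" for v
      unfolding free_act_basis[of \<phi> r v]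
      by (rule sum.neutral) (use that rel[OF r] in \<open>auto simp: supported_on_def vscale_simps\<close>)
    then show "r \<in> J" by (simp add: J_def)
  qed
  ultimately have IJ: "?I \<subseteq> J" unfolding rel_ideal_def by (rule R.genideal_minimal)
  have "ideal ?I free_ring"
    unfolding rel_ideal_def by (rule R.genideal_ideal) (simp add: free_ring_def)
  then interpret I: ideal ?I free_ring .
  define act where "act X = free_act \<phi> (SOME x. x \<in> X)" for X
  have act: "act (?\<pi> x) v = free_act \<phi> x v" if v: "v \<in> ?V" for x v
  proof -
    have coset: "?\<pi> x = (\<lambda>h. h + x) ` ?I"
      by (auto simp: E_proj_def a_r_coset_def r_coset_def free_ring_def)
    have "0 \<in> ?I" using I.zero_closed by (simp add: free_ring_def)
    then have "x \<in> ?\<pi> x" unfolding coset by (metis add_0 image_eqI)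
    then have "(SOME y. y \<in> ?\<pi> x) \<in> ?\<pi> x" by (rule someI)
    then obtain h where h: "h \<in> ?I" "(SOME y. y \<in> ?\<pi> x) = h + x" unfolding coset by blast
    have "free_act \<phi> h v = 0" using h(1) IJ v by (auto simp: J_def)
    then show ?thesis unfolding act_def h(2) by (simp add: free_act_add_left)
  qed
  have carrier: "\<exists>x. X = ?\<pi> x" if "X \<in> carrier (E_alg q1 q2 q3)" for X
    using that by (auto simp: E_alg_def FactRing_def A_RCOSETS_defs E_proj_def a_r_coset_def)
  interpret h: ring_hom_ring free_ring "E_alg q1 q2 q3" ?\<pi>
    using I.rcos_ring_hom_ring unfolding E_alg_def E_proj_def .
  have \<pi>: "?\<pi> x \<oplus>\<^bsub>E_alg q1 q2 q3\<^esub> ?\<pi> y = ?\<pi> (x + y)" "?\<pi> x \<otimes>\<^bsub>E_alg q1 q2 q3\<^esub> ?\<pi> y = ?\<pi> (x * y)"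
    "\<one>\<^bsub>E_alg q1 q2 q3\<^esub> = ?\<pi> 1" for x y
    using h.hom_add[of x y] h.hom_mult[of x y] h.hom_one by (simp_all add: free_ring_def)
  have V_add: "v + w \<in> ?V" if "v \<in> ?V" "w \<in> ?V" for v w
    using that supported_on_subspace[of S] by (simp add: subspace_of_free_def)
  have "alg_module (E_alg q1 q2 q3) (\<lambda>c. ?\<pi> (fconst c)) ?V act"
    unfolding alg_module_def
  proof (intro conjI ballI allI)
    show "subspace_of_free ?V" by (rule supported_on_subspace)
  next
    fix X v assume "X \<in> carrier (E_alg q1 q2 q3)" and v: "v \<in> ?V"
    then obtain x where X: "X = ?\<pi> x" using carrier by blast
    show "act X v \<in> ?V" unfolding X act[OF v] by (rule act_V[OF v])
  next
    fix X v w assume "X \<in> carrier (E_alg q1 q2 q3)" and v: "v \<in> ?V" and w: "w \<in> ?V"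
    then obtain x where X: "X = ?\<pi> x" using carrier by blast
    show "act X (v + w) = act X v + act X w"
      unfolding X act[OF v] act[OF w] act[OF V_add[OF v w]] by (rule free_act_add)
  next
    fix X Y v assume "X \<in> carrier (E_alg q1 q2 q3)" "Y \<in> carrier (E_alg q1 q2 q3)" and v: "v \<in> ?V"
    then obtain x y where XY: "X = ?\<pi> x" "Y = ?\<pi> y" using carrier by blast
    show "act (X \<oplus>\<^bsub>E_alg q1 q2 q3\<^esub> Y) v = act X v + act Y v"
      unfolding XY \<pi> act[OF v] by (rule free_act_add_left)
    show "act (X \<otimes>\<^bsub>E_alg q1 q2 q3\<^esub> Y) v = act X (act Y v)"
      unfolding XY \<pi> act[OF v] act[OF act_V[OF v]] by (rule free_act_mult)
  next
    fix v assume v: "v \<in> ?V"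
    show "act \<one>\<^bsub>E_alg q1 q2 q3\<^esub> v = v" unfolding \<pi> act[OF v] by simp
  next
    fix c v assume v: "v \<in> ?V"
    show "act (?\<pi> (fconst c)) v = vscale c v" unfolding act[OF v] by simp
  qed
  moreover have "act X v \<in> ?D (k + d)" if X: "X \<in> E_homogeneous q1 q2 q3 k" and v: "v \<in> ?D d" for X v k d
  proof -
    obtain x where x: "X = ?\<pi> x" "\<forall>w\<in>Poly_Mapping.keys x. sum_list (map gen_degree w) = k"
      using X by (auto simp: E_homogeneous_def)
    have vV: "v \<in> ?V" using v D_mono by blast
    have "word_act \<phi> w v \<in> ?D (k + d)" if "w \<in> Poly_Mapping.keys x" for w
      using word_hom[OF v, of w] x(2) that by simp
    then show ?thesis
      unfolding x(1) act[OF vV] free_act_def by (intro supported_on_sum supported_on_vscale) auto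
  qed
  ultimately have "graded_alg_module (E_alg q1 q2 q3) (\<lambda>c. ?\<pi> (fconst c)) (E_homogeneous q1 q2 q3) ?V ?D act"
    unfolding graded_alg_module_def
    using supported_on_subspace D_mono decomposition_by_degree by blast
  then show ?thesis using that act by blast
qed

section \<open>The module at the resonance\<close>

lemma (in resonance) gen_act_homogeneous:
  assumes L: "L \<in> states"
  shows "gen_act x L \<in> supported_on {M \<in> states. int (tuple_degree n M) = int (tuple_degree n L) + gen_degree x}"
    (is "_ \<in> supported_on (?D x)")
proof -
  have add: "add_at L x \<in> ?D (Mode (E k))" if x: "addable (boxes L) x" for x :: box and k
  proof -
    note A = add_at_state[OF L x]
    have "tuple_degree n (add_at L x) = Suc (tuple_degree n L)"
      unfolding tuple_degree_card[OF A(1)] tuple_degree_card[OF L] A(2)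
      using finite_boxes[OF L] addableD(2)[OF x] by simp
    then show ?thesis using A(1) by simp
  qed
  have remove: "remove_at L x \<in> ?D (Mode (F k))" if x: "removable (boxes L) x" for x :: box and k
  proof -
    note R = remove_at_state[OF L x]
    have "Suc (tuple_degree n (remove_at L x)) = tuple_degree n L"
      unfolding tuple_degree_card[OF R(1)] tuple_degree_card[OF L] R(2)
      using finite_boxes[OF L] removableD(2)[OF states_ideal[OF L] x] by (rule card_Suc_Diff1)
    then show ?thesis using R(1) by simp
  qed
  have stay: "L \<in> ?D x" if "gen_degree x = 0" using L that by simp
  show ?thesis
  proof (cases x)
    case (Mode X)
    then show ?thesis
    proof (cases X)
      case (E k)
      then show ?thesis unfolding Mode E gen_act.simps
        by (intro supported_on_sum supported_on_single add) simp
    next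
      case (F k)
      then show ?thesis unfolding Mode F gen_act.simps
        by (intro supported_on_sum supported_on_single remove) simp
    qed (use stay in \<open>simp_all add: Mode supported_on_single\<close>)
  qed (use stay in \<open>simp_all add: supported_on_single\<close>)
qed

theorem proposition3p7:
  fixes n :: nat and a b :: "nat \<Rightarrow> nat" and p' p :: int and q1 q2 q3 u :: complex
  assumes n: "n \<ge> 2"
    and pp: "p' \<noteq> p"
    and an: "int (a n) = p' - 1 - (\<Sum>i\<in>{1..n-1}. (int (a i) + 1))"
    and bn: "int (b n) = p - 1 - (\<Sum>i\<in>{1..n-1}. (int (b i) + 1))"
    and q: "q1 * q2 * q3 = 1"
    and not_root_of_unity: "\<And>m::nat. m > 0 \<Longrightarrow> q1 ^ m \<noteq> 1 \<and> q2 ^ m \<noteq> 1 \<and> q3 ^ m \<noteq> 1"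
    and resonance: "\<And>x y::int. q1 powi x * q3 powi y = 1 \<longleftrightarrow> (\<exists>k::int. x = p' * k \<and> y = p * k)"
    and u: "u \<noteq> 0"
  shows "action_well_defined q1 q3 u a b n \<and>
    (\<exists>act :: free_alg set \<Rightarrow> (tuple \<Rightarrow>\<^sub>0 complex) \<Rightarrow> (tuple \<Rightarrow>\<^sub>0 complex).
       graded_alg_module (E_alg q1 q2 q3) (\<lambda>c. E_proj q1 q2 q3 (fconst c)) (E_homogeneous q1 q2 q3)
         (resonant_space a b n) (resonant_homogeneous a b n) act
       \<and> (\<forall>X. \<forall>L\<in>resonant_basis a b n. \<forall>M\<in>resonant_basis a b n.
            Poly_Mapping.lookup (act (E_proj q1 q2 q3 (fgen (Mode X))) (Poly_Mapping.single L 1)) M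
              = resonant_coeff q1 q3 u a b n X M L))"
proof -
  interpret resonance n a b p' p q1 q2 q3 u
    by unfold_locales (fact n an bn q not_root_of_unity resonance u)+
  have coeff: "specializes id point (generic_coeff n X M L) (Poly_Mapping.lookup (gen_act (Mode X) L) M)"
    if "L \<in> states" "M \<in> states" for X L M
    using gen_act_coeff[OF that] .
  have spaces: "resonant_space a b n = supported_on states"
    "resonant_homogeneous a b n = (\<lambda>d. supported_on {L \<in> states. int (tuple_degree n L) = d})"
    by (auto simp: resonant_space_def resonant_homogeneous_def supported_on_def fun_eq_iff)
  obtain act where
    module: "graded_alg_module (E_alg q1 q2 q3) (\<lambda>c. E_proj q1 q2 q3 (fconst c)) (E_homogeneous q1 q2 q3)
      (resonant_space a b n) (resonant_homogeneous a b n) act"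
    and act: "\<And>x v. v \<in> supported_on states \<Longrightarrow> act (E_proj q1 q2 q3 x) v = free_act gen_act x v"
    unfolding spaces
    by (rule graded_module_of_relations[where \<phi> = gen_act and S = states and deg = "\<lambda>L. int (tuple_degree n L)"])
       (use gen_act_homogeneous relations_zero in blast)+
  have "Poly_Mapping.lookup (act (E_proj q1 q2 q3 (fgen (Mode X))) (Poly_Mapping.single L 1)) M
      = resonant_coeff q1 q3 u a b n X M L" if "L \<in> states" "M \<in> states" for X L M
    unfolding act[OF supported_on_single[OF that(1)]] free_act_fgen lin_ext_single vscale_simps
    using coeff_values(3)[OF coeff[OF that]] by simp
  moreover have "action_well_defined q1 q3 u a b n"
    unfolding action_well_defined_def using coeff_values(1,2)[OF coeff] by blast
  ultimately show ?thesis using module by blast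
qed

end
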